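(* Suppose that $r$ is a rational number and that $n>1$ is an integer or a half-integer. For $s\in\hat{\mathbb{Q}}=\mathbb{Q}\cup\{\infty\}$, if $s$ or $s+1$ belongs to the $\Gamma(r;n)$-orbit of $\infty$, then there is an upper-meridian-pair-preserving epimorphism from the 2-bridge link group $G(K(s))$ to the Heckoid group $G(r;n)$.
   Context: Half-integer means an element of $\frac12\mathbb{Z}$; $\langle\langle\cdot\rangle\rangle$ denotes normal closure; $\pi_1$ of an orbifold is its orbifold fundamental group. Conway sphere. Let $H$ be the group of isometries of $\mathbb{R}^2$ generated by the $\pi$-rotations about the points of $\mathbb{Z}^2$. The Conway sphere is $(\boldsymbol{S}^2,\boldsymbol{P})=(\mathbb{R}^2,\mathbb{Z}^2)/H$ (a sphere with 4 marked points), and $\boldsymbol{S}=\boldsymbol{S}^2-\boldsymbol{P}$. For $s\in\hat{\mathbb{Q}}$, $\alpha_s$ is the simple loop in $\boldsymbol{S}$ obtained as the projection of a line of slope $s$ in $\mathbb{R}^2-\mathbb{Z}^2$; it also denotes the corresponding pair of mutually inverse conjugacy classes in $\pi_1(\boldsymbol{S})$. Tangles and 2-bridge links. A trivial tangle $(B^3,t)$ is a 3-ball with two properly embedded arcs simultaneously parallel to disjoint arcs in $\partial B^3$. Its core tunnel is the unknotted arc $\tau$ joining the two components of $t$. The meridian pair of $\pi_1(B^3-t)$ is the generating pair $(\mu_1,\mu_2)$, each $\mu_i$ represented by a small loop around a component of $t$ joined to a base point in the interior of $\tau$ along a subarc of $\tau$; it is well defined up to reversal of order, replacement of one member by its inverse,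 and simultaneous conjugation. A rational tangle $(B^3,t(r))$ of slope $r\in\hat{\mathbb{Q}}$ is a trivial tangle with boundary identified with the Conway sphere so that $\alpha_r$ bounds a disk in $B^3$ separating the components of $t(r)$. The 2-bridge link $K(r)$ is obtained by gluing $(B^3,t(\infty))$ (upper tangle) and $(B^3,t(r))$ (lower tangle) by the identity on the Conway sphere, and $G(K(r))=\pi_1(S^3-K(r))\cong\pi_1(\boldsymbol{S})/\langle\langle\alpha_\infty,\alpha_r\rangle\rangle$. Its upper meridian pair is the image of the meridian pair of $\pi_1(B^3-t(\infty))=\pi_1(\boldsymbol{S})/\langle\langle\alpha_\infty\rangle\rangle$. The orbifold $\boldsymbol{O}$. Let $\hat H$ be generated by the $\pi$-rotations about the points of $(\frac12\mathbb{Z})^2$, and $\boldsymbol{O}=(\mathbb{R}^2-\mathbb{Z}^2)/\hat H$, a once-punctured sphere with three cone points of order 2, so $\pi_1(\boldsymbol{O})=\langle P,Q,R\mid P^2=Q^2=R^2=1\rangle$. For $s\in\hat{\mathbb{Q}}$, $\beta_s$ is the simple loop in $\boldsymbol{O}$ that is the image of a line of slope $s$ avoiding $(\frac12\mathbb{Z})^2$ (and the corresponding pair of mutually inverse conjugacy classes); the generators are chosen so that $\beta_0,\beta_\infty$ are represented by $RQ,PQ$. $\boldsymbol{S}\to\boldsymbol{O}$ is a $(\mathbb{Z}/2\mathbb{Z})^2$-covering, $\pi_1(\boldsymbol{S})\lhd\pi_1(\boldsymbol{O})$, and $\alpha_s=\beta_s^2$. Heckoid groups ($r\in\mathbb{Q}$).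 If $n\ge2$ is an integer, $G(r;n)$ is the orbifold fundamental group of the orbifold with underlying space the exterior of $K(r)$ and singular set the core tunnel of the lower tangle with index $n$; $G(r;n)\cong\pi_1(\boldsymbol{S})/\langle\langle\alpha_\infty,\alpha_r^n\rangle\rangle$. If $n>1$ is a non-integral half-integer and $m=2n$, $G(r;n)$ is the image of the natural map $\pi_1(\boldsymbol{S})\to\pi_1(\boldsymbol{O})\to\pi_1(\boldsymbol{O})/\langle\langle\beta_\infty^2,\beta_r^m\rangle\rangle$. In either case there is a natural epimorphism $\pi_1(B^3-t(\infty))\to G(r;n)$, and the image of the meridian pair of $\pi_1(B^3-t(\infty))$ is the upper meridian pair of $G(r;n)$. An epimorphism $G(K(s))\to G(r;n)$ is upper-meridian-pair-preserving if it maps the upper meridian pair to the upper meridian pair. The group $\Gamma(r;n)$. Let $\mathcal{D}$ be the Farey tessellation of $\mathbb{H}^2$ by ideal triangles, obtained from the ideal triangle with vertices $0,1,\infty$ by repeated reflection in the edges; its set of ideal vertices is $\hat{\mathbb{Q}}$. $\Gamma_\infty$ is the group of automorphisms of $\mathcal{D}$ generated by the reflections in the edges of $\mathcal{D}$ with endpoint $\infty$. $C_r(2n)$ is the infinite cyclic group generated by the parabolic automorphism of $\mathcal{D}$ centered at the vertex $r$ which shifts by $2n$ units in the clockwise direction (one unit takes each edge of $\mathcal{D}$ ending at $r$ to the adjacent such edge). $\Gamma(r;n)$ is the group generated by $\Gamma_\infty$ and $C_r(2n)$; it acts on $\hat{\mathbb{Q}}$. *)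

theory Defs
  imports "HOL-Analysis.Analysis" "HOL-Algebra.Bij" "HOL-Algebra.Coset" "HOL-Algebra.Generated_Groups"
begin

section \<open>Group theory\<close>

definition normal_closure :: "('a, 'b) monoid_scheme \<Rightarrow> 'a set \<Rightarrow> 'a set" where
  "normal_closure G X = \<Inter>{N. normal N G \<and> X \<subseteq> N}"

text \<open>The pairs obtained from \<open>(x, y)\<close> by reversing the order, replacing one member by its
  inverse, and simultaneous conjugation.\<close>

inductive_set pair_class :: "('a, 'b) monoid_scheme \<Rightarrow> 'a \<Rightarrow> 'a \<Rightarrow> ('a \<times> 'a) set"
  for G :: "('a, 'b) monoid_scheme" and x y :: 'a where
  base: "(x, y) \<in> pair_class G x y"
| swap: "(a, b) \<in> pair_class G x y \<Longrightarrow> (b, a) \<in> pair_class G x y"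
| inv1: "(a, b) \<in> pair_class G x y \<Longrightarrow> (inv\<^bsub>G\<^esub> a, b) \<in> pair_class G x y"
| conj: "(a, b) \<in> pair_class G x y \<Longrightarrow> g \<in> carrier G \<Longrightarrow>
    (g \<otimes>\<^bsub>G\<^esub> a \<otimes>\<^bsub>G\<^esub> inv\<^bsub>G\<^esub> g, g \<otimes>\<^bsub>G\<^esub> b \<otimes>\<^bsub>G\<^esub> inv\<^bsub>G\<^esub> g) \<in> pair_class G x y"

section \<open>Orbifold fundamental groups of quotients by group actions\<close>

definition path_class :: "'a::topological_space set \<Rightarrow> (real \<Rightarrow> 'a) \<Rightarrow> (real \<Rightarrow> 'a) set" where
  "path_class X p = {q. homotopic_paths X p q}"

text \<open>For a group \<open>F\<close> acting properly discontinuously on \<open>X\<close>, the orbifold fundamental group of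
  \<open>X/F\<close> is the group of lifts of elements of \<open>F\<close> to the universal covering of \<open>X\<close>. In terms of a
  base point \<open>x0\<close> of \<open>X\<close> such a lift is a pair of some \<open>g \<in> F\<close> and a homotopy class
  (relative to the end points) of paths in \<open>X\<close> from \<open>x0\<close> to \<open>g x0\<close>. If the action is free, this is
  the usual fundamental group of \<open>X/F\<close>: the pair is determined by the projected loop.\<close>

definition orbifold_pi1 ::
  "('a::real_normed_vector \<Rightarrow> 'a) set \<Rightarrow> 'a set \<Rightarrow> 'a \<Rightarrow> (('a \<Rightarrow> 'a) \<times> (real \<Rightarrow> 'a) set) monoid" where
  "orbifold_pi1 F X x0 =
    \<lparr>carrier = {(g, path_class X p) | g p. g \<in> F \<and> path p \<and> path_image p \<subseteq> X \<and>
                  pathstart p = x0 \<and> pathfinish p = g x0},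
     mult = (\<lambda>(g, C) (h, D).
       (g \<circ> h, {q. \<exists>c\<in>C. \<exists>d\<in>D. homotopic_paths X (c +++ (g \<circ> d)) q})),
     one = (\<lambda>x. x, path_class X (linepath x0 x0))\<rparr>"

section \<open>The Conway sphere and the orbifold \<open>O\<close>\<close>

text \<open>The Euclidean plane is identified with the complex numbers.\<close>

definition int_lattice :: "complex set" where
  "int_lattice = {z. Re z \<in> \<int> \<and> Im z \<in> \<int>}"

definition half_lattice :: "complex set" where
  "half_lattice = {z. 2 * z \<in> int_lattice}"

abbreviation pi_rotation :: "complex \<Rightarrow> complex \<Rightarrow> complex" where
  "pi_rotation c \<equiv> (\<lambda>z. 2 * c - z)"

definition H_group :: "(complex \<Rightarrow> complex) set" where
  "H_group = generate (BijGroup UNIV) {pi_rotation c | c. c \<in> int_lattice}"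

definition H_hat_group :: "(complex \<Rightarrow> complex) set" where
  "H_hat_group = generate (BijGroup UNIV) {pi_rotation c | c. c \<in> half_lattice}"

type_synonym pi1_element = "(complex \<Rightarrow> complex) \<times> (real \<Rightarrow> complex) set"

text \<open>The base point lies over the interior of the slope 0 arc of the Conway sphere that joins
  the images of 0 and 1.\<close>

definition base_point :: complex where
  "base_point = 1 / 4"

definition pi1_S :: "pi1_element monoid" where
  "pi1_S = orbifold_pi1 H_group (- int_lattice) base_point"

definition pi1_O :: "pi1_element monoid" where
  "pi1_O = orbifold_pi1 H_hat_group (- int_lattice) base_point"

lemma group_orbifold_pi1:
  fixes X :: "'a::real_normed_vector set"
  assumes F: "subgroup F (BijGroup UNIV)" and c: "\<And>g. g \<in> F \<Longrightarrow> continuous_on X g"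
    and m: "\<And>g. g \<in> F \<Longrightarrow> g ` X \<subseteq> X" and x0: "x0 \<in> X"
  shows "group (orbifold_pi1 F X x0)"
proof -
  let ?G = "orbifold_pi1 F X x0"
  have FB: "F \<subseteq> Bij UNIV" using subgroup.subset[OF F] by (simp add: BijGroup_def)
  have comp: "g \<circ> h \<in> F" if "g \<in> F" "h \<in> F" for g h
  proof -
    have "g \<otimes>\<^bsub>BijGroup UNIV\<^esub> h \<in> F" using F that by (simp add: subgroup.m_closed)
    moreover have "g \<otimes>\<^bsub>BijGroup UNIV\<^esub> h = g \<circ> h" using that FB
      by (auto simp: BijGroup_def compose_def restrict_def fun_eq_iff subset_iff)
    ultimately show ?thesis by simp
  qed
  have idF: "(\<lambda>x. x) \<in> F" using subgroup.one_closed[OF F] by (simp add: BijGroup_def restrict_def)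
  have invF: "\<exists>h\<in>F. h \<circ> g = (\<lambda>x. x) \<and> g \<circ> h = (\<lambda>x. x)" if "g \<in> F" for g
  proof -
    let ?h = "inv\<^bsub>BijGroup UNIV\<^esub> g"
    have h: "?h \<in> F" using F that by (simp add: subgroup.m_inv_closed)
    have gc: "g \<in> carrier (BijGroup UNIV)" using that subgroup.subset[OF F] by auto
    have hb: "?h \<in> Bij UNIV" "g \<in> Bij UNIV" using h that FB by auto
    have "?h \<otimes>\<^bsub>BijGroup UNIV\<^esub> g = \<one>\<^bsub>BijGroup UNIV\<^esub>" using gc group.l_inv[OF group_BijGroup] by blast
    moreover have "g \<otimes>\<^bsub>BijGroup UNIV\<^esub> ?h = \<one>\<^bsub>BijGroup UNIV\<^esub>" using gc group.r_inv[OF group_BijGroup] by blast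
    ultimately have "?h \<circ> g = (\<lambda>x. x)" "g \<circ> ?h = (\<lambda>x. x)" using hb
      by (auto simp: BijGroup_def compose_def restrict_def fun_eq_iff)
    then show ?thesis using h by blast
  qed
  define P where "P g p \<longleftrightarrow> g \<in> F \<and> path p \<and> path_image p \<subseteq> X \<and> pathstart p = x0 \<and> pathfinish p = g x0" for g p
  have carr: "carrier ?G = {(g, path_class X p) | g p. P g p}" by (simp add: orbifold_pi1_def P_def)
  have Pc: "P (g \<circ> h) (p +++ (g \<circ> q))" if "P g p" "P h q" for g h p q
  proof -
    have "path (g \<circ> q)" using that c[of g] unfolding P_def
      by (auto intro!: path_continuous_image intro: continuous_on_subset)
    moreover have "path_image (g \<circ> q) \<subseteq> X" using that m[of g] unfolding P_def by (auto simp: path_image_compose)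
    ultimately show ?thesis using that comp unfolding P_def
      by (auto simp: pathstart_compose pathfinish_compose path_image_join)
  qed
  have cls: "path_class X p = path_class X q \<longleftrightarrow> homotopic_paths X p q" if "P g p" for g p q
  proof
    assume "path_class X p = path_class X q"
    moreover have "p \<in> path_class X p" using that by (simp add: path_class_def P_def)
    ultimately have "p \<in> path_class X q" by simp
    then show "homotopic_paths X p q" by (simp add: path_class_def homotopic_paths_sym)
  next
    assume "homotopic_paths X p q"
    then show "path_class X p = path_class X q" unfolding path_class_def
      by (blast intro: homotopic_paths_trans homotopic_paths_sym)
  qed
  have mul: "(g, path_class X p) \<otimes>\<^bsub>?G\<^esub> (h, path_class X q) = (g \<circ> h, path_class X (p +++ (g \<circ> q)))"
    if "P g p" "P h q" for g h p q
  proof -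
    have 1: "homotopic_paths X (p +++ (g \<circ> q)) (c +++ (g \<circ> d))"
      if cd: "homotopic_paths X p c" "homotopic_paths X q d" for c d
    proof (rule homotopic_paths_join)
      show "homotopic_paths X p c" by fact
      show "homotopic_paths X (g \<circ> q) (g \<circ> d)"
        using cd(2) c[of g] m[of g] \<open>P g p\<close> by (intro homotopic_paths_continuous_image) (auto simp: P_def)
      show "pathfinish p = pathstart (g \<circ> q)" using that \<open>P g p\<close> \<open>P h q\<close> by (auto simp: P_def pathstart_compose)
    qed
    have r: "homotopic_paths X p p" "homotopic_paths X q q" using that by (auto simp: P_def)
    have "{s. \<exists>c\<in>path_class X p. \<exists>d\<in>path_class X q. homotopic_paths X (c +++ (g \<circ> d)) s} = path_class X (p +++ (g \<circ> q))"
      unfolding path_class_def using 1 r by (blast intro: homotopic_paths_trans)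
    then show ?thesis by (simp add: orbifold_pi1_def)
  qed
  have one: "P (\<lambda>x. x) (linepath x0 x0)" using idF x0 by (auto simp: P_def)
  have oneG: "\<one>\<^bsub>?G\<^esub> = (\<lambda>x. x, path_class X (linepath x0 x0))" by (simp add: orbifold_pi1_def)
  show ?thesis
  proof (rule groupI)
    show "x \<otimes>\<^bsub>?G\<^esub> y \<in> carrier ?G" if xy: "x \<in> carrier ?G" "y \<in> carrier ?G" for x y
    proof -
      obtain g p h q where d: "x = (g, path_class X p)" "P g p" "y = (h, path_class X q)" "P h q"
        using xy unfolding carr by blast
      show ?thesis unfolding d(1,3) mul[OF d(2,4)] carr using Pc[OF d(2,4)] by blast
    qed
    show "\<one>\<^bsub>?G\<^esub> \<in> carrier ?G" using one unfolding carr oneG by blast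
    show "x \<otimes>\<^bsub>?G\<^esub> y \<otimes>\<^bsub>?G\<^esub> z = x \<otimes>\<^bsub>?G\<^esub> (y \<otimes>\<^bsub>?G\<^esub> z)"
      if xyz: "x \<in> carrier ?G" "y \<in> carrier ?G" "z \<in> carrier ?G" for x y z
    proof -
      obtain g p h q k r where d: "x = (g, path_class X p)" "P g p" "y = (h, path_class X q)" "P h q" "z = (k, path_class X r)" "P k r"
        using xyz unfolding carr by blast
      have e: "g \<circ> (q +++ (h \<circ> r)) = (g \<circ> q) +++ ((g \<circ> h) \<circ> r)" by (auto simp: joinpaths_def fun_eq_iff)
      have "P (g\<circ>h\<circ>k) ((p +++ (g \<circ> q)) +++ ((g \<circ> h) \<circ> r))" using d Pc by blast
      moreover have "homotopic_paths X (p +++ (g \<circ> q) +++ ((g \<circ> h) \<circ> r)) ((p +++ (g \<circ> q)) +++ ((g \<circ> h) \<circ> r))"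
      proof (rule homotopic_paths_assoc)
        have "path (g \<circ> q)" "path_image (g \<circ> q) \<subseteq> X" if "P g p" "P h q" for g h p q
          using that c[of g] m[of g] unfolding P_def by (auto intro!: path_continuous_image intro: continuous_on_subset simp: path_image_compose)
        note Q = this
        show "path p" "path_image p \<subseteq> X" "path (g \<circ> q)" "path_image (g \<circ> q) \<subseteq> X"
          using d(2) Q[OF d(2,4)] by (simp_all add: P_def)
        show "path (g \<circ> h \<circ> r)" "path_image (g \<circ> h \<circ> r) \<subseteq> X" using Q[OF Pc[OF d(2,4)] d(6)] by auto
        show "pathfinish p = pathstart (g \<circ> q)" "pathfinish (g \<circ> q) = pathstart (g \<circ> h \<circ> r)"
          using d by (auto simp: P_def pathstart_compose pathfinish_compose)
      qed
      ultimately have "path_class X (p +++ (g \<circ> q) +++ ((g \<circ> h) \<circ> r)) = path_class X ((p +++ (g \<circ> q)) +++ ((g \<circ> h) \<circ> r))"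
        using cls homotopic_paths_sym by blast
      then show ?thesis unfolding d(1,3,5) mul[OF d(2,4)] mul[OF d(4,6)] mul[OF Pc[OF d(2,4)] d(6)] mul[OF d(2) Pc[OF d(4,6)]] e
        by (simp add: comp_assoc)
    qed
    show "\<one>\<^bsub>?G\<^esub> \<otimes>\<^bsub>?G\<^esub> x = x" if x: "x \<in> carrier ?G" for x
    proof -
      obtain g p where d: "x = (g, path_class X p)" "P g p" using x unfolding carr by blast
      have "homotopic_paths X (linepath x0 x0 +++ p) p" using d homotopic_paths_lid[of p X] by (auto simp: P_def)
      moreover have "(\<lambda>x. x) \<circ> g = g" "(\<lambda>x. x) \<circ> p = p" by auto
      ultimately show ?thesis using cls[OF d(2), of "linepath x0 x0 +++ p"] unfolding d(1) oneG mul[OF one d(2)]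
        by (simp add: homotopic_paths_sym)
    qed
    show "\<exists>y\<in>carrier ?G. y \<otimes>\<^bsub>?G\<^esub> x = \<one>\<^bsub>?G\<^esub>" if x: "x \<in> carrier ?G" for x
    proof -
      obtain g p where d: "x = (g, path_class X p)" "P g p" using x unfolding carr by blast
      obtain h where h: "h \<in> F" "h \<circ> g = (\<lambda>x. x)" using invF d(2) unfolding P_def by blast
      have pth: "path (h \<circ> p)" "path_image (h \<circ> p) \<subseteq> X" using d h c[of h] m[of h] unfolding P_def
        by (auto intro!: path_continuous_image intro: continuous_on_subset simp: path_image_compose)
      have hg: "h (g x0) = x0" using h(2) by (metis comp_apply)
      have Ph: "P h (reversepath (h \<circ> p))" using pth d h hg unfolding P_def
        by (auto simp: pathstart_compose pathfinish_compose)
      have "homotopic_paths X (reversepath (h \<circ> p) +++ (h \<circ> p)) (linepath x0 x0)"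
        using homotopic_paths_linv[OF pth] d hg by (auto simp: P_def pathfinish_compose)
      then have "path_class X (reversepath (h \<circ> p) +++ (h \<circ> p)) = path_class X (linepath x0 x0)"
        using cls[OF Pc[OF Ph d(2)]] by blast
      then have "(h, path_class X (reversepath (h \<circ> p))) \<otimes>\<^bsub>?G\<^esub> x = \<one>\<^bsub>?G\<^esub>"
        using mul[OF Ph d(2)] d h oneG by simp
      moreover have "(h, path_class X (reversepath (h \<circ> p))) \<in> carrier ?G" using Ph unfolding carr by blast
      ultimately show ?thesis by blast
    qed
  qed
qed


lemma generate_rotations:
  assumes S: "S \<subseteq> half_lattice"
  defines "F \<equiv> generate (BijGroup UNIV) {pi_rotation c | c. c \<in> S}"
  shows "subgroup F (BijGroup UNIV)"
    and "g \<in> F \<Longrightarrow> \<exists>e\<in>{1, -1}. \<exists>v\<in>int_lattice. g = (\<lambda>z. e * z + v)"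
proof -
  have rot: "pi_rotation c \<in> Bij UNIV" for c
    by (auto simp: Bij_def intro!: bij_betwI[where g = "pi_rotation c"])
  interpret B: group "BijGroup (UNIV :: complex set)" by (rule group_BijGroup)
  show F: "subgroup F (BijGroup UNIV)"
    unfolding F_def by (rule B.generate_is_subgroup) (auto simp: BijGroup_def intro: rot)
  have FB: "x \<in> Bij UNIV" if "x \<in> F" for x
    using that subgroup.subset[OF F] by (auto simp: BijGroup_def)
  have latt: "v - w \<in> int_lattice" "v + w \<in> int_lattice" if "v \<in> int_lattice" "w \<in> int_lattice" for v w
    using that by (auto simp: int_lattice_def)
  have inv_rot: "inv\<^bsub>BijGroup UNIV\<^esub> (pi_rotation c) = pi_rotation c" for c
    by (rule B.inv_equality) (use rot in \<open>auto simp: BijGroup_def compose_def restrict_def\<close>)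
  have gen: "\<exists>e\<in>{1, -1}. \<exists>v\<in>int_lattice. pi_rotation c = (\<lambda>z. e * z + v)" if "c \<in> S" for c
  proof (intro bexI)
    show "pi_rotation c = (\<lambda>z. - 1 * z + 2 * c)" by auto
  qed (use that S in \<open>auto simp: half_lattice_def\<close>)
  show "\<exists>e\<in>{1, -1}. \<exists>v\<in>int_lattice. g = (\<lambda>z. e * z + v)" if "g \<in> F" for g
    using that unfolding F_def
  proof induction
    case one
    show ?case
    proof (intro bexI)
      show "\<one>\<^bsub>BijGroup UNIV\<^esub> = (\<lambda>z::complex. 1 * z + 0)" by (auto simp: BijGroup_def)
    qed (auto simp: int_lattice_def)
  next
    case (incl h)
    then show ?case using gen by blast
  next
    case (inv h)
    then show ?case using gen inv_rot by fastforce
  next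
    case (eng h1 h2)
    then obtain e v e' v' where *: "e \<in> {1, -1}" "v \<in> int_lattice" "h1 = (\<lambda>z. e * z + v)"
      "e' \<in> {1, -1}" "v' \<in> int_lattice" "h2 = (\<lambda>z. e' * z + v')" by blast
    have "h1 \<otimes>\<^bsub>BijGroup UNIV\<^esub> h2 = (\<lambda>z. h1 (h2 z))"
      using FB eng.hyps unfolding F_def by (auto simp: BijGroup_def compose_def restrict_def)
    also have "\<dots> = (\<lambda>z. (e * e') * z + (e * v' + v))" by (simp add: * algebra_simps)
    finally have "h1 \<otimes>\<^bsub>BijGroup UNIV\<^esub> h2 = (\<lambda>z. (e * e') * z + (e * v' + v))" .
    moreover have "e * e' \<in> {1, -1}" "e * v' + v \<in> int_lattice" using * latt by auto
    ultimately show ?case by blast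
  qed
qed

lemma group_pi1_aux:
  assumes S: "S \<subseteq> half_lattice"
  shows "group (orbifold_pi1 (generate (BijGroup UNIV) {pi_rotation c | c. c \<in> S}) (- int_lattice) base_point)"
proof (rule group_orbifold_pi1)
  show "subgroup (generate (BijGroup UNIV) {pi_rotation c | c. c \<in> S}) (BijGroup UNIV)"
    using generate_rotations(1)[OF S] .
  show "base_point \<in> - int_lattice"
  proof
    assume "base_point \<in> int_lattice"
    then obtain k :: int where "of_int k = (1 / 4 :: real)"
      by (auto simp: int_lattice_def base_point_def elim!: Ints_cases)
    then have "of_int (4 * k) = (of_int 1 :: real)" by simp
    then show False by (simp only: of_int_eq_iff) presburger
  qed
  fix g assume "g \<in> generate (BijGroup UNIV) {pi_rotation c | c. c \<in> S}"
  then obtain e v where g: "e \<in> {1, -1}" "v \<in> int_lattice" "g = (\<lambda>z. e * z + v)"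
    using generate_rotations(2)[OF S] by blast
  show "continuous_on (- int_lattice) g" unfolding g by (intro continuous_intros)
  have "z \<in> int_lattice" if "e * z + v \<in> int_lattice" for z
  proof -
    have "Re (e * z) = Re (e * z + v) - Re v" "Im (e * z) = Im (e * z + v) - Im v" by simp_all
    then have "e * z \<in> int_lattice" using that g(2) unfolding int_lattice_def by (metis (mono_tags, lifting) Ints_diff mem_Collect_eq)
    then show ?thesis using g(1) by (auto simp: int_lattice_def)
  qed
  then show "g ` (- int_lattice) \<subseteq> - int_lattice" using g(3) by auto
qed

lemma group_pi1_S: "group pi1_S"
  unfolding pi1_S_def H_group_def
  by (rule group_pi1_aux) (auto simp: half_lattice_def int_lattice_def)

lemma group_pi1_O: "group pi1_O"
  unfolding pi1_O_def H_hat_group_def by (rule group_pi1_aux) simp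

text \<open>Extended rationals are represented by \<^typ>\<open>rat option\<close>, with \<^term>\<open>None\<close> as \<open>\<infinity>\<close>;
  \<open>num_den\<close> gives a coprime pair of numerator and denominator, and \<open>1/0\<close> for \<open>\<infinity>\<close>.\<close>

fun num_den :: "rat option \<Rightarrow> int \<times> int" where
  "num_den None = (1, 0)"
| "num_den (Some q) = quotient_of q"

definition slope_vector :: "rat option \<Rightarrow> complex" where
  "slope_vector s = (case num_den s of (a, b) \<Rightarrow> Complex (of_int b) (of_int a))"

text \<open>The closed loops obtained by projecting a line \<open>x + \<real>v\<close> that avoids \<open>A\<close>, where \<open>v\<close> is
  the shortest translation (up to sign) in the group that preserves the line. The loops are
  traversed once in either direction and joined to the base point by arbitrary paths \<open>p\<close>, so that
  the result is a pair of mutually inverse conjugacy classes.\<close>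

definition line_loops :: "complex set \<Rightarrow> complex \<Rightarrow> pi1_element set" where
  "line_loops A v =
    {(\<lambda>z. z + w,
      path_class (- int_lattice) (p +++ linepath x (x + w) +++ reversepath ((\<lambda>z. z + w) \<circ> p))) | p x w.
      w \<in> {v, - v} \<and> path p \<and> path_image p \<subseteq> - int_lattice \<and>
      pathstart p = base_point \<and> pathfinish p = x \<and> (\<forall>t::real. x + of_real t * v \<notin> A)}"

text \<open>The translations in \<open>H\<close> and \<open>H_hat\<close> are those by vectors in twice the integer lattice
  and in the integer lattice, respectively.\<close>

definition alpha :: "rat option \<Rightarrow> pi1_element set" where
  "alpha s = line_loops int_lattice (2 * slope_vector s)"

definition beta :: "rat option \<Rightarrow> pi1_element set" where
  "beta s = line_loops half_lattice (slope_vector s)"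

section \<open>2-bridge link groups, Heckoid groups and upper meridian pairs\<close>

text \<open>The group of the upper tangle, i.e. of the rational tangle of slope \<open>\<infinity>\<close>.\<close>

definition tangle_kernel :: "pi1_element set" where
  "tangle_kernel = normal_closure pi1_S (alpha None)"

definition tangle_group :: "pi1_element set monoid" where
  "tangle_group = pi1_S Mod tangle_kernel"

text \<open>For \<open>c = 0\<close> and \<open>c = 1\<close>: the loop on the Conway sphere around the marked point below \<open>c\<close>,
  joined to the base point along the segment from 0 to 1. It lifts to a half circle from the base
  point to its image under the rotation about \<open>c\<close>. The core tunnel of the upper tangle is
  parallel to the image of the segment from 0 to 1 (which meets the loop \<open>\<alpha>\<^sub>\<infinity>\<close> once),
  so that the two loops are meridians joined to the base point along the tunnel.\<close>

definition meridian :: "complex \<Rightarrow> pi1_element" where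
  "meridian c = (pi_rotation c,
     path_class (- int_lattice) (\<lambda>t. c + (base_point - c) * cis (pi * t)))"

definition tangle_meridian_pair :: "(pi1_element set \<times> pi1_element set) set" where
  "tangle_meridian_pair =
    pair_class tangle_group (tangle_kernel #>\<^bsub>pi1_S\<^esub> meridian 0) (tangle_kernel #>\<^bsub>pi1_S\<^esub> meridian 1)"

definition link_kernel :: "rat option \<Rightarrow> pi1_element set" where
  "link_kernel s = normal_closure pi1_S (alpha None \<union> alpha s)"

text \<open>By van Kampen's theorem, this is the fundamental group of the complement of \<open>K(s)\<close>.\<close>

definition link_group :: "rat option \<Rightarrow> pi1_element set monoid" where
  "link_group s = pi1_S Mod link_kernel s"

definition link_upper_pair :: "rat option \<Rightarrow> (pi1_element set \<times> pi1_element set) set" where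
  "link_upper_pair s =
    (let f = (\<lambda>C. link_kernel s <#>\<^bsub>pi1_S\<^esub> C) in map_prod f f ` tangle_meridian_pair)"

definition heckoid_kernel :: "rat \<Rightarrow> rat \<Rightarrow> pi1_element set" where
  "heckoid_kernel r n =
    (if n \<in> \<int> then
       normal_closure pi1_S
         (alpha None \<union> (\<lambda>x. x [^]\<^bsub>pi1_S\<^esub> nat \<lfloor>n\<rfloor>) ` alpha (Some r))
     else
       normal_closure pi1_O
         ((\<lambda>x. x [^]\<^bsub>pi1_O\<^esub> (2::nat)) ` beta None \<union>
          (\<lambda>x. x [^]\<^bsub>pi1_O\<^esub> nat \<lfloor>2 * n\<rfloor>) ` beta (Some r)))"

text \<open>For integral \<open>n\<close> this is the fundamental group of the orbifold whose underlying space is the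
  exterior of \<open>K(r)\<close> and whose singular set is the lower core tunnel with index \<open>n\<close>: the
  exterior of \<open>K(r)\<close> and this tunnel has fundamental group \<open>\<pi>\<^sub>1(S)/\<langle>\<langle>\<alpha>\<^sub>\<infinity>\<rangle>\<rangle>\<close>, and \<open>\<alpha>\<^sub>r\<close> is a
  meridian of the tunnel. Otherwise it is the image of \<open>\<pi>\<^sub>1(S)\<close> in a quotient of \<open>\<pi>\<^sub>1(O)\<close>.\<close>

definition heckoid_group :: "rat \<Rightarrow> rat \<Rightarrow> pi1_element set monoid" where
  "heckoid_group r n =
    (if n \<in> \<int> then pi1_S Mod heckoid_kernel r n
     else (pi1_O Mod heckoid_kernel r n)
       \<lparr>carrier := (\<lambda>x. heckoid_kernel r n #>\<^bsub>pi1_O\<^esub> x) ` carrier pi1_S\<rparr>)"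

text \<open>The multiplications of \<open>pi1_S\<close> and \<open>pi1_O\<close> are the same function, so \<open>f\<close> below is the
  natural map in both cases.\<close>

definition heckoid_upper_pair :: "rat \<Rightarrow> rat \<Rightarrow> (pi1_element set \<times> pi1_element set) set" where
  "heckoid_upper_pair r n =
    (let f = (\<lambda>C. heckoid_kernel r n <#>\<^bsub>pi1_O\<^esub> C) in map_prod f f ` tangle_meridian_pair)"

definition upper_meridian_pair_preserving ::
  "rat option \<Rightarrow> rat \<Rightarrow> rat \<Rightarrow> (pi1_element set \<Rightarrow> pi1_element set) \<Rightarrow> bool" where
  "upper_meridian_pair_preserving s r n f \<longleftrightarrow>
    map_prod f f ` link_upper_pair s = heckoid_upper_pair r n"

section \<open>The Farey tessellation and the group \<open>\<Gamma>(r; n)\<close>\<close>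

text \<open>The action on the extended rationals of the reflection of the hyperbolic plane in the geodesic
  with end points \<open>a \<noteq> b\<close>. If both are finite, it is the inversion in the circle with diameter
  \<open>[a, b]\<close>.\<close>

fun reflection :: "rat option \<Rightarrow> rat option \<Rightarrow> rat option \<Rightarrow> rat option" where
  "reflection None None x = x"
| "reflection None (Some b) x = map_option (\<lambda>t. 2 * b - t) x"
| "reflection (Some a) None x = map_option (\<lambda>t. 2 * a - t) x"
| "reflection (Some a) (Some b) None = Some ((a + b) / 2)"
| "reflection (Some a) (Some b) (Some t) =
     (if t = (a + b) / 2 then None
      else Some ((a + b) / 2 + ((b - a) / 2)\<^sup>2 / (t - (a + b) / 2)))"

inductive farey_triangle :: "rat option \<Rightarrow> rat option \<Rightarrow> rat option \<Rightarrow> bool" where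
  base: "farey_triangle (Some 0) (Some 1) None"
| swap: "farey_triangle a b c \<Longrightarrow> farey_triangle b a c"
| rotate: "farey_triangle a b c \<Longrightarrow> farey_triangle b c a"
| reflect: "farey_triangle a b c \<Longrightarrow> farey_triangle a b (reflection a b c)"

definition farey_edge :: "rat option \<Rightarrow> rat option \<Rightarrow> bool" where
  "farey_edge a b \<longleftrightarrow> (\<exists>c. farey_triangle a b c)"

text \<open>The parabolic automorphism centered at \<open>r = p/q\<close> that shifts the edges ending at \<open>r\<close> by one
  unit: on homogeneous coordinates it is the transvection \<open>v \<mapsto> v + det((p, q), v) (p, q)\<close>.
  If \<open>a/b\<close> is a Farey neighbour of \<open>r\<close>, then the determinant is \<open>\<plusminus>1\<close>, and the image
  \<open>(a \<plusminus> p)/(b \<plusminus> q)\<close> is the third vertex of a triangle that has the edge from \<open>r\<close> to \<open>a/b\<close>.\<close>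

definition unit_shift :: "rat \<Rightarrow> rat option \<Rightarrow> rat option" where
  "unit_shift r x =
    (case num_den (Some r) of (p, q) \<Rightarrow> case num_den x of (a, b) \<Rightarrow>
      let d = p * b - q * a; a' = a + d * p; b' = b + d * q
      in if b' = 0 then None else Some (of_int a' / of_int b'))"

text \<open>Automorphisms of the tessellation are represented by their (faithful) action on the ideal
  vertices. A cyclic group does not depend on the direction of the shift that generates it.\<close>

definition Gamma_inf :: "(rat option \<Rightarrow> rat option) set" where
  "Gamma_inf = generate (BijGroup UNIV) {reflection None b | b. farey_edge None b}"

definition C_group :: "rat \<Rightarrow> nat \<Rightarrow> (rat option \<Rightarrow> rat option) set" where
  "C_group r k = generate (BijGroup UNIV) {unit_shift r ^^ k}"

definition Gamma :: "rat \<Rightarrow> rat \<Rightarrow> (rat option \<Rightarrow> rat option) set" where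
  "Gamma r n = generate (BijGroup UNIV) (Gamma_inf \<union> C_group r (nat \<lfloor>2 * n\<rfloor>))"

definition Gamma_orbit :: "rat \<Rightarrow> rat \<Rightarrow> rat option \<Rightarrow> rat option set" where
  "Gamma_orbit r n x = (\<lambda>g. g x) ` Gamma r n"

end

theory Submission
  imports Defs
begin

text \<open>
  Let \<open>K \<subseteq> \<pi>\<^sub>1(O)\<close> be the kernel that defines \<open>G(r; n)\<close>. It is normal in \<open>\<pi>\<^sub>1(O)\<close> and contains
  \<open>\<beta>\<^sub>\<infinity>\<^sup>2\<close>, \<open>\<beta>\<^sub>r\<^bsup>2n\<^esup>\<close> and \<open>\<alpha>\<^sub>\<infinity>\<close>, whether \<open>n\<close> is an integer or not (\<open>heckoid_kernel_properties\<close>). If \<open>\<alpha>\<^sub>s \<subseteq> K\<close>, the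
  identity of \<open>\<pi>\<^sub>1(S)\<close> induces an epimorphism \<open>G(K(s)) \<rightarrow> G(r; n)\<close> that preserves the upper meridian pair
  (\<open>induced_epimorphism\<close>). The main point is therefore that \<open>\<alpha>\<^sub>t \<subseteq> K\<close> holds for all slopes \<open>t\<close> in the orbit
  of \<open>\<infinity>\<close>, or that the condition \<open>\<alpha>\<^sub>t \<subseteq> K\<close> is invariant under \<open>\<Gamma>(r; n)\<close> (\<open>alpha_orbit\<close>).

  An integral linear map \<open>A\<close> of determinant \<open>\<plusminus>1\<close> acts on the plane without the lattice, hence, up to a
  choice of path between base points, on \<open>\<pi>\<^sub>1(O)\<close>, and takes \<open>\<alpha>\<^sub>s\<close> and \<open>\<beta>\<^sub>s\<close> to the corresponding sets for
  the image slope (\<open>transport\<close>, \<open>transport_line_elements\<close>). If it acts on the quotient by \<open>K\<close> as an inner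
  automorphism, then \<open>\<alpha>\<^sub>t \<subseteq> K\<close> is equivalent to the same condition for the image of \<open>t\<close>. After a linear
  change of coordinates that moves \<open>r\<close> to \<open>\<infinity>\<close>, this has to be shown for two kinds of maps: the shear
  \<open>(x, y) \<mapsto> (x, y + kx)\<close>, a power of the half twist along \<open>\<beta>\<^sub>\<infinity>\<close>, modulo \<open>\<beta>\<^sub>\<infinity>\<^sup>k\<close>; and the reflection
  \<open>(x, y) \<mapsto> (-x, y)\<close> modulo \<open>\<beta>\<^sub>\<infinity>\<^sup>2\<close>.

  Both maps fix the point \<open>i/2\<close>. With this base point, \<open>\<pi>\<^sub>1(O)\<close> is generated by involutions \<open>R\<close>, \<open>E\<^sub>0\<close> and
  \<open>E\<^sub>1\<close>, where \<open>R\<close> lifts the rotation about \<open>i/2\<close>, and \<open>E\<^sub>j\<close> the rotation about \<open>1/2 + ij/2\<close>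
  (\<open>pi1_A_generated\<close>, by Macbeath's argument on the translates of a convex open set). The product
  \<open>E\<^sub>j E\<^bsub>j+1\<^esub>\<close> does not depend on \<open>j\<close> and belongs to \<open>\<beta>\<^sub>\<infinity>\<close>, so \<open>E\<^bsub>j+k\<^esub> = E\<^sub>j\<close> modulo \<open>\<beta>\<^sub>\<infinity>\<^sup>k\<close>. The shear fixes
  \<open>R\<close> and takes \<open>E\<^sub>j\<close> to \<open>E\<^bsub>j+k\<^esub>\<close>, so it acts trivially. The reflection fixes \<open>R\<close> and takes \<open>E\<^sub>j\<close> to
  \<open>R E\<^bsub>2-j\<^esub> R\<close>, so modulo \<open>\<beta>\<^sub>\<infinity>\<^sup>2\<close> it is conjugation by \<open>R\<close>.

  If \<open>s + 1\<close> lies in the orbit, the identity is replaced by the half twist, the shear with \<open>k = 1\<close>. It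
  takes \<open>\<alpha>\<^sub>s\<close> to \<open>\<alpha>\<^bsub>s+1\<^esub>\<close> and fixes the meridian \<open>R E\<^sub>1 E\<^sub>0\<close>, and modulo \<open>\<beta>\<^sub>\<infinity>\<^sup>2\<close> it inverts the meridian
  \<open>E\<^sub>0 R E\<^sub>1\<close>.
\<close>

section \<open>The fundamental groupoid of the punctured plane\<close>

abbreviation punctured_plane :: "complex set" where
  "punctured_plane \<equiv> - int_lattice"

text \<open>Homotopy classes are composed as sets of paths. In these terms the product of
  \<^const>\<open>orbifold_pi1\<close> is \<open>(g, C) (h, D) = (g \<circ> h, C \<odot> cimg g D)\<close>, and computations with paths
  become algebra in a groupoid. The operations are meaningful on \<open>arrows\<close> only.\<close>

definition arrows :: "complex \<Rightarrow> complex \<Rightarrow> (real \<Rightarrow> complex) set set" where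
  "arrows a b = {path_class punctured_plane p | p.
     path p \<and> path_image p \<subseteq> punctured_plane \<and> pathstart p = a \<and> pathfinish p = b}"

definition cjoin :: "(real \<Rightarrow> complex) set \<Rightarrow> (real \<Rightarrow> complex) set \<Rightarrow> (real \<Rightarrow> complex) set"
    (infixr "\<odot>" 70) where
  "C \<odot> D = {q. \<exists>c\<in>C. \<exists>d\<in>D. homotopic_paths punctured_plane (c +++ d) q}"

definition crev :: "(real \<Rightarrow> complex) set \<Rightarrow> (real \<Rightarrow> complex) set" where
  "crev C = {q. \<exists>c\<in>C. homotopic_paths punctured_plane (reversepath c) q}"

definition cimg :: "(complex \<Rightarrow> complex) \<Rightarrow> (real \<Rightarrow> complex) set \<Rightarrow> (real \<Rightarrow> complex) set" where
  "cimg A C = {q. \<exists>c\<in>C. homotopic_paths punctured_plane (A \<circ> c) q}"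

definition seg :: "complex \<Rightarrow> complex \<Rightarrow> (real \<Rightarrow> complex) set" where
  "seg a b = path_class punctured_plane (linepath a b)"

lemma arrowsE:
  assumes "C \<in> arrows a b"
  obtains p where "C = path_class punctured_plane p" "path p" "path_image p \<subseteq> punctured_plane"
    "pathstart p = a" "pathfinish p = b"
  using assms unfolding arrows_def by blast

lemma arrowsI:
  "path p \<Longrightarrow> path_image p \<subseteq> punctured_plane \<Longrightarrow> pathstart p = a \<Longrightarrow> pathfinish p = b \<Longrightarrow>
    path_class punctured_plane p \<in> arrows a b"
  unfolding arrows_def by blast

lemma path_class_eqI:
  assumes "homotopic_paths X p q" shows "path_class X p = path_class X q"
  using assms unfolding path_class_def by (blast intro: homotopic_paths_trans homotopic_paths_sym)

lemma cjoin_path_class: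
  assumes "path p" "path_image p \<subseteq> punctured_plane" "path q" "path_image q \<subseteq> punctured_plane"
    "pathfinish p = pathstart q"
  shows "path_class punctured_plane p \<odot> path_class punctured_plane q = path_class punctured_plane (p +++ q)"
proof -
  have "homotopic_paths punctured_plane (p +++ q) (c +++ d)"
    if "homotopic_paths punctured_plane p c" "homotopic_paths punctured_plane q d" for c d
    using that assms(5) by (rule homotopic_paths_join)
  moreover have "homotopic_paths punctured_plane p p" "homotopic_paths punctured_plane q q"
    using assms by auto
  ultimately show ?thesis
    unfolding cjoin_def path_class_def by (blast intro: homotopic_paths_trans)
qed

lemma crev_path_class:
  assumes "path p" "path_image p \<subseteq> punctured_plane"
  shows "crev (path_class punctured_plane p) = path_class punctured_plane (reversepath p)"
proof -
  have "homotopic_paths punctured_plane p p" using assms by auto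
  then show ?thesis unfolding crev_def path_class_def
    by (blast intro: homotopic_paths_trans homotopic_paths_reversepath_D)
qed

text \<open>The affine symmetries of the punctured plane, each with its inverse. They comprise the
  elements of both rotation groups and the integral linear maps, so that conjugation in
  \<^const>\<open>pi1_O\<close>, change of base point and the action of the mapping class group are all
  instances of one construction.\<close>

definition lattice_symmetry :: "(complex \<Rightarrow> complex) \<Rightarrow> (complex \<Rightarrow> complex) \<Rightarrow> bool" where
  "lattice_symmetry A A' \<longleftrightarrow> linear (\<lambda>z. A z - A 0) \<and> linear (\<lambda>z. A' z - A' 0) \<and>
     (\<forall>z. A (A' z) = z) \<and> (\<forall>z. A' (A z) = z) \<and> (\<forall>z. A z \<in> int_lattice \<longleftrightarrow> z \<in> int_lattice)"

lemma lattice_symmetry_sym: "lattice_symmetry A A' \<Longrightarrow> lattice_symmetry A' A"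
  unfolding lattice_symmetry_def by metis

lemma lattice_symmetry_inverse:
  assumes "lattice_symmetry A A'" shows "A (A' z) = z" "A' (A z) = z"
  using assms by (auto simp: lattice_symmetry_def)

lemma lattice_symmetry_lattice:
  assumes "lattice_symmetry A A'" shows "A z \<in> int_lattice \<longleftrightarrow> z \<in> int_lattice"
  using assms by (auto simp: lattice_symmetry_def)

lemma lattice_symmetry_affine:
  assumes "lattice_symmetry A A'"
  shows "A (z + w) = A z + (A w - A 0)" "A (of_real t * z) = of_real t * (A z - A 0) + A 0"
    "A (- z) = - (A z - A 0) + A 0"
proof -
  have l: "linear (\<lambda>z. A z - A 0)" using assms by (auto simp: lattice_symmetry_def)
  show "A (z + w) = A z + (A w - A 0)" using linear_add[OF l, of z w] by (simp add: algebra_simps)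
  show "A (of_real t * z) = of_real t * (A z - A 0) + A 0"
    using linear_scale[OF l, of t z] by (simp add: scaleR_conv_of_real algebra_simps)
  show "A (- z) = - (A z - A 0) + A 0" using linear_neg[OF l, of z] by (simp add: algebra_simps)
qed

lemma lattice_symmetry_continuous:
  assumes "lattice_symmetry A A'" shows "continuous_on S A"
proof -
  have "linear (\<lambda>z. A z - A 0)" using assms by (auto simp: lattice_symmetry_def)
  then have "continuous_on S (\<lambda>z. (A z - A 0) + A 0)"
    by (intro continuous_intros linear_continuous_on linear_conv_bounded_linear[THEN iffD1])
  then show ?thesis by simp
qed

lemma lattice_symmetry_comp:
  assumes "lattice_symmetry A A'" "lattice_symmetry B B'"
  shows "lattice_symmetry (A \<circ> B) (B' \<circ> A')"
proof -
  have *: "linear (\<lambda>z. (A \<circ> B) z - (A \<circ> B) 0)" if "lattice_symmetry A A'" "lattice_symmetry B B'" for A A' B B'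
  proof -
    have "(\<lambda>z. (A \<circ> B) z - (A \<circ> B) 0) = (\<lambda>z. A z - A 0) \<circ> (\<lambda>z. B z - B 0)"
    proof
      fix z
      have "A (B z) = A (B z - B 0) + (A (B 0) - A 0)"
        using lattice_symmetry_affine(1)[OF that(1), of "B z - B 0" "B 0"] by simp
      moreover have "x - w = y - v" if "x = y + (w - v)" for x y w v :: complex
        using that by simp
      ultimately show "(A \<circ> B) z - (A \<circ> B) 0 = ((\<lambda>z. A z - A 0) \<circ> (\<lambda>z. B z - B 0)) z"
        unfolding comp_apply by blast
    qed
    moreover have "linear (\<lambda>z. A z - A 0)" "linear (\<lambda>z. B z - B 0)"
      using that by (auto simp: lattice_symmetry_def)
    ultimately show ?thesis using linear_compose by simp
  qed
  have "linear (\<lambda>z. (A \<circ> B) z - (A \<circ> B) 0)" "linear (\<lambda>z. (B' \<circ> A') z - (B' \<circ> A') 0)"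
    using * assms lattice_symmetry_sym by blast+
  then show ?thesis using assms unfolding lattice_symmetry_def comp_apply by auto
qed

lemma lattice_symmetry_id: "lattice_symmetry (\<lambda>z. z) (\<lambda>z. z)"
  by (auto simp: lattice_symmetry_def linear_iff)

lemma lattice_symmetry_image:
  assumes "lattice_symmetry A A'" "S \<subseteq> punctured_plane" shows "A ` S \<subseteq> punctured_plane"
  using assms lattice_symmetry_lattice by blast

lemma cimg_path_class:
  assumes A: "lattice_symmetry A A'" and "path p" "path_image p \<subseteq> punctured_plane"
  shows "cimg A (path_class punctured_plane p) = path_class punctured_plane (A \<circ> p)"
proof -
  have "homotopic_paths punctured_plane (A \<circ> p) (A \<circ> q)" if "homotopic_paths punctured_plane p q" for q
    using that lattice_symmetry_continuous[OF A] lattice_symmetry_lattice[OF A]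
    by (intro homotopic_paths_continuous_image) auto
  moreover have "homotopic_paths punctured_plane p p" using assms by auto
  ultimately show ?thesis unfolding cimg_def path_class_def
    by (blast intro: homotopic_paths_trans)
qed

lemma path_symmetry_image:
  assumes A: "lattice_symmetry A A'" and "path p" "path_image p \<subseteq> punctured_plane"
  shows "path (A \<circ> p)" "path_image (A \<circ> p) \<subseteq> punctured_plane"
  using assms lattice_symmetry_continuous[OF A] lattice_symmetry_image[OF A]
  by (auto intro: path_continuous_image simp: path_image_compose)

lemma arrows_in_plane:
  assumes "C \<in> arrows a b" shows "a \<in> punctured_plane" "b \<in> punctured_plane"
  using assms unfolding arrows_def by auto

lemma cjoin_arrows: "C \<in> arrows a b \<Longrightarrow> D \<in> arrows b c \<Longrightarrow> C \<odot> D \<in> arrows a c"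
  by (elim arrowsE) (auto simp: cjoin_path_class path_image_join intro!: arrowsI)

lemma crev_arrows: "C \<in> arrows a b \<Longrightarrow> crev C \<in> arrows b a"
  by (elim arrowsE) (auto simp: crev_path_class intro!: arrowsI)

lemma cimg_arrows: "lattice_symmetry A A' \<Longrightarrow> C \<in> arrows a b \<Longrightarrow> cimg A C \<in> arrows (A a) (A b)"
  by (elim arrowsE)
    (auto simp: cimg_path_class path_symmetry_image pathstart_compose pathfinish_compose
      intro!: arrowsI path_symmetry_image(1) dest: path_symmetry_image(2))

lemma seg_arrows: "closed_segment a b \<subseteq> punctured_plane \<Longrightarrow> seg a b \<in> arrows a b"
  unfolding seg_def by (intro arrowsI) auto

lemma cjoin_assoc:
  assumes "C \<in> arrows a b" "D \<in> arrows b c" "E \<in> arrows c d"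
  shows "(C \<odot> D) \<odot> E = C \<odot> (D \<odot> E)"
  using assms
  by (elim arrowsE)
    (auto simp: cjoin_path_class path_image_join
      intro!: path_class_eqI homotopic_paths_sym[OF homotopic_paths_assoc])

lemma cjoin_unit_left: "C \<in> arrows a b \<Longrightarrow> seg a a \<odot> C = C"
  unfolding seg_def
  by (elim arrowsE, hypsubst, subst cjoin_path_class)
    (auto intro!: path_class_eqI homotopic_paths_lid)

lemma cjoin_unit_right: "C \<in> arrows a b \<Longrightarrow> C \<odot> seg b b = C"
  unfolding seg_def
  by (elim arrowsE, hypsubst, subst cjoin_path_class)
    (auto intro!: path_class_eqI homotopic_paths_rid)

lemma cjoin_inverse_left: "C \<in> arrows a b \<Longrightarrow> crev C \<odot> C = seg b b"
  unfolding seg_def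
  by (elim arrowsE)
    (auto simp: cjoin_path_class crev_path_class path_image_join intro!: path_class_eqI homotopic_paths_linv)

lemma crev_crev: "C \<in> arrows a b \<Longrightarrow> crev (crev C) = C"
  by (elim arrowsE) (auto simp: crev_path_class)

lemma crev_seg: "closed_segment a b \<subseteq> punctured_plane \<Longrightarrow> crev (seg a b) = seg b a"
  unfolding seg_def by (auto simp: crev_path_class)

lemma crev_cjoin:
  assumes "C \<in> arrows a b" "D \<in> arrows b c" shows "crev (C \<odot> D) = crev D \<odot> crev C"
  using assms
  by (elim arrowsE)
    (auto simp: crev_path_class cjoin_path_class path_image_join reversepath_joinpaths)

lemma cimg_cjoin:
  assumes "lattice_symmetry A A'" "C \<in> arrows a b" "D \<in> arrows b c"
  shows "cimg A (C \<odot> D) = cimg A C \<odot> cimg A D"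
proof -
  from assms(2,3) obtain p q where
    p: "C = path_class punctured_plane p" "path p" "path_image p \<subseteq> punctured_plane" "pathstart p = a" "pathfinish p = b"
    and q: "D = path_class punctured_plane q" "path q" "path_image q \<subseteq> punctured_plane" "pathstart q = b" "pathfinish q = c"
    by (elim arrowsE)
  have "path (p +++ q)" "path_image (p +++ q) \<subseteq> punctured_plane" using p q by (auto simp: path_image_join)
  moreover have "A \<circ> (p +++ q) = (A \<circ> p) +++ (A \<circ> q)" by (rule path_compose_join)
  moreover have "pathfinish (A \<circ> p) = pathstart (A \<circ> q)" using p q by (simp add: pathstart_compose pathfinish_compose)
  ultimately show ?thesis using p q assms(1)
    by (simp add: cjoin_path_class cimg_path_class[OF assms(1)] path_symmetry_image[OF assms(1)])
qed

lemma cimg_crev: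
  assumes "lattice_symmetry A A'" "C \<in> arrows a b"
  shows "cimg A (crev C) = crev (cimg A C)"
proof -
  from assms(2) obtain p where
    p: "C = path_class punctured_plane p" "path p" "path_image p \<subseteq> punctured_plane" by (elim arrowsE)
  have "A \<circ> reversepath p = reversepath (A \<circ> p)" by (auto simp: reversepath_def fun_eq_iff)
  then show ?thesis using p
    by (simp add: crev_path_class cimg_path_class[OF assms(1)] path_symmetry_image[OF assms(1)])
qed

lemma cimg_comp:
  assumes "lattice_symmetry A A'" "lattice_symmetry B B'" "C \<in> arrows a b"
  shows "cimg A (cimg B C) = cimg (A \<circ> B) C"
proof -
  from assms(3) obtain p where
    p: "C = path_class punctured_plane p" "path p" "path_image p \<subseteq> punctured_plane" by (elim arrowsE)
  then show ?thesis using lattice_symmetry_comp[OF assms(1,2)]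
    by (simp add: cimg_path_class[OF assms(1)] cimg_path_class[OF assms(2)]
       cimg_path_class[OF lattice_symmetry_comp[OF assms(1,2)]] path_symmetry_image[OF assms(2)] comp_assoc)
qed

lemma cimg_id: "C \<in> arrows a b \<Longrightarrow> cimg (\<lambda>z. z) C = C"
  by (elim arrowsE) (simp add: cimg_path_class[OF lattice_symmetry_id] comp_def)

lemma cimg_seg:
  assumes "lattice_symmetry A A'" "closed_segment a b \<subseteq> punctured_plane"
  shows "cimg A (seg a b) = seg (A a) (A b)"
proof -
  have "A (linepath a b t) = linepath (A a) (A b) t" for t
  proof -
    have "A (linepath a b t) = A (of_real (1 - t) * a + of_real t * b)"
      by (simp add: linepath_def scaleR_conv_of_real)
    also have "\<dots> = A (of_real (1 - t) * a) + (A (of_real t * b) - A 0)"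
      by (rule lattice_symmetry_affine(1)[OF assms(1)])
    also have "\<dots> = of_real (1 - t) * A a + of_real t * A b"
      unfolding lattice_symmetry_affine(2)[OF assms(1), of "1 - t" a] lattice_symmetry_affine(2)[OF assms(1), of t b]
      by (simp add: algebra_simps)
    finally show ?thesis by (simp add: linepath_def scaleR_conv_of_real)
  qed
  then have "A \<circ> linepath a b = linepath (A a) (A b)" by (simp add: fun_eq_iff)
  then show ?thesis using assms unfolding seg_def by (simp add: cimg_path_class[OF assms(1)])
qed

lemma path_class_eq_simply_connected:
  assumes "simply_connected S" "S \<subseteq> punctured_plane" "path p" "path_image p \<subseteq> S" "path q" "path_image q \<subseteq> S"
    "pathstart p = pathstart q" "pathfinish p = pathfinish q"
  shows "path_class punctured_plane p = path_class punctured_plane q"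
proof -
  have "homotopic_paths S p q"
    using assms(1,3-) unfolding simply_connected_eq_homotopic_paths by simp
  then show ?thesis using assms(2) by (intro path_class_eqI) (rule homotopic_paths_subset)
qed

lemma seg_join:
  assumes "convex S" "S \<subseteq> punctured_plane" "a \<in> S" "b \<in> S" "c \<in> S"
  shows "seg a b \<odot> seg b c = seg a c"
proof -
  have *: "closed_segment a b \<subseteq> S" "closed_segment b c \<subseteq> S" "closed_segment a c \<subseteq> S"
    using assms by (simp_all add: closed_segment_subset)
  have "path_class punctured_plane (linepath a b +++ linepath b c) = path_class punctured_plane (linepath a c)"
    by (rule path_class_eq_simply_connected[OF convex_imp_simply_connected[OF assms(1)] assms(2)])
      (use * in \<open>auto simp: path_image_join\<close>)
  then show ?thesis using * assms unfolding seg_def by (subst cjoin_path_class) auto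
qed

section \<open>The rotation groups and the orbifold groups at an arbitrary base point\<close>

definition motions :: "complex set \<Rightarrow> (complex \<Rightarrow> complex) set" where
  "motions \<Lambda> = {g. \<exists>e\<in>{1, -1}. \<exists>v\<in>\<Lambda>. g = (\<lambda>z. e * z + v)}"

abbreviation even_lattice :: "complex set" where
  "even_lattice \<equiv> (\<lambda>z. 2 * z) ` int_lattice"

lemma int_lattice_zero [simp]: "0 \<in> int_lattice"
  and int_lattice_one [simp]: "1 \<in> int_lattice"
  and int_lattice_ii [simp]: "\<i> \<in> int_lattice"
  by (auto simp: int_lattice_def)

lemma int_lattice_add: "v \<in> int_lattice \<Longrightarrow> w \<in> int_lattice \<Longrightarrow> v + w \<in> int_lattice"
  and int_lattice_diff: "v \<in> int_lattice \<Longrightarrow> w \<in> int_lattice \<Longrightarrow> v - w \<in> int_lattice"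
  and int_lattice_minus: "v \<in> int_lattice \<Longrightarrow> - v \<in> int_lattice"
  by (auto simp: int_lattice_def)

lemma int_lattice_translate: "v \<in> int_lattice \<Longrightarrow> z + v \<in> int_lattice \<longleftrightarrow> z \<in> int_lattice"
  and int_lattice_rotate: "v \<in> int_lattice \<Longrightarrow> v - z \<in> int_lattice \<longleftrightarrow> z \<in> int_lattice"
proof -
  assume v: "v \<in> int_lattice"
  show "z + v \<in> int_lattice \<longleftrightarrow> z \<in> int_lattice"
    using int_lattice_add[OF _ v, of z] int_lattice_diff[OF _ v, of "z + v"] by auto
  show "v - z \<in> int_lattice \<longleftrightarrow> z \<in> int_lattice"
    using int_lattice_diff[OF v, of z] int_lattice_diff[OF v, of "v - z"] by auto
qed

lemma motionsI: "v \<in> \<Lambda> \<Longrightarrow> (\<lambda>z. z + v) \<in> motions \<Lambda>" "v \<in> \<Lambda> \<Longrightarrow> (\<lambda>z. v - z) \<in> motions \<Lambda>"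
proof -
  show "(\<lambda>z. z + v) \<in> motions \<Lambda>" if "v \<in> \<Lambda>"
    unfolding motions_def using that by (intro CollectI bexI[of _ 1] bexI[of _ v]) auto
  show "(\<lambda>z. v - z) \<in> motions \<Lambda>" if "v \<in> \<Lambda>"
    unfolding motions_def using that by (intro CollectI bexI[of _ "-1"] bexI[of _ v]) auto
qed

lemma motionsE:
  assumes "g \<in> motions \<Lambda>"
  obtains v where "v \<in> \<Lambda>" "g = (\<lambda>z. z + v)" | v where "v \<in> \<Lambda>" "g = (\<lambda>z. v - z)"
  using assms unfolding motions_def by (auto simp: algebra_simps)

lemma motions_Bij:
  assumes "g \<in> motions \<Lambda>" shows "g \<in> Bij UNIV"
  using assms
proof (cases rule: motionsE)
  case (1 v)
  then show ?thesis by (auto simp: Bij_def intro!: bij_betwI[where g = "\<lambda>z. z - v"])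
next
  case (2 v)
  then show ?thesis by (auto simp: Bij_def intro!: bij_betwI[where g = "\<lambda>z. v - z"])
qed

lemma BijGroup_mult_comp:
  "g \<in> Bij UNIV \<Longrightarrow> h \<in> Bij UNIV \<Longrightarrow> g \<otimes>\<^bsub>BijGroup UNIV\<^esub> h = g \<circ> h"
  by (auto simp: BijGroup_def compose_def restrict_def fun_eq_iff)

lemma motions_comp:
  assumes "\<And>v w. v \<in> \<Lambda> \<Longrightarrow> w \<in> \<Lambda> \<Longrightarrow> v - w \<in> \<Lambda>" "g \<in> motions \<Lambda>" "h \<in> motions \<Lambda>"
  shows "g \<circ> h \<in> motions \<Lambda>"
proof -
  have add: "v + w \<in> \<Lambda>" if "v \<in> \<Lambda>" "w \<in> \<Lambda>" for v w
    using assms(1)[OF that(1) assms(1)[OF assms(1)[OF that(2,2)] that(2)]] by simp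
  show ?thesis
    using assms(2)
  proof (cases rule: motionsE)
    case g: (1 v)
    show ?thesis using assms(3)
    proof (cases rule: motionsE)
      case (1 w)
      then have "g \<circ> h = (\<lambda>z. z + (w + v))" using g by (simp add: fun_eq_iff)
      then show ?thesis using motionsI(1)[OF add[OF 1(1) g(1)]] by simp
    next
      case (2 w)
      then have "g \<circ> h = (\<lambda>z. (w + v) - z)" using g by (simp add: fun_eq_iff)
      then show ?thesis using motionsI(2)[OF add[OF 2(1) g(1)]] by simp
    qed
  next
    case g: (2 v)
    show ?thesis using assms(3)
    proof (cases rule: motionsE)
      case (1 w)
      then have "g \<circ> h = (\<lambda>z. (v - w) - z)" using g by (simp add: fun_eq_iff)
      then show ?thesis using motionsI(2)[OF assms(1)[OF g(1) 1(1)]] by simp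
    next
      case (2 w)
      then have "g \<circ> h = (\<lambda>z. z + (v - w))" using g by (simp add: fun_eq_iff)
      then show ?thesis using motionsI(1)[OF assms(1)[OF g(1) 2(1)]] by simp
    qed
  qed
qed

text \<open>The translation by \<open>v\<close> is the product of the rotations about \<open>v/2\<close> and \<open>0\<close>.\<close>

lemma generate_rotations_eq_motions:
  assumes "0 \<in> \<Lambda>" and diff: "\<And>v w. v \<in> \<Lambda> \<Longrightarrow> w \<in> \<Lambda> \<Longrightarrow> v - w \<in> \<Lambda>"
  shows "generate (BijGroup UNIV) {pi_rotation c | c. 2 * c \<in> \<Lambda>} = motions \<Lambda>" (is "generate ?B ?R = _")
proof
  interpret B: group ?B by (rule group_BijGroup)
  have R: "?R \<subseteq> motions \<Lambda>" using motionsI(2) by blast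
  have inv_rot: "inv\<^bsub>?B\<^esub> (pi_rotation c) = pi_rotation c" if "2 * c \<in> \<Lambda>" for c
    by (rule B.inv_equality)
      (use motions_Bij[OF motionsI(2)[OF that]] in \<open>auto simp: BijGroup_def compose_def restrict_def\<close>)
  show "generate ?B ?R \<subseteq> motions \<Lambda>"
  proof
    fix g assume "g \<in> generate ?B ?R"
    then show "g \<in> motions \<Lambda>"
    proof induction
      case one
      have "\<one>\<^bsub>?B\<^esub> = (\<lambda>z. z + 0)" by (auto simp: BijGroup_def)
      then show ?case using motionsI(1)[OF assms(1)] by simp
    next
      case (incl h) then show ?case using R by blast
    next
      case (inv h) then show ?case using R inv_rot by auto
    next
      case (eng g h)
      have "g \<circ> h \<in> motions \<Lambda>" by (rule motions_comp) (use diff eng in auto)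
      then show ?case using BijGroup_mult_comp[OF motions_Bij[OF eng.IH(1)] motions_Bij[OF eng.IH(2)]] by (simp only:)
    qed
  qed
  show "motions \<Lambda> \<subseteq> generate ?B ?R"
  proof
    have rot: "(\<lambda>z. v - z) \<in> generate ?B ?R" if "v \<in> \<Lambda>" for v
      by (rule generate.incl) (use that in \<open>auto intro!: exI[of _ "v / 2"]\<close>)
    fix g assume "g \<in> motions \<Lambda>"
    then show "g \<in> generate ?B ?R"
    proof (cases rule: motionsE)
      case (1 v)
      have "(\<lambda>z. v - z) \<otimes>\<^bsub>?B\<^esub> (\<lambda>z. 0 - z) \<in> generate ?B ?R" using rot 1 assms(1) by (blast intro: generate.eng)
      moreover have "(\<lambda>z. v - z) \<otimes>\<^bsub>?B\<^esub> (\<lambda>z. 0 - z) = g"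
        using BijGroup_mult_comp[OF motions_Bij motions_Bij, OF motionsI(2) motionsI(2), OF 1(1) assms(1)]
        unfolding 1 by (auto simp: fun_eq_iff)
      ultimately show ?thesis by simp
    next
      case (2 v) then show ?thesis using rot by simp
    qed
  qed
qed

lemma even_lattice_diff: "v \<in> even_lattice \<Longrightarrow> w \<in> even_lattice \<Longrightarrow> v - w \<in> even_lattice"
proof -
  assume "v \<in> even_lattice" "w \<in> even_lattice"
  then obtain a b where "a \<in> int_lattice" "b \<in> int_lattice" "v = 2 * a" "w = 2 * b" by blast
  then have "v - w = 2 * (a - b)" "a - b \<in> int_lattice" using int_lattice_diff by (auto simp: algebra_simps)
  then show ?thesis by blast
qed

lemma H_hat_group_eq: "H_hat_group = motions int_lattice"
  unfolding H_hat_group_def half_lattice_def mem_Collect_eq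
  by (rule generate_rotations_eq_motions) (auto intro: int_lattice_diff)

lemma H_group_eq: "H_group = motions even_lattice"
proof -
  have "{pi_rotation c | c. c \<in> int_lattice} = {pi_rotation c | c. 2 * c \<in> even_lattice}" by auto
  then show ?thesis unfolding H_group_def
    by (simp only:) (rule generate_rotations_eq_motions, auto intro: even_lattice_diff)
qed

lemma H_group_subset: "H_group \<subseteq> H_hat_group"
proof -
  have "2 * z \<in> int_lattice" if "z \<in> int_lattice" for z
    unfolding mult_2 by (rule int_lattice_add[OF that that])
  then have "even_lattice \<subseteq> int_lattice" by blast
  then show ?thesis unfolding H_group_eq H_hat_group_eq motions_def by blast
qed

lemma motion_symmetry:
  assumes "g \<in> H_hat_group"
  obtains g' where "lattice_symmetry g g'" "g' \<in> H_hat_group"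
proof -
  have "linear (\<lambda>z::complex. - z)" "linear (\<lambda>z::complex. z)" by (auto simp: linear_iff)
  note l = this
  show ?thesis
    using assms[unfolded H_hat_group_eq]
  proof (cases rule: motionsE)
    case (1 v)
    have "lattice_symmetry g (\<lambda>z. z + - v)"
      unfolding lattice_symmetry_def 1(2) using l int_lattice_translate[OF 1(1)] by simp
    then show ?thesis using that motionsI(1)[OF int_lattice_minus[OF 1(1)]] unfolding H_hat_group_eq by blast
  next
    case (2 v)
    have "lattice_symmetry g g"
      unfolding lattice_symmetry_def 2(2) using l int_lattice_rotate[OF 2(1)] by simp
    then show ?thesis using that assms by blast
  qed
qed

definition pi1_O_at :: "complex \<Rightarrow> pi1_element monoid" where
  "pi1_O_at x = orbifold_pi1 H_hat_group punctured_plane x"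

definition pi1_S_at :: "complex \<Rightarrow> pi1_element set" where
  "pi1_S_at x = {(g, C). g \<in> H_group \<and> C \<in> arrows x (g x)}"

lemma pi1_O_at_base: "pi1_O = pi1_O_at base_point"
  by (simp add: pi1_O_def pi1_O_at_def)

lemma carrier_pi1_O_at: "(g, C) \<in> carrier (pi1_O_at x) \<longleftrightarrow> g \<in> H_hat_group \<and> C \<in> arrows x (g x)"
  unfolding pi1_O_at_def orbifold_pi1_def arrows_def by auto

lemma pi1_S_eq: "pi1_S = pi1_O\<lparr>carrier := pi1_S_at base_point\<rparr>"
  unfolding pi1_O_def pi1_S_def orbifold_pi1_def pi1_S_at_def arrows_def by auto

lemma one_pi1_O_at: "\<one>\<^bsub>pi1_O_at x\<^esub> = (\<lambda>z. z, seg x x)"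
  by (simp add: pi1_O_at_def orbifold_pi1_def seg_def)

lemma mult_pi1_O_at:
  assumes "g \<in> H_hat_group" "C \<in> arrows x (g x)" "D \<in> arrows x y"
  shows "(g, C) \<otimes>\<^bsub>pi1_O_at x\<^esub> (h, D) = (g \<circ> h, C \<odot> cimg g D)"
proof -
  from assms(1) obtain g' where g: "lattice_symmetry g g'" by (rule motion_symmetry)
  from assms(2,3) obtain p q where
    p: "C = path_class punctured_plane p" "path p" "path_image p \<subseteq> punctured_plane" "pathstart p = x" "pathfinish p = g x"
    and q: "D = path_class punctured_plane q" "path q" "path_image q \<subseteq> punctured_plane" "pathstart q = x" "pathfinish q = y"
    by (elim arrowsE)
  have 1: "homotopic_paths punctured_plane (p +++ (g \<circ> q)) (c +++ (g \<circ> d))"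
    if cd: "homotopic_paths punctured_plane p c" "homotopic_paths punctured_plane q d" for c d
  proof (rule homotopic_paths_join)
    show "homotopic_paths punctured_plane (g \<circ> q) (g \<circ> d)"
      using cd(2) lattice_symmetry_continuous[OF g] lattice_symmetry_lattice[OF g]
      by (intro homotopic_paths_continuous_image) auto
  qed (use cd p q in \<open>auto simp: pathstart_compose\<close>)
  have r: "homotopic_paths punctured_plane p p" "homotopic_paths punctured_plane q q" using p q by auto
  have "{s. \<exists>c\<in>C. \<exists>d\<in>D. homotopic_paths punctured_plane (c +++ (g \<circ> d)) s} = path_class punctured_plane (p +++ (g \<circ> q))"
    unfolding p(1) q(1) path_class_def using 1 r by (blast intro: homotopic_paths_trans)
  moreover have "C \<odot> cimg g D = path_class punctured_plane (p +++ (g \<circ> q))"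
    unfolding p(1) q(1) cimg_path_class[OF g q(2,3)]
    using p q path_symmetry_image[OF g q(2,3)] by (subst cjoin_path_class) (auto simp: pathstart_compose)
  ultimately show ?thesis by (simp add: pi1_O_at_def orbifold_pi1_def)
qed

lemma group_pi1_O_at:
  assumes "x \<in> punctured_plane" shows "group (pi1_O_at x)"
  unfolding pi1_O_at_def
proof (rule group_orbifold_pi1)
  show "subgroup H_hat_group (BijGroup UNIV)" unfolding H_hat_group_def by (rule generate_rotations(1)) simp
  fix g assume "g \<in> H_hat_group"
  then obtain g' where g: "lattice_symmetry g g'" by (rule motion_symmetry)
  show "continuous_on punctured_plane g" "g ` punctured_plane \<subseteq> punctured_plane"
    using lattice_symmetry_continuous[OF g] lattice_symmetry_image[OF g] by auto
qed (fact assms)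

text \<open>The effect on orbifold groups of a symmetry \<open>A\<close> of the punctured plane, the base points being
  joined by \<open>C\<close>. For \<open>A\<close> in the rotation group and \<open>C\<close> in the group at \<open>x\<close> this is conjugation by
  \<open>(A, C)\<close>.\<close>

definition transport ::
  "(complex \<Rightarrow> complex) \<Rightarrow> (complex \<Rightarrow> complex) \<Rightarrow> (real \<Rightarrow> complex) set \<Rightarrow> pi1_element \<Rightarrow> pi1_element" where
  "transport A A' C = (\<lambda>(g, D). (A \<circ> g \<circ> A', C \<odot> cimg A D \<odot> crev (cimg (A \<circ> g \<circ> A') C)))"

text \<open>Conjugation by \<open>A\<close> changes the translation by \<open>v\<close> into that by \<open>A v - A 0\<close>, and the rotation
  \<open>z \<mapsto> v - z\<close> into \<open>z \<mapsto> 2 A 0 + (A v - A 0) - z\<close>. The term \<open>2 A 0\<close> is always even, so both lattices of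
  translations are preserved.\<close>

lemma conjugate_motion:
  assumes A: "lattice_symmetry A A'"
  shows "g \<in> H_hat_group \<Longrightarrow> A \<circ> g \<circ> A' \<in> H_hat_group"
    and "g \<in> H_group \<Longrightarrow> A \<circ> g \<circ> A' \<in> H_group"
proof -
  note I = lattice_symmetry_inverse[OF A] and aff = lattice_symmetry_affine[OF A]
  have 1: "A \<circ> (\<lambda>z. z + v) \<circ> A' = (\<lambda>z. z + (A v - A 0))" for v
    unfolding comp_def aff(1)[of "A' z" v for z] I ..
  have 2: "A \<circ> (\<lambda>z. v - z) \<circ> A' = (\<lambda>z. (2 * A 0 + (A v - A 0)) - z)" for v
  proof
    fix z
    have "A (v - A' z) = A v + (A (- A' z) - A 0)" using aff(1)[of v "- A' z"] by simp
    also have "A (- A' z) = - (z - A 0) + A 0" unfolding aff(3)[of "A' z"] I ..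
    finally show "(A \<circ> (\<lambda>z. v - z) \<circ> A') z = (2 * A 0 + (A v - A 0)) - z" by simp
  qed
  note * = 1 2
  have A0: "A 0 \<in> int_lattice" using lattice_symmetry_lattice[OF A] by simp
  have Av: "A v - A 0 \<in> int_lattice" if "v \<in> int_lattice" for v
    using lattice_symmetry_lattice[OF A] that A0 by (blast intro: int_lattice_diff)
  show "A \<circ> g \<circ> A' \<in> H_hat_group" if "g \<in> H_hat_group"
    using that unfolding H_hat_group_eq
  proof (cases rule: motionsE)
    case (1 v)
    then show "A \<circ> g \<circ> A' \<in> motions int_lattice" unfolding 1(2) * using Av by (blast intro: motionsI)
  next
    case (2 v)
    then have "2 * A 0 + (A v - A 0) \<in> int_lattice"
      unfolding mult_2 by (intro int_lattice_add A0 Av)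
    then show "A \<circ> g \<circ> A' \<in> motions int_lattice" unfolding 2(2) * by (rule motionsI)
  qed
  have e: "A (2 * u) - A 0 \<in> even_lattice" "2 * A 0 + (A (2 * u) - A 0) \<in> even_lattice" if "u \<in> int_lattice" for u
  proof -
    have "A (2 * u) - A 0 = 2 * (A u - A 0)" using lattice_symmetry_affine(2)[OF A, of 2 u] by simp
    moreover from this have "2 * A 0 + (A (2 * u) - A 0) = 2 * (A 0 + (A u - A 0))" by (simp add: algebra_simps)
    ultimately show "A (2 * u) - A 0 \<in> even_lattice" "2 * A 0 + (A (2 * u) - A 0) \<in> even_lattice"
      using Av[OF that] int_lattice_add[OF A0 Av[OF that]] by (blast intro: image_eqI)+
  qed
  show "A \<circ> g \<circ> A' \<in> H_group" if "g \<in> H_group"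
    using that unfolding H_group_eq
  proof (cases rule: motionsE)
    case (1 v)
    then obtain u where "u \<in> int_lattice" "v = 2 * u" by blast
    then show "A \<circ> g \<circ> A' \<in> motions even_lattice" using e unfolding 1(2) * by (blast intro: motionsI)
  next
    case (2 v)
    then obtain u where "u \<in> int_lattice" "v = 2 * u" by blast
    then show "A \<circ> g \<circ> A' \<in> motions even_lattice" using e unfolding 2(2) * by (blast intro: motionsI)
  qed
qed

lemma conjugate_motion_symmetry:
  assumes A: "lattice_symmetry A A'" and g: "g \<in> H_hat_group"
  obtains g' h' where "lattice_symmetry g g'" "lattice_symmetry (A \<circ> g \<circ> A') h'"
  using motion_symmetry[OF g] motion_symmetry[OF conjugate_motion(1)[OF A g]] by metis

lemma transport_arrows:
  assumes A: "lattice_symmetry A A'" and C: "C \<in> arrows y (A x)" and g: "g \<in> H_hat_group" and D: "D \<in> arrows x (g x)"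
  shows "cimg A D \<in> arrows (A x) (A (g x))" 
    "crev (cimg (A \<circ> g \<circ> A') C) \<in> arrows (A (g x)) ((A \<circ> g \<circ> A') y)"
    "C \<odot> cimg A D \<odot> crev (cimg (A \<circ> g \<circ> A') C) \<in> arrows y ((A \<circ> g \<circ> A') y)"
proof -
  obtain h' where h: "lattice_symmetry (A \<circ> g \<circ> A') h'" using conjugate_motion_symmetry[OF A g] by metis
  show 1: "cimg A D \<in> arrows (A x) (A (g x))" using cimg_arrows[OF A D] .
  show 2: "crev (cimg (A \<circ> g \<circ> A') C) \<in> arrows (A (g x)) ((A \<circ> g \<circ> A') y)"
    using crev_arrows[OF cimg_arrows[OF h C]] lattice_symmetry_inverse[OF A] by simp
  show "C \<odot> cimg A D \<odot> crev (cimg (A \<circ> g \<circ> A') C) \<in> arrows y ((A \<circ> g \<circ> A') y)"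
    using cjoin_arrows[OF C cjoin_arrows[OF 1 2]] .
qed

lemma transport_closed:
  assumes "lattice_symmetry A A'" "C \<in> arrows y (A x)"
  shows "X \<in> carrier (pi1_O_at x) \<Longrightarrow> transport A A' C X \<in> carrier (pi1_O_at y)"
    and "X \<in> pi1_S_at x \<Longrightarrow> transport A A' C X \<in> pi1_S_at y"
  using transport_arrows(3)[OF assms] conjugate_motion[OF assms(1)] H_group_subset
  by (cases X; auto simp: transport_def carrier_pi1_O_at pi1_S_at_def)+

text \<open>The copies of \<open>C\<close> inserted at the end of the first factor and at the start of the second are
  inverse to each other.\<close>

lemma transport_hom:
  assumes A: "lattice_symmetry A A'" and C: "C \<in> arrows y (A x)"
  shows "transport A A' C \<in> hom (pi1_O_at x) (pi1_O_at y)"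
proof (rule homI)
  fix X Y assume X: "X \<in> carrier (pi1_O_at x)" and Y: "Y \<in> carrier (pi1_O_at x)"
  obtain g D h E where XY: "X = (g, D)" "Y = (h, E)" by (cases X, cases Y) auto
  have g: "g \<in> H_hat_group" "D \<in> arrows x (g x)" and h: "h \<in> H_hat_group" "E \<in> arrows x (h x)"
    using X Y XY by (auto simp: carrier_pi1_O_at)
  let ?g = "A \<circ> g \<circ> A'" and ?h = "A \<circ> h \<circ> A'"
  obtain g' h' k' where s: "lattice_symmetry g g'" "lattice_symmetry ?g h'" "lattice_symmetry ?h k'"
    using conjugate_motion_symmetry[OF A g(1)] conjugate_motion_symmetry[OF A h(1)] by metis
  note I = lattice_symmetry_inverse[OF A]
  have gh: "?g \<circ> ?h = A \<circ> (g \<circ> h) \<circ> A'" by (simp add: fun_eq_iff I)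
  note Tg = transport_arrows[OF A C g] and Th = transport_arrows[OF A C h]
  let ?c = "cimg ?g C"
  have c: "?c \<in> arrows (?g y) (A (g x))" using cimg_arrows[OF s(2) C] by (simp add: I)
  have gA: "cimg ?g (cimg A E) = cimg A (cimg g E)"
    using cimg_comp[OF s(2) A h(2)] cimg_comp[OF A s(1) h(2)]
    by (simp add: comp_def I)
  have gE: "cimg A (cimg g E) \<in> arrows (A (g x)) (A (g (h x)))"
    using cimg_arrows[OF A cimg_arrows[OF s(1) h(2)]] .
  have last: "cimg ?g (crev (cimg ?h C)) = crev (cimg (A \<circ> (g \<circ> h) \<circ> A') C)"
    unfolding cimg_crev[OF s(2) cimg_arrows[OF s(3) C]] cimg_comp[OF s(2,3) C] gh ..
  let ?l = "crev (cimg (A \<circ> (g \<circ> h) \<circ> A') C)"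
  have l: "?l \<in> arrows (A (g (h x))) (?g (?h y))"
    using cimg_arrows[OF s(2) Th(2)] unfolding last by (simp add: I)
  have "transport A A' C X \<otimes>\<^bsub>pi1_O_at y\<^esub> transport A A' C Y =
    (?g \<circ> ?h, (C \<odot> cimg A D \<odot> crev ?c) \<odot> cimg ?g (C \<odot> cimg A E \<odot> crev (cimg ?h C)))"
    unfolding XY transport_def prod.case
    by (rule mult_pi1_O_at[OF conjugate_motion(1)[OF A g(1)] Tg(3) Th(3)])
  also have "cimg ?g (C \<odot> cimg A E \<odot> crev (cimg ?h C)) = ?c \<odot> cimg A (cimg g E) \<odot> ?l"
    unfolding cimg_cjoin[OF s(2) C cjoin_arrows[OF Th(1,2)]] cimg_cjoin[OF s(2) Th(1,2)] gA last ..
  also have "(C \<odot> cimg A D \<odot> crev ?c) \<odot> ?c \<odot> cimg A (cimg g E) \<odot> ?l =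
      C \<odot> cimg A D \<odot> crev ?c \<odot> ?c \<odot> cimg A (cimg g E) \<odot> ?l"
    using cjoin_assoc[OF C cjoin_arrows[OF Tg(1) crev_arrows[OF c]]] 
      cjoin_assoc[OF Tg(1) crev_arrows[OF c]] cjoin_arrows[OF c cjoin_arrows[OF gE l]] by simp
  also have "crev ?c \<odot> ?c \<odot> cimg A (cimg g E) \<odot> ?l = cimg A (cimg g E) \<odot> ?l"
    using cjoin_assoc[OF crev_arrows[OF c] c cjoin_arrows[OF gE l]] cjoin_inverse_left[OF c]
      cjoin_unit_left[OF cjoin_arrows[OF gE l]] by simp
  also have "C \<odot> cimg A D \<odot> cimg A (cimg g E) \<odot> ?l = C \<odot> cimg A (D \<odot> cimg g E) \<odot> ?l"
    using cjoin_assoc[OF Tg(1) gE l] cimg_cjoin[OF A g(2) cimg_arrows[OF s(1) h(2)]] by simp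
  also have "(?g \<circ> ?h, C \<odot> cimg A (D \<odot> cimg g E) \<odot> ?l) = transport A A' C (X \<otimes>\<^bsub>pi1_O_at x\<^esub> Y)"
    unfolding XY mult_pi1_O_at[OF g h(2)] by (simp add: transport_def gh)
  finally show "transport A A' C (X \<otimes>\<^bsub>pi1_O_at x\<^esub> Y) = transport A A' C X \<otimes>\<^bsub>pi1_O_at y\<^esub> transport A A' C Y" ..
qed (use transport_closed[OF assms] in blast)

lemma transport_inverse:
  assumes A: "lattice_symmetry A A'" and C: "C \<in> arrows y (A x)" and X: "X \<in> carrier (pi1_O_at x)"
  shows "transport A' A (crev (cimg A' C)) (transport A A' C X) = X"
    and "crev (cimg A' C) \<in> arrows x (A' y)"
proof -
  obtain g D where XY: "X = (g, D)" by (cases X) auto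
  have g: "g \<in> H_hat_group" "D \<in> arrows x (g x)" using X XY by (auto simp: carrier_pi1_O_at)
  let ?g = "A \<circ> g \<circ> A'"
  obtain g' h' where s: "lattice_symmetry g g'" "lattice_symmetry ?g h'"
    using conjugate_motion_symmetry[OF A g(1)] by metis
  note A' = lattice_symmetry_sym[OF A] and I = lattice_symmetry_inverse[OF A]
  note Tg = transport_arrows[OF A C g]
  let ?b = "cimg A' C"
  have b: "?b \<in> arrows (A' y) x" using cimg_arrows[OF A' C] by (simp add: I)
  show "crev (cimg A' C) \<in> arrows x (A' y)" using crev_arrows[OF b] .
  have AA: "cimg A' (cimg A D) = D" using cimg_comp[OF A' A g(2)] cimg_id[OF g(2)] by (simp add: comp_def I)
  let ?e = "cimg g ?b"
  have e: "?e \<in> arrows (g (A' y)) (g x)" using cimg_arrows[OF s(1) b] .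
  have 1: "cimg A' (crev (cimg ?g C)) = crev ?e"
    unfolding cimg_crev[OF A' cimg_arrows[OF s(2) C]] cimg_comp[OF A' s(2) C] cimg_comp[OF s(1) A' C]
    by (simp add: comp_def I)
  have eq: "A' \<circ> ?g \<circ> A = g" by (simp add: fun_eq_iff I)
  have 2: "crev (cimg g (crev ?b)) = ?e"
    using cimg_crev[OF s(1) b] crev_crev[OF e] by simp
  have "cimg A' (C \<odot> cimg A D \<odot> crev (cimg ?g C)) = ?b \<odot> D \<odot> crev ?e"
    unfolding cimg_cjoin[OF A' C cjoin_arrows[OF Tg(1,2)]] cimg_cjoin[OF A' Tg(1,2)] AA 1 ..
  then have "transport A' A (crev ?b) (transport A A' C X) = (g, crev ?b \<odot> (?b \<odot> D \<odot> crev ?e) \<odot> ?e)"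
    unfolding XY transport_def prod.case eq 2 by simp
  also have "(?b \<odot> D \<odot> crev ?e) \<odot> ?e = ?b \<odot> D \<odot> crev ?e \<odot> ?e"
    using cjoin_assoc[OF b cjoin_arrows[OF g(2) crev_arrows[OF e]] e] cjoin_assoc[OF g(2) crev_arrows[OF e] e] by simp
  also have "\<dots> = ?b \<odot> D" using cjoin_inverse_left[OF e] cjoin_unit_right[OF g(2)] by simp
  also have "crev ?b \<odot> ?b \<odot> D = D"
    using cjoin_assoc[OF crev_arrows[OF b] b g(2)] cjoin_inverse_left[OF b] cjoin_unit_left[OF g(2)] by simp
  finally show "transport A' A (crev ?b) (transport A A' C X) = X" using XY by simp
qed

lemma transport_inverse_right:
  assumes A: "lattice_symmetry A A'" and C: "C \<in> arrows y (A x)" and Y: "Y \<in> carrier (pi1_O_at y)"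
  shows "transport A A' C (transport A' A (crev (cimg A' C)) Y) = Y"
proof -
  note A' = lattice_symmetry_sym[OF A]
  let ?C = "crev (cimg A' C)"
  have C': "?C \<in> arrows x (A' y)"
    using crev_arrows[OF cimg_arrows[OF A' C]] lattice_symmetry_inverse[OF A] by simp
  have "cimg A ?C = crev C"
    using cimg_crev[OF A cimg_arrows[OF A' C]] cimg_comp[OF A A' C] cimg_id[OF C]
    by (simp add: comp_def lattice_symmetry_inverse[OF A])
  then have "crev (cimg A ?C) = C" using crev_crev[OF C] by simp
  then show ?thesis using transport_inverse(1)[OF A' C' Y] by simp
qed

lemma pi1_S_at_subset: "pi1_S_at x \<subseteq> carrier (pi1_O_at x)"
  using H_group_subset by (auto simp: pi1_S_at_def carrier_pi1_O_at)

lemma transport_surj: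
  assumes A: "lattice_symmetry A A'" and C: "C \<in> arrows y (A x)"
  shows "transport A A' C ` carrier (pi1_O_at x) = carrier (pi1_O_at y)"
    and "transport A A' C ` pi1_S_at x = pi1_S_at y"
proof -
  note A' = lattice_symmetry_sym[OF A] and inv = transport_inverse_right[OF A C]
  let ?C = "crev (cimg A' C)"
  have C': "?C \<in> arrows x (A' y)"
    using crev_arrows[OF cimg_arrows[OF A' C]] lattice_symmetry_inverse[OF A] by simp
  show "transport A A' C ` carrier (pi1_O_at x) = carrier (pi1_O_at y)"
  proof (intro equalityI image_subsetI subsetI)
    fix Y assume Y: "Y \<in> carrier (pi1_O_at y)"
    have "transport A A' C (transport A' A ?C Y) \<in> transport A A' C ` carrier (pi1_O_at x)"
      by (rule imageI) (rule transport_closed(1)[OF A' C' Y])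
    then show "Y \<in> transport A A' C ` carrier (pi1_O_at x)" using inv[OF Y] by simp
  qed (rule transport_closed(1)[OF A C])
  show "transport A A' C ` pi1_S_at x = pi1_S_at y"
  proof (intro equalityI image_subsetI subsetI)
    fix Y assume Y: "Y \<in> pi1_S_at y"
    have "transport A A' C (transport A' A ?C Y) \<in> transport A A' C ` pi1_S_at x"
      by (rule imageI) (rule transport_closed(2)[OF A' C' Y])
    then show "Y \<in> transport A A' C ` pi1_S_at x" using inv pi1_S_at_subset Y by (metis subsetD)
  qed (rule transport_closed(2)[OF A C])
qed

section \<open>Loops along lines\<close>

text \<open>A vertical strip between two lines of lattice points, together with one point on each of
  the lines. It is the convex set in which almost all homotopies take place.\<close>

definition strip :: "int \<Rightarrow> real \<Rightarrow> real \<Rightarrow> complex set" where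
  "strip m s t = {z. of_int m \<le> Re z \<and> Re z \<le> of_int m + 1 \<and>
     (Re z = of_int m \<longrightarrow> Im z = s) \<and> (Re z = of_int m + 1 \<longrightarrow> Im z = t)}"

lemma convex_combination_extreme:
  fixes x y c :: real
  assumes "c \<le> x" "c \<le> y" "0 < u" "0 < v" "u + v = 1" "u * x + v * y = c"
  shows "x = c" "y = c"
proof -
  have "u * (x - c) + v * (y - c) = 0"
  proof -
    have "u * (x - c) + v * (y - c) = (u * x + v * y) - (u + v) * c" by (simp add: algebra_simps)
    then show ?thesis using assms(5,6) by simp
  qed
  moreover have "u * (x - c) \<ge> 0" "v * (y - c) \<ge> 0" using assms by auto
  ultimately have "u * (x - c) = 0" "v * (y - c) = 0" by linarith+
  then show "x = c" "y = c" using assms by auto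
qed

lemma convex_strip: "convex (strip m s t)"
proof (rule convexI)
  fix x y :: complex and u v :: real
  assume x: "x \<in> strip m s t" and y: "y \<in> strip m s t" and uv: "0 \<le> u" "0 \<le> v" "u + v = 1"
  show "u *\<^sub>R x + v *\<^sub>R y \<in> strip m s t"
  proof (cases "u = 0 \<or> v = 0")
    case True
    then show ?thesis using x y uv by auto
  next
    case False
    then have pos: "0 < u" "0 < v" using uv by auto
    have b: "of_int m \<le> Re x" "Re x \<le> of_int m + 1" "of_int m \<le> Re y" "Re y \<le> of_int m + 1"
      using x y by (auto simp: strip_def)
    have "of_int m \<le> u * Re x + v * Re y" "u * Re x + v * Re y \<le> of_int m + 1"
      using convex_bound_le[of "Re x" "of_int m + 1" "Re y" u v]
        convex_bound_le[of "- Re x" "- of_int m" "- Re y" u v] b uv by auto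
    moreover have "u * Im x + v * Im y = s" if "u * Re x + v * Re y = of_int m"
    proof -
      have "Re x = of_int m" "Re y = of_int m" using convex_combination_extreme[OF b(1,3) pos uv(3) that] .
      then have "Im x = s" "Im y = s" using x y by (auto simp: strip_def)
      then show ?thesis using uv(3) by (metis distrib_right mult_1)
    qed
    moreover have "u * Im x + v * Im y = t" if "u * Re x + v * Re y = of_int m + 1"
    proof -
      have e: "u * (- Re x) + v * (- Re y) = - (of_int m + 1)" using that by simp
      have l: "- (of_int m + 1) \<le> - Re x" "- (of_int m + 1) \<le> - Re y" using b(2,4) by simp_all
      have "Re x = of_int m + 1" "Re y = of_int m + 1"
        using convex_combination_extreme[OF l pos uv(3) e] by simp_all
      then have "Im x = t" "Im y = t" using x y by (auto simp: strip_def)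
      then show ?thesis using uv(3) by (metis distrib_right mult_1)
    qed
    ultimately show ?thesis by (auto simp: strip_def)
  qed
qed

lemma strip_subset:
  assumes "s \<notin> \<int>" "t \<notin> \<int>" shows "strip m s t \<subseteq> punctured_plane"
proof
  fix z assume z: "z \<in> strip m s t"
  show "z \<in> punctured_plane"
  proof
    assume "z \<in> int_lattice"
    then obtain k :: int where k: "Re z = of_int k" and i: "Im z \<in> \<int>" by (auto simp: int_lattice_def elim: Ints_cases)
    have "of_int m \<le> (of_int k :: real)" "(of_int k :: real) \<le> of_int (m + 1)" using z k by (auto simp: strip_def)
    then have "k = m \<or> k = m + 1" by linarith
    then show False using z k i assms by (auto simp: strip_def)
  qed
qed

lemma strip_join:
  assumes "s \<notin> \<int>" "t \<notin> \<int>" "a \<in> strip m s t" "b \<in> strip m s t" "c \<in> strip m s t"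
  shows "seg a b \<odot> seg b c = seg a c"
  using seg_join[OF convex_strip strip_subset[OF assms(1,2)]] assms by blast

lemma strip_segment:
  assumes "s \<notin> \<int>" "t \<notin> \<int>" "a \<in> strip m s t" "b \<in> strip m s t"
  shows "closed_segment a b \<subseteq> punctured_plane"
  using closed_segment_subset[OF assms(3,4) convex_strip] strip_subset[OF assms(1,2)] by blast

lemma half_not_Ints: "(of_int k + 1 / 2 :: real) \<notin> \<int>"
proof
  assume "(of_int k + 1 / 2 :: real) \<in> \<int>"
  then obtain l :: int where "of_int k + 1 / 2 = (of_int l :: real)" by (auto elim: Ints_cases)
  then have "(of_int (2 * k + 1) :: real) = of_int (2 * l)" by simp
  then show False unfolding of_int_eq_iff by presburger
qed

text \<open>\<^const>\<open>line_loops\<close> at an arbitrary base point: the orbifold group has its simplest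
  generators at \<open>i/2\<close>.\<close>

definition line_elements :: "complex \<Rightarrow> complex set \<Rightarrow> complex \<Rightarrow> pi1_element set" where
  "line_elements x0 \<Lambda> v = {(\<lambda>z. z + w, P \<odot> seg x (x + w) \<odot> crev (cimg (\<lambda>z. z + w) P)) | P x w.
      w \<in> {v, - v} \<and> P \<in> arrows x0 x \<and> (\<forall>t::real. x + of_real t * v \<notin> \<Lambda>)}"

lemma translation_symmetry:
  assumes "w \<in> int_lattice" shows "lattice_symmetry (\<lambda>z. z + w) (\<lambda>z. z - w)"
proof -
  have "linear (\<lambda>z::complex. z)" by (auto simp: linear_iff)
  then show ?thesis unfolding lattice_symmetry_def using int_lattice_translate[OF assms] by simp
qed

lemma half_lattice_superset: "int_lattice \<subseteq> half_lattice"
  using int_lattice_add unfolding half_lattice_def mult_2 by blast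

lemma line_segment_avoids:
  assumes "\<forall>t::real. x + of_real t * v \<notin> \<Lambda>" "int_lattice \<subseteq> \<Lambda>"
  shows "closed_segment (x + of_real a * v) (x + of_real b * v) \<subseteq> punctured_plane"
proof
  fix z assume "z \<in> closed_segment (x + of_real a * v) (x + of_real b * v)"
  then obtain u where "z = (1 - u) *\<^sub>R (x + of_real a * v) + u *\<^sub>R (x + of_real b * v)"
    by (auto simp: in_segment)
  then have "z = x + of_real ((1 - u) * a + u * b) * v"
    by (simp add: scaleR_conv_of_real algebra_simps)
  then show "z \<in> punctured_plane" using assms by blast
qed

lemma line_loop_segment:
  assumes "\<forall>t::real. x + of_real t * v \<notin> \<Lambda>" "int_lattice \<subseteq> \<Lambda>" "w \<in> {v, - v}"
  shows "closed_segment x (x + w) \<subseteq> punctured_plane"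
  using line_segment_avoids[OF assms(1,2), of 0 1] line_segment_avoids[OF assms(1,2), of 0 "-1"] assms(3) by auto

lemma line_loops_eq:
  assumes v: "v \<in> int_lattice" and L: "int_lattice \<subseteq> \<Lambda>"
  shows "line_loops \<Lambda> v = line_elements base_point \<Lambda> v"
proof -
  have eq: "path_class punctured_plane (p +++ linepath x (x + w) +++ reversepath ((\<lambda>z. z + w) \<circ> p)) =
      path_class punctured_plane p \<odot> seg x (x + w) \<odot> crev (cimg (\<lambda>z. z + w) (path_class punctured_plane p))"
    if "w \<in> {v, - v}" and p: "path p" "path_image p \<subseteq> punctured_plane" "pathfinish p = x"
      and x: "\<forall>t::real. x + of_real t * v \<notin> \<Lambda>" for p x w
  proof -
    have "w \<in> int_lattice" using v that(1) int_lattice_minus by auto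
    then have s: "lattice_symmetry (\<lambda>z. z + w) (\<lambda>z. z - w)" by (rule translation_symmetry)
    note i = path_symmetry_image[OF s p(1,2)] and sg = line_loop_segment[OF x L that(1)]
    have "path_class punctured_plane (linepath x (x + w)) \<odot> path_class punctured_plane (reversepath ((\<lambda>z. z + w) \<circ> p))
      = path_class punctured_plane (linepath x (x + w) +++ reversepath ((\<lambda>z. z + w) \<circ> p))"
      using i sg p(3) by (intro cjoin_path_class) (auto simp: pathfinish_compose)
    moreover have "path_class punctured_plane p \<odot> path_class punctured_plane (linepath x (x + w) +++ reversepath ((\<lambda>z. z + w) \<circ> p))
      = path_class punctured_plane (p +++ linepath x (x + w) +++ reversepath ((\<lambda>z. z + w) \<circ> p))"
      using i sg p by (intro cjoin_path_class) (auto simp: pathfinish_compose path_image_join)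
    ultimately show ?thesis
      unfolding seg_def cimg_path_class[OF s p(1,2)] crev_path_class[OF i] by simp
  qed
  show ?thesis
  proof (intro equalityI subsetI)
    fix X assume "X \<in> line_loops \<Lambda> v"
    then obtain p x w where p: "X = (\<lambda>z. z + w, path_class punctured_plane (p +++ linepath x (x + w) +++ reversepath ((\<lambda>z. z + w) \<circ> p)))"
      "w \<in> {v, - v}" "path p" "path_image p \<subseteq> punctured_plane" "pathstart p = base_point" "pathfinish p = x"
      "\<forall>t::real. x + of_real t * v \<notin> \<Lambda>" unfolding line_loops_def by blast
    then have "path_class punctured_plane p \<in> arrows base_point x" by (intro arrowsI)
    then show "X \<in> line_elements base_point \<Lambda> v"
      unfolding line_elements_def p(1) eq[OF p(2-4,6,7)] using p(2,7) by blast
  next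
    fix X assume "X \<in> line_elements base_point \<Lambda> v"
    then obtain P x w where X: "X = (\<lambda>z. z + w, P \<odot> seg x (x + w) \<odot> crev (cimg (\<lambda>z. z + w) P))"
      "w \<in> {v, - v}" "P \<in> arrows base_point x" "\<forall>t::real. x + of_real t * v \<notin> \<Lambda>" unfolding line_elements_def by blast
    from X(3) obtain p where p: "P = path_class punctured_plane p" "path p" "path_image p \<subseteq> punctured_plane"
      "pathstart p = base_point" "pathfinish p = x" by (rule arrowsE)
    show "X \<in> line_loops \<Lambda> v"
      unfolding line_loops_def X(1) p(1) eq[OF X(2) p(2,3,5) X(4), symmetric] using p X(2,4) by blast
  qed
qed

lemma line_elements_minus: "line_elements x0 \<Lambda> (- v) = line_elements x0 \<Lambda> v"
proof -
  have "(\<forall>t::real. x + of_real t * (- v) \<notin> \<Lambda>) \<longleftrightarrow> (\<forall>t::real. x + of_real t * v \<notin> \<Lambda>)" for x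
    by (metis minus_minus mult_minus_left mult_minus_right of_real_minus)
  moreover have "w \<in> {- v, - (- v)} \<longleftrightarrow> w \<in> {v, - v}" for w by auto
  ultimately show ?thesis unfolding line_elements_def by simp
qed

lemma line_element_typing:
  assumes "w \<in> {v, - v}" "v \<in> int_lattice" "P \<in> arrows x0 x" "\<forall>t::real. x + of_real t * v \<notin> \<Lambda>" "int_lattice \<subseteq> \<Lambda>"
  shows "lattice_symmetry (\<lambda>z. z + w) (\<lambda>z. z - w)" "(\<lambda>z. z + w) \<in> H_hat_group"
    "seg x (x + w) \<in> arrows x (x + w)" "crev (cimg (\<lambda>z. z + w) P) \<in> arrows (x + w) (x0 + w)"
    "P \<odot> seg x (x + w) \<odot> crev (cimg (\<lambda>z. z + w) P) \<in> arrows x0 (x0 + w)"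
proof -
  have w: "w \<in> int_lattice" using assms(1,2) int_lattice_minus by auto
  show 1: "lattice_symmetry (\<lambda>z. z + w) (\<lambda>z. z - w)" using w by (rule translation_symmetry)
  show "(\<lambda>z. z + w) \<in> H_hat_group" using w unfolding H_hat_group_eq by (rule motionsI)
  show 2: "seg x (x + w) \<in> arrows x (x + w)" using line_loop_segment[OF assms(4,5,1)] by (rule seg_arrows)
  show 3: "crev (cimg (\<lambda>z. z + w) P) \<in> arrows (x + w) (x0 + w)"
    by (rule crev_arrows) (rule cimg_arrows[OF 1 assms(3)])
  show "P \<odot> seg x (x + w) \<odot> crev (cimg (\<lambda>z. z + w) P) \<in> arrows x0 (x0 + w)"
    using cjoin_arrows[OF assms(3) cjoin_arrows[OF 2 3]] .
qed

lemma line_elements_carrier: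
  assumes "v \<in> int_lattice" "int_lattice \<subseteq> \<Lambda>"
  shows "line_elements x0 \<Lambda> v \<subseteq> carrier (pi1_O_at x0)"
  using line_element_typing(2,5)[OF _ assms(1) _ _ assms(2)]
  unfolding line_elements_def by (blast intro: carrier_pi1_O_at[THEN iffD2])

lemma line_elements_pi1_S:
  assumes "v \<in> even_lattice" "int_lattice \<subseteq> \<Lambda>"
  shows "line_elements x0 \<Lambda> v \<subseteq> pi1_S_at x0"
proof -
  obtain u where u: "u \<in> int_lattice" "v = 2 * u" using assms(1) by blast
  have v: "v \<in> int_lattice" unfolding u(2) mult_2 by (intro int_lattice_add u)
  have "- v = 2 * (- u)" using u by simp
  then have "- v \<in> even_lattice" using int_lattice_minus[OF u(1)] by blast
  then have "(\<lambda>z. z + w) \<in> H_group" if "w \<in> {v, - v}" for w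
    unfolding H_group_eq using that assms(1) by (auto intro!: motionsI(1))
  then show ?thesis
    using line_element_typing(5)[OF _ v _ _ assms(2)]
    unfolding line_elements_def pi1_S_at_def by blast
qed

lemma transport_line_elements_subset:
  assumes A: "lattice_symmetry A A'" and C: "C \<in> arrows y (A x0)" and v: "v \<in> int_lattice"
    and L: "int_lattice \<subseteq> \<Lambda>" and inv: "\<And>z. A z \<in> \<Lambda> \<longleftrightarrow> z \<in> \<Lambda>"
  shows "transport A A' C ` line_elements x0 \<Lambda> v \<subseteq> line_elements y \<Lambda> (A v - A 0)"
proof
  fix Y assume "Y \<in> transport A A' C ` line_elements x0 \<Lambda> v"
  then obtain P x w where P: "w \<in> {v, - v}" "P \<in> arrows x0 x" "\<forall>t::real. x + of_real t * v \<notin> \<Lambda>"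
    and Y: "Y = transport A A' C (\<lambda>z. z + w, P \<odot> seg x (x + w) \<odot> crev (cimg (\<lambda>z. z + w) P))"
    unfolding line_elements_def by blast
  note t = line_element_typing[OF P(1) v P(2,3) L]
  let ?w = "A w - A 0" and ?v = "A v - A 0"
  have eq: "A \<circ> (\<lambda>z. z + w) \<circ> A' = (\<lambda>z. z + ?w)"
    unfolding comp_def lattice_symmetry_affine(1)[OF A, of "A' z" w for z] lattice_symmetry_inverse[OF A] ..
  have w: "?w \<in> {?v, - ?v}" using P(1) lattice_symmetry_affine(3)[OF A, of v] by auto
  have Ax: "\<forall>t::real. A x + of_real t * ?v \<notin> \<Lambda>"
  proof
    fix t :: real
    have "A (x + of_real t * v) = A x + of_real t * ?v"
      unfolding lattice_symmetry_affine(1)[OF A, of x] lattice_symmetry_affine(2)[OF A] by simp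
    then show "A x + of_real t * ?v \<notin> \<Lambda>" using inv P(3) by metis
  qed
  have v': "?v \<in> int_lattice" using v lattice_symmetry_lattice[OF A] by (intro int_lattice_diff) auto
  let ?P = "C \<odot> cimg A P"
  have AP: "cimg A P \<in> arrows (A x0) (A x)" using cimg_arrows[OF A P(2)] .
  have CP: "?P \<in> arrows y (A x)" using cjoin_arrows[OF C AP] .
  note t' = line_element_typing[OF w v' CP Ax L]
  have 1: "cimg A (seg x (x + w)) = seg (A x) (A x + ?w)"
    using cimg_seg[OF A line_loop_segment[OF P(3) L P(1)]] lattice_symmetry_affine(1)[OF A, of x w] by simp
  have "cimg A (cimg (\<lambda>z. z + w) P) = cimg (A \<circ> (\<lambda>z. z + w)) P" by (rule cimg_comp[OF A t(1) P(2)])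
  also have "A \<circ> (\<lambda>z. z + w) = (\<lambda>z. z + ?w) \<circ> A"
    unfolding comp_def lattice_symmetry_affine(1)[OF A, of z w for z] ..
  also have "cimg ((\<lambda>z. z + ?w) \<circ> A) P = cimg (\<lambda>z. z + ?w) (cimg A P)" by (rule cimg_comp[OF t'(1) A P(2), symmetric])
  finally have 2: "cimg A (crev (cimg (\<lambda>z. z + w) P)) = crev (cimg (\<lambda>z. z + ?w) (cimg A P))"
    using cimg_crev[OF A cimg_arrows[OF t(1) P(2)]] by simp
  let ?s = "seg (A x) (A x + ?w)" and ?q = "crev (cimg (\<lambda>z. z + ?w) (cimg A P))" and ?c = "crev (cimg (\<lambda>z. z + ?w) C)"
  have q: "?q \<in> arrows (A x + ?w) (A x0 + ?w)" and c: "?c \<in> arrows (A x0 + ?w) (y + ?w)"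
    by (rule crev_arrows, rule cimg_arrows[OF t'(1)], rule AP C)+
  have qc: "?q \<odot> ?c = crev (cimg (\<lambda>z. z + ?w) ?P)"
    unfolding cimg_cjoin[OF t'(1) C AP] by (rule crev_cjoin[symmetric]; rule cimg_arrows[OF t'(1)]; rule C AP)
  have "Y = (\<lambda>z. z + ?w, C \<odot> cimg A (P \<odot> seg x (x + w) \<odot> crev (cimg (\<lambda>z. z + w) P)) \<odot> ?c)"
    unfolding Y transport_def prod.case eq ..
  also have "cimg A (P \<odot> seg x (x + w) \<odot> crev (cimg (\<lambda>z. z + w) P)) = cimg A P \<odot> ?s \<odot> ?q"
    unfolding cimg_cjoin[OF A P(2) cjoin_arrows[OF t(3,4)]] cimg_cjoin[OF A t(3,4)] 1 2 ..
  also have "C \<odot> (cimg A P \<odot> ?s \<odot> ?q) \<odot> ?c = ?P \<odot> ?s \<odot> ?q \<odot> ?c"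
    using cjoin_assoc[OF C AP cjoin_arrows[OF t'(3) cjoin_arrows[OF q c]]]
      cjoin_assoc[OF AP cjoin_arrows[OF t'(3) q] c] cjoin_assoc[OF t'(3) q c] by simp
  finally show "Y \<in> line_elements y \<Lambda> ?v"
    unfolding qc line_elements_def using w CP Ax by blast
qed

text \<open>Affine maps take lines to lines, and the path from the base point to the line is arbitrary.
  Hence the whole set \<open>\<beta>\<^sub>s\<close> goes onto the set \<open>\<beta>\<close> of the image slope, whatever path joins the base
  points.\<close>

lemma transport_line_elements:
  assumes A: "lattice_symmetry A A'" and C: "C \<in> arrows y (A x0)" and v: "v \<in> int_lattice"
    and L: "int_lattice \<subseteq> \<Lambda>" and inv: "\<And>z. A z \<in> \<Lambda> \<longleftrightarrow> z \<in> \<Lambda>"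
  shows "transport A A' C ` line_elements x0 \<Lambda> v = line_elements y \<Lambda> (A v - A 0)"
proof
  show "transport A A' C ` line_elements x0 \<Lambda> v \<subseteq> line_elements y \<Lambda> (A v - A 0)"
    by (rule transport_line_elements_subset[OF assms])
  note A' = lattice_symmetry_sym[OF A] and I = lattice_symmetry_inverse[OF A]
  let ?C = "crev (cimg A' C)" and ?v = "A v - A 0"
  have C': "?C \<in> arrows x0 (A' y)" using crev_arrows[OF cimg_arrows[OF A' C]] I by simp
  have v': "?v \<in> int_lattice" using v lattice_symmetry_lattice[OF A] by (intro int_lattice_diff) auto
  have inv': "A' z \<in> \<Lambda> \<longleftrightarrow> z \<in> \<Lambda>" for z using inv[of "A' z"] I by simp
  have "A v = A 0 + (A v - A 0)" by simp
  then have "A' (A v) = A' (A 0) + (A' ?v - A' 0)" using lattice_symmetry_affine(1)[OF A', of "A 0" ?v] by simp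
  then have "A' ?v - A' 0 = v" by (simp add: I)
  then have sub: "transport A' A ?C ` line_elements y \<Lambda> ?v \<subseteq> line_elements x0 \<Lambda> v"
    using transport_line_elements_subset[OF A' C' v' L inv'] by simp
  show "line_elements y \<Lambda> ?v \<subseteq> transport A A' C ` line_elements x0 \<Lambda> v"
  proof
    fix Y assume Y: "Y \<in> line_elements y \<Lambda> ?v"
    have "transport A A' C (transport A' A ?C Y) \<in> transport A A' C ` line_elements x0 \<Lambda> v"
      using Y sub by blast
    then show "Y \<in> transport A A' C ` line_elements x0 \<Lambda> v"
      using transport_inverse_right[OF A C subsetD[OF line_elements_carrier[OF v' L] Y]] by simp
  qed
qed

lemma lattice_symmetry_half_lattice:
  assumes A: "lattice_symmetry A A'" shows "A z \<in> half_lattice \<longleftrightarrow> z \<in> half_lattice"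
proof -
  have "A (2 * z) = 2 * A z - A 0" using lattice_symmetry_affine(2)[OF A, of 2 z] by (simp add: algebra_simps)
  moreover have "A 0 \<in> int_lattice" using lattice_symmetry_lattice[OF A] by simp
  ultimately have "A (2 * z) \<in> int_lattice \<longleftrightarrow> 2 * A z \<in> int_lattice"
    using int_lattice_translate[of "A 0" "2 * A z - A 0"] by simp
  then show ?thesis unfolding half_lattice_def using lattice_symmetry_lattice[OF A] by simp
qed

lemma convex_line: "convex {x + of_real t * v | t::real. True}" for x v :: complex
proof (rule convexI)
  fix a b :: complex and p q :: real
  assume "a \<in> {x + of_real t * v | t::real. True}" "b \<in> {x + of_real t * v | t::real. True}" and pq: "p + q = 1"
  then obtain s t where "a = x + of_real s * v" "b = x + of_real t * v" by blast
  then have "p *\<^sub>R a + q *\<^sub>R b = of_real (p + q) * x + of_real (p * s + q * t) * v"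
    by (simp add: scaleR_conv_of_real algebra_simps)
  then have "p *\<^sub>R a + q *\<^sub>R b = x + of_real (p * s + q * t) * v" unfolding pq by (simp only: of_real_1 mult_1)
  then show "p *\<^sub>R a + q *\<^sub>R b \<in> {x + of_real t * v | t::real. True}" by blast
qed

text \<open>The return path of the first factor cancels against the path to the line in the second; what
  remains are two consecutive segments of the line.\<close>

lemma line_element_square:
  assumes w: "w \<in> {v, - v}" and v: "v \<in> int_lattice" and P: "P \<in> arrows x0 x"
    and x: "\<forall>t::real. x + of_real t * v \<notin> \<Lambda>" and L: "int_lattice \<subseteq> \<Lambda>"
    and X: "X = (\<lambda>z. z + w, P \<odot> seg x (x + w) \<odot> crev (cimg (\<lambda>z. z + w) P))"
  shows "X \<otimes>\<^bsub>pi1_O_at x0\<^esub> X = (\<lambda>z. z + 2 * w, P \<odot> seg x (x + 2 * w) \<odot> crev (cimg (\<lambda>z. z + 2 * w) P))"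
proof -
  note t = line_element_typing[OF w v P x L]
  let ?t = "\<lambda>z. z + w" and ?s = "seg x (x + w)"
  let ?p = "cimg ?t P" and ?ts = "cimg ?t ?s" and ?q = "crev (cimg (\<lambda>z. z + 2 * w) P)"
  have tt: "?t \<circ> ?t = (\<lambda>z. z + 2 * w)" by (simp add: fun_eq_iff)
  have p: "?p \<in> arrows (x0 + w) (x + w)" using cimg_arrows[OF t(1) P] .
  have ts: "?ts \<in> arrows (x + w) (x + w + w)" using cimg_arrows[OF t(1,3)] .
  have tq: "cimg ?t (crev ?p) = ?q"
    unfolding cimg_crev[OF t(1) p] cimg_comp[OF t(1,1) P] tt ..
  have q: "?q \<in> arrows (x + w + w) (x0 + w + w)" using cimg_arrows[OF t(1,4)] unfolding tq .
  have "?s \<odot> ?ts = ?s \<odot> seg (x + w) (x + w + w)"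
    using cimg_seg[OF t(1) line_loop_segment[OF x L w]] by simp
  also have "\<dots> = seg x (x + w + w)"
  proof (rule seg_join[OF convex_line[of x v]])
    show "{x + of_real t * v | t::real. True} \<subseteq> punctured_plane" using x L by blast
    have S: "x + of_real t * v \<in> {x + of_real t * v | t::real. True}" for t by blast
    show "x \<in> {x + of_real t * v | t::real. True}" using S[of 0] by simp
    have "w = of_real 1 * v \<or> w = of_real (-1) * v" using w by auto
    then show "x + w \<in> {x + of_real t * v | t::real. True}" using S[of 1] S[of "-1"] by (elim disjE) (simp_all only:)
    have "x + w + w = x + of_real 2 * v \<or> x + w + w = x + of_real (-2) * v" using w by auto
    then show "x + w + w \<in> {x + of_real t * v | t::real. True}" using S[of 2] S[of "-2"] by (elim disjE) (simp_all only:)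
  qed
  also have "x + w + w = x + 2 * w" by simp
  finally have ss: "?s \<odot> ?ts = seg x (x + 2 * w)" .
  have "X \<otimes>\<^bsub>pi1_O_at x0\<^esub> X = (?t \<circ> ?t, (P \<odot> ?s \<odot> crev ?p) \<odot> cimg ?t (P \<odot> ?s \<odot> crev ?p))"
    unfolding X by (rule mult_pi1_O_at[OF t(2,5,5)])
  also have "cimg ?t (P \<odot> ?s \<odot> crev ?p) = ?p \<odot> ?ts \<odot> ?q"
    unfolding cimg_cjoin[OF t(1) P cjoin_arrows[OF t(3,4)]] cimg_cjoin[OF t(1,3,4)] tq ..
  also have "(P \<odot> ?s \<odot> crev ?p) \<odot> ?p \<odot> ?ts \<odot> ?q = P \<odot> ?s \<odot> crev ?p \<odot> ?p \<odot> ?ts \<odot> ?q"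
    using cjoin_assoc[OF P cjoin_arrows[OF t(3,4)] cjoin_arrows[OF p cjoin_arrows[OF ts q]]]
      cjoin_assoc[OF t(3,4) cjoin_arrows[OF p cjoin_arrows[OF ts q]]] by simp
  also have "crev ?p \<odot> ?p \<odot> ?ts \<odot> ?q = ?ts \<odot> ?q"
    using cjoin_assoc[OF t(4) p cjoin_arrows[OF ts q]] cjoin_inverse_left[OF p]
      cjoin_unit_left[OF cjoin_arrows[OF ts q]] by simp
  also have "?s \<odot> ?ts \<odot> ?q = seg x (x + 2 * w) \<odot> ?q" using cjoin_assoc[OF t(3) ts q] ss by simp
  finally show ?thesis unfolding tt .
qed

lemma square_beta_alpha:
  assumes v: "v \<in> int_lattice" and X: "X \<in> line_elements x0 half_lattice v"
  shows "X \<otimes>\<^bsub>pi1_O_at x0\<^esub> X \<in> line_elements x0 int_lattice (2 * v)"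
proof -
  obtain P x w where P: "w \<in> {v, - v}" "P \<in> arrows x0 x" "\<forall>t::real. x + of_real t * v \<notin> half_lattice"
    and X: "X = (\<lambda>z. z + w, P \<odot> seg x (x + w) \<odot> crev (cimg (\<lambda>z. z + w) P))"
    using X unfolding line_elements_def by blast
  have "x + of_real t * (2 * v) \<notin> int_lattice" for t :: real
  proof -
    have "x + of_real t * (2 * v) = x + of_real (t * 2) * v" by simp
    then show ?thesis using P(3) half_lattice_superset by (metis subsetD)
  qed
  moreover have "2 * w \<in> {2 * v, - (2 * v)}" using P(1) by auto
  ultimately show ?thesis
    unfolding line_element_square[OF P(1) v P(2,3) half_lattice_superset X] line_elements_def using P(2) by blast
qed

text \<open>A vertical line through half-lattice points can be slid off them, so that \<open>\<alpha>\<^sub>\<infinity>\<close> consists of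
  squares of elements of \<open>\<beta>\<^sub>\<infinity>\<close>.\<close>

lemma alpha_infinity_square:
  assumes Y: "Y \<in> line_elements x0 int_lattice (2 * \<i>)"
  shows "\<exists>X\<in>line_elements x0 half_lattice \<i>. Y = X \<otimes>\<^bsub>pi1_O_at x0\<^esub> X"
proof -
  obtain P x W where P: "W \<in> {2 * \<i>, - (2 * \<i>)}" "P \<in> arrows x0 x" "\<forall>t::real. x + of_real t * (2 * \<i>) \<notin> int_lattice"
    and Y: "Y = (\<lambda>z. z + W, P \<odot> seg x (x + W) \<odot> crev (cimg (\<lambda>z. z + W) P))"
    using Y unfolding line_elements_def mem_Collect_eq by (elim exE conjE) (rule that)
  define m where "m = \<lfloor>Re x\<rfloor>"
  have "Re x \<noteq> of_int m"
  proof
    assume "Re x = of_int m"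
    then have "x + of_real (- Im x / 2) * (2 * \<i>) \<in> int_lattice" by (auto simp: int_lattice_def)
    then show False using P(3) by blast
  qed
  then have m: "of_int m < Re x" "Re x < of_int m + 1" unfolding m_def by linarith+
  define x' where "x' = Complex (of_int m + 1 / 4) (Im x)"
  define w where "w = W / 2"
  have w: "w \<in> {\<i>, - \<i>}" "W = 2 * w" using P(1) by (auto simp: w_def)
  have half: "(1 / 2 :: real) \<notin> \<int>" using half_not_Ints[of 0] by simp
  have x': "\<forall>t::real. x' + of_real t * \<i> \<notin> half_lattice"
  proof
    fix t :: real
    have "Re (2 * (x' + of_real t * \<i>)) = of_int (2 * m) + 1 / 2" by (simp add: x'_def)
    then show "x' + of_real t * \<i> \<notin> half_lattice"
      unfolding half_lattice_def int_lattice_def using half_not_Ints[of "2 * m"] by (metis (no_types, lifting) mem_Collect_eq)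
  qed
  have str: "x \<in> strip m (1/2) (1/2)" "x' \<in> strip m (1/2) (1/2)" "x + W \<in> strip m (1/2) (1/2)" "x' + W \<in> strip m (1/2) (1/2)"
    using m P(1) by (auto simp: strip_def x'_def)
  note sj = strip_join[OF half half] and ss = strip_segment[OF half half]
  let ?P = "P \<odot> seg x x'" and ?X = "(\<lambda>z. z + w, (P \<odot> seg x x') \<odot> seg x' (x' + w) \<odot> crev (cimg (\<lambda>z. z + w) (P \<odot> seg x x')))"
  have sx: "seg x x' \<in> arrows x x'" using ss[OF str(1,2)] by (rule seg_arrows)
  have P': "?P \<in> arrows x0 x'" using cjoin_arrows[OF P(2) sx] .
  have X: "?X \<in> line_elements x0 half_lattice \<i>" unfolding line_elements_def using w(1) P' x' by blast
  have i2: "2 * \<i> \<in> int_lattice" unfolding mult_2 by (intro int_lattice_add) auto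
  note t = line_element_typing[OF P(1) i2 P(2,3) subset_refl]
  have sq: "?X \<otimes>\<^bsub>pi1_O_at x0\<^esub> ?X = (\<lambda>z. z + W, ?P \<odot> seg x' (x' + W) \<odot> crev (cimg (\<lambda>z. z + W) ?P))"
    unfolding w(2) by (rule line_element_square[OF w(1) int_lattice_ii P' x' half_lattice_superset refl])
  let ?q = "crev (cimg (\<lambda>z. z + W) P)"
  have "cimg (\<lambda>z. z + W) ?P = cimg (\<lambda>z. z + W) P \<odot> seg (x + W) (x' + W)"
    unfolding cimg_cjoin[OF t(1) P(2) sx] cimg_seg[OF t(1) ss[OF str(1,2)]] ..
  then have "crev (cimg (\<lambda>z. z + W) ?P) = seg (x' + W) (x + W) \<odot> ?q"
    using crev_cjoin[OF cimg_arrows[OF t(1) P(2)] seg_arrows[OF ss[OF str(3,4)]]] crev_seg[OF ss[OF str(3,4)]] by simp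
  then have "?P \<odot> seg x' (x' + W) \<odot> crev (cimg (\<lambda>z. z + W) ?P) = ?P \<odot> seg x' (x' + W) \<odot> seg (x' + W) (x + W) \<odot> ?q" by simp
  also have "seg x' (x' + W) \<odot> seg (x' + W) (x + W) \<odot> ?q = seg x' (x + W) \<odot> ?q"
    using cjoin_assoc[OF seg_arrows[OF ss[OF str(2,4)]] seg_arrows[OF ss[OF str(4,3)]] t(4)] sj[OF str(2,4,3)] by simp
  also have "?P \<odot> seg x' (x + W) \<odot> ?q = P \<odot> seg x x' \<odot> seg x' (x + W) \<odot> ?q"
    by (rule cjoin_assoc[OF P(2) sx cjoin_arrows[OF seg_arrows[OF ss[OF str(2,3)]] t(4)]])
  also have "seg x x' \<odot> seg x' (x + W) \<odot> ?q = seg x (x + W) \<odot> ?q"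
    using cjoin_assoc[OF sx seg_arrows[OF ss[OF str(2,3)]] t(4)] sj[OF str(1,2,3)] by simp
  finally show ?thesis using X sq Y by metis
qed

section \<open>Generators of the orbifold group\<close>

text \<open>The base point \<open>i/2\<close> is fixed by the shears \<open>(x, y) \<mapsto> (x, y + kx)\<close> and by the reflection
  \<open>(x, y) \<mapsto> (-x, y)\<close>, so that these act on the group without a choice of path.\<close>

abbreviation axis_point :: complex where
  "axis_point \<equiv> Complex 0 (1 / 2)"

abbreviation pi1_A :: "pi1_element monoid" where
  "pi1_A \<equiv> pi1_O_at axis_point"

text \<open>The generators are lifts of rotations: \<open>rot_R\<close> of the one about \<open>i/2\<close>, which fixes the base
  point, and \<open>rot_E j\<close> of the one about \<open>1/2 + ij/2\<close>, along the segment through this point, which ends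
  at \<open>E_end j\<close>. The three generators \<open>R, P, Q\<close> of order 2 are \<open>rot_R\<close>, \<open>rot_E 0\<close> and \<open>rot_E 1\<close>.\<close>

definition rot_R :: pi1_element where
  "rot_R = (\<lambda>z. \<i> - z, seg axis_point axis_point)"

definition E_end :: "int \<Rightarrow> complex" where
  "E_end j = Complex 1 (of_int j - 1 / 2)"

definition rot_E :: "int \<Rightarrow> pi1_element" where
  "rot_E j = (\<lambda>z. Complex 1 (of_int j) - z, seg axis_point (E_end j))"

definition down :: pi1_element where
  "down = (\<lambda>z. z - \<i>, seg axis_point (1 / 2) \<odot> seg (1 / 2) (- axis_point))"

lemma not_Ints:
  "(1 / 2 :: real) \<notin> \<int>" "(- 1 / 2 :: real) \<notin> \<int>" "(of_int j - 1 / 2 :: real) \<notin> \<int>"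
  "(3 / 2 :: real) \<notin> \<int>"
  using half_not_Ints[of 0] half_not_Ints[of "-1"] half_not_Ints[of "j - 1"] half_not_Ints[of 1] by simp_all

lemma axis_point_plane: "axis_point \<in> punctured_plane"
proof -
  have "axis_point \<notin> int_lattice" unfolding int_lattice_def mem_Collect_eq complex.sel using not_Ints(1) by blast
  then show ?thesis by simp
qed

lemma ii_minus_axis_point [simp]: "\<i> - axis_point = axis_point"
  by (simp add: complex_eq_iff)

lemma group_pi1_A: "group pi1_A"
  by (rule group_pi1_O_at) (rule axis_point_plane)

lemma E_end_seg:
  "closed_segment axis_point (E_end j) \<subseteq> punctured_plane"
  "closed_segment (E_end j) axis_point \<subseteq> punctured_plane"
  by (rule strip_segment[OF not_Ints(1) not_Ints(3)[of j], where m = 0]; simp add: strip_def E_end_def)+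

lemma motion_symmetries:
  "lattice_symmetry (\<lambda>z. \<i> - z) (\<lambda>z. \<i> - z)" "lattice_symmetry (\<lambda>z. Complex 1 (of_int j) - z) (\<lambda>z. Complex 1 (of_int j) - z)"
proof -
  have l: "linear (\<lambda>z::complex. - z)" by (auto simp: linear_iff)
  have *: "lattice_symmetry (\<lambda>z. v - z) (\<lambda>z. v - z)" if "v \<in> int_lattice" for v
    unfolding lattice_symmetry_def using l int_lattice_rotate[OF that] by simp
  show "lattice_symmetry (\<lambda>z. \<i> - z) (\<lambda>z. \<i> - z)" by (rule *) simp
  show "lattice_symmetry (\<lambda>z. Complex 1 (of_int j) - z) (\<lambda>z. Complex 1 (of_int j) - z)"
    by (rule *) (simp add: int_lattice_def)
qed

lemma generator_motions:
  "(\<lambda>z. \<i> - z) \<in> H_hat_group" "(\<lambda>z. Complex 1 (of_int j) - z) \<in> H_hat_group"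
  "v \<in> int_lattice \<Longrightarrow> (\<lambda>z. z + v) \<in> H_hat_group"
  unfolding H_hat_group_eq by (rule motionsI; simp add: int_lattice_def)+

lemma seg_refl_arrows: "a \<in> punctured_plane \<Longrightarrow> seg a a \<in> arrows a a"
  by (rule seg_arrows) simp

lemma rot_R_arrows: "seg axis_point axis_point \<in> arrows axis_point (\<i> - axis_point)"
  using seg_refl_arrows[OF axis_point_plane] unfolding ii_minus_axis_point .

lemma rot_E_arrows: "seg axis_point (E_end j) \<in> arrows axis_point (Complex 1 (of_int j) - axis_point)"
proof -
  have "Complex 1 (of_int j) - axis_point = E_end j" by (simp add: E_end_def complex_eq_iff)
  then show ?thesis using seg_arrows[OF E_end_seg(1)] by simp
qed

lemma rot_carrier: "rot_R \<in> carrier pi1_A" "rot_E j \<in> carrier pi1_A"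
  unfolding rot_R_def rot_E_def carrier_pi1_O_at
  using generator_motions rot_R_arrows rot_E_arrows by auto

lemma rot_R_mult:
  assumes "D \<in> arrows axis_point y"
  shows "rot_R \<otimes>\<^bsub>pi1_A\<^esub> (h, D) = (\<lambda>z. \<i> - h z, cimg (\<lambda>z. \<i> - z) D)"
proof -
  have "cimg (\<lambda>z. \<i> - z) D \<in> arrows axis_point (\<i> - y)"
    using cimg_arrows[OF motion_symmetries(1) assms] unfolding ii_minus_axis_point .
  then show ?thesis unfolding rot_R_def mult_pi1_O_at[OF generator_motions(1) rot_R_arrows assms]
    by (simp add: cjoin_unit_left comp_def)
qed

lemma rot_E_mult:
  assumes "D \<in> arrows axis_point y"
  shows "rot_E j \<otimes>\<^bsub>pi1_A\<^esub> (h, D) =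
    (\<lambda>z. Complex 1 (of_int j) - h z, seg axis_point (E_end j) \<odot> cimg (\<lambda>z. Complex 1 (of_int j) - z) D)"
  unfolding rot_E_def mult_pi1_O_at[OF generator_motions(2) rot_E_arrows assms] by (simp add: comp_def)

lemma rot_R_square: "rot_R \<otimes>\<^bsub>pi1_A\<^esub> rot_R = \<one>\<^bsub>pi1_A\<^esub>"
proof -
  have "closed_segment axis_point axis_point \<subseteq> punctured_plane"
    using axis_point_plane unfolding closed_segment_idem by blast
  then show ?thesis
    using rot_R_mult[OF seg_refl_arrows[OF axis_point_plane], of "\<lambda>z. \<i> - z"]
    unfolding rot_R_def one_pi1_O_at by (simp add: cimg_seg[OF motion_symmetries(1)])
qed

lemma rot_E_square: "rot_E j \<otimes>\<^bsub>pi1_A\<^esub> rot_E j = \<one>\<^bsub>pi1_A\<^esub>"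
proof -
  have e: "Complex 1 (of_int j) - axis_point = E_end j" "Complex 1 (of_int j) - E_end j = axis_point"
    by (simp_all add: E_end_def complex_eq_iff)
  have "rot_E j \<otimes>\<^bsub>pi1_A\<^esub> rot_E j = (\<lambda>z. z, seg axis_point (E_end j) \<odot> seg (E_end j) axis_point)"
    using rot_E_mult[OF seg_arrows[OF E_end_seg(1)], of j "\<lambda>z. Complex 1 (of_int j) - z" j]
    unfolding cimg_seg[OF motion_symmetries(2) E_end_seg(1)] e by (simp add: rot_E_def)
  also have "seg axis_point (E_end j) \<odot> seg (E_end j) axis_point = seg axis_point axis_point"
    by (rule strip_join[OF not_Ints(1) not_Ints(3)[of j], where m = 0]) (simp_all add: strip_def E_end_def)
  finally show ?thesis by (simp add: one_pi1_O_at)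
qed

text \<open>The path of the product crosses the strip \<open>0 < x < 1\<close>, touches its right edge between two lattice
  points and returns. Pulled off the right edge, it no longer shows the value of \<open>j\<close>.\<close>

lemma rot_E_mult_Suc_at:
  assumes z: "0 < Re z" "Re z < 1"
  shows "rot_E j \<otimes>\<^bsub>pi1_A\<^esub> rot_E (j + 1) = (\<lambda>z. z - \<i>, seg axis_point z \<odot> seg z (- axis_point))"
proof -
  have e: "Complex 1 (of_int j) - axis_point = E_end j" "Complex 1 (of_int j) - E_end (j + 1) = - axis_point"
    "Complex 1 (of_int j) - (Complex 1 (of_int (j + 1)) - z) = z - \<i>" for z
    by (simp_all add: E_end_def complex_eq_iff)
  have m: "rot_E j \<otimes>\<^bsub>pi1_A\<^esub> rot_E (j + 1) = (\<lambda>z. z - \<i>, seg axis_point (E_end j) \<odot> seg (E_end j) (- axis_point))"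
    using rot_E_mult[OF seg_arrows[OF E_end_seg(1)], of j "\<lambda>z. Complex 1 (of_int (j + 1)) - z" "j + 1"]
    unfolding cimg_seg[OF motion_symmetries(2) E_end_seg(1)] e rot_E_def[of "j + 1"] .
  have S: "seg axis_point z \<in> arrows axis_point z" "seg z (E_end j) \<in> arrows z (E_end j)"
    by (rule seg_arrows; rule strip_segment[OF not_Ints(1) not_Ints(3)[of j], where m = 0];
        use z in \<open>simp add: strip_def E_end_def\<close>)+
  have S': "seg (E_end j) (- axis_point) \<in> arrows (E_end j) (- axis_point)"
    by (rule seg_arrows; rule strip_segment[OF not_Ints(2) not_Ints(3)[of j], where m = 0];
        use z in \<open>simp add: strip_def E_end_def\<close>)
  have "seg axis_point z \<odot> seg z (E_end j) = seg axis_point (E_end j)"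
    by (rule strip_join[OF not_Ints(1) not_Ints(3)[of j], where m = 0]; use z in \<open>simp add: strip_def E_end_def\<close>)
  moreover have "seg z (E_end j) \<odot> seg (E_end j) (- axis_point) = seg z (- axis_point)"
    by (rule strip_join[OF not_Ints(2) not_Ints(3)[of j], where m = 0]; use z in \<open>simp add: strip_def E_end_def\<close>)
  ultimately have "seg axis_point (E_end j) \<odot> seg (E_end j) (- axis_point) = seg axis_point z \<odot> seg z (- axis_point)"
    using cjoin_assoc[OF S S'] by simp
  then show ?thesis unfolding m by simp
qed

lemma rot_E_mult_Suc: "rot_E j \<otimes>\<^bsub>pi1_A\<^esub> rot_E (j + 1) = down"
  unfolding down_def by (rule rot_E_mult_Suc_at) simp_all

lemma down_carrier: "down \<in> carrier pi1_A"
  using monoid.m_closed[OF group.is_monoid[OF group_pi1_A] rot_carrier(2) rot_carrier(2), of 0 "0 + 1"]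
  unfolding rot_E_mult_Suc .

lemma rot_E_Suc: "rot_E (j + 1) = rot_E j \<otimes>\<^bsub>pi1_A\<^esub> down"
proof -
  interpret group pi1_A by (rule group_pi1_A)
  have "rot_E j \<otimes>\<^bsub>pi1_A\<^esub> (rot_E j \<otimes>\<^bsub>pi1_A\<^esub> rot_E (j + 1)) = rot_E (j + 1)"
    using m_assoc[of "rot_E j" "rot_E j" "rot_E (j + 1)"] rot_carrier(2) rot_E_square by simp
  then show ?thesis unfolding rot_E_mult_Suc by simp
qed

text \<open>This follows from \<open>rot_E j \<cdot> rot_E (j + 1) = down\<close>, since \<open>rot_E j\<close> is an involution.\<close>

lemma rot_E_add: "rot_E (j + int k) = rot_E j \<otimes>\<^bsub>pi1_A\<^esub> down [^]\<^bsub>pi1_A\<^esub> k"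
proof -
  interpret group pi1_A by (rule group_pi1_A)
  show ?thesis
  proof (induction k)
    case 0 then show ?case using rot_carrier(2) by simp
  next
    case (Suc k)
    have "rot_E (j + int (Suc k)) = rot_E (j + int k) \<otimes>\<^bsub>pi1_A\<^esub> down" using rot_E_Suc[of "j + int k"] by (simp add: ac_simps)
    also have "\<dots> = rot_E j \<otimes>\<^bsub>pi1_A\<^esub> (down [^]\<^bsub>pi1_A\<^esub> k \<otimes>\<^bsub>pi1_A\<^esub> down)"
      unfolding Suc by (rule m_assoc) (use rot_carrier(2) down_carrier in auto)
    finally show ?case by simp
  qed
qed

text \<open>The loop \<open>down\<close> is homotopic to one that runs to the line \<open>x = 1/4\<close>, down along it by one unit,
  and then back to the vertical axis.\<close>

lemma down_in_beta_infinity: "down \<in> line_elements axis_point half_lattice \<i>"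
proof -
  let ?x = "Complex (1 / 4) 0"
  have str: "axis_point \<in> strip 0 (1/2) (1/2)" "?x \<in> strip 0 (1/2) (1/2)" "?x \<in> strip 0 (-1/2) (1/2)"
    "?x - \<i> \<in> strip 0 (-1/2) (1/2)" "- axis_point \<in> strip 0 (-1/2) (1/2)"
    by (simp_all add: strip_def)
  have a: "seg axis_point ?x \<in> arrows axis_point ?x"
    by (rule seg_arrows[OF strip_segment[OF not_Ints(1,1) str(1,2)]])
  have s: "lattice_symmetry (\<lambda>z. z + - \<i>) (\<lambda>z. z - - \<i>)" by (rule translation_symmetry) (simp add: int_lattice_def)
  have "axis_point - \<i> = - axis_point" by (simp add: complex_eq_iff)
  then have "cimg (\<lambda>z. z + - \<i>) (seg axis_point ?x) = seg (- axis_point) (?x - \<i>)"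
    using cimg_seg[OF s strip_segment[OF not_Ints(1,1) str(1,2)]] by (simp only: diff_conv_add_uminus)
  then have "crev (cimg (\<lambda>z. z + - \<i>) (seg axis_point ?x)) = seg (?x - \<i>) (- axis_point)"
    using crev_seg[OF strip_segment[OF not_Ints(2,1) str(5,4)]] by simp
  moreover have "seg ?x (?x - \<i>) \<odot> seg (?x - \<i>) (- axis_point) = seg ?x (- axis_point)"
    by (rule strip_join[OF not_Ints(2,1) str(3,4,5)])
  ultimately have "(\<lambda>z. z + - \<i>, seg axis_point ?x \<odot> seg ?x (?x + - \<i>) \<odot> crev (cimg (\<lambda>z. z + - \<i>) (seg axis_point ?x)))
    = (\<lambda>z. z - \<i>, seg axis_point ?x \<odot> seg ?x (- axis_point))" by simp
  also have "\<dots> = down"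
    using rot_E_mult_Suc_at[of ?x 0] rot_E_mult_Suc[of 0] by simp
  finally have d: "down = (\<lambda>z. z + - \<i>, seg axis_point ?x \<odot> seg ?x (?x + - \<i>) \<odot> crev (cimg (\<lambda>z. z + - \<i>) (seg axis_point ?x)))" ..
  have x: "\<forall>t::real. ?x + of_real t * \<i> \<notin> half_lattice"
  proof
    fix t :: real
    have "Re (2 * (?x + of_real t * \<i>)) = 1 / 2" by simp
    then show "?x + of_real t * \<i> \<notin> half_lattice"
      unfolding half_lattice_def int_lattice_def using not_Ints(1) by (metis (no_types, lifting) mem_Collect_eq)
  qed
  show ?thesis unfolding d line_elements_def using a x by blast
qed

lemma lattice_symmetry_convex:
  assumes A: "lattice_symmetry A A'" and "convex U" shows "convex (A ` U)"
proof -
  have "linear (\<lambda>z. A z - A 0)" using A by (simp add: lattice_symmetry_def)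
  then have "convex ((\<lambda>z. A z - A 0) ` U)" using assms(2) by (rule convex_linear_image)
  then have "convex ((+) (A 0) ` (\<lambda>z. A z - A 0) ` U)" by (rule convex_translation)
  then show ?thesis by (simp add: image_image)
qed

lemma lattice_symmetry_open:
  assumes A: "lattice_symmetry A A'" and "open U" shows "open (A ` U)"
proof -
  have "A ` U = A' -` U"
  proof (intro equalityI subsetI)
    fix z assume "z \<in> A' -` U"
    then have "A (A' z) \<in> A ` U" by blast
    then show "z \<in> A ` U" by (simp only: lattice_symmetry_inverse[OF A])
  qed (auto simp: lattice_symmetry_inverse[OF A])
  moreover have "continuous_on UNIV A'" using lattice_symmetry_continuous[OF lattice_symmetry_sym[OF A]] .
  ultimately show ?thesis using assms(2) by (simp add: open_vimage)
qed

text \<open>Macbeath's argument. If the translates of a convex open set \<open>U\<close> cover the punctured plane,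
  a path from the base point is followed through successive translates; whenever it passes from
  one to another, the two differ by a motion that moves \<open>U\<close> to a set that meets \<open>U\<close>. Thus the orbifold
  group is generated by the elements that belong to such motions.\<close>

lemma generated_by_overlaps:
  assumes U: "convex U" "open U" "U \<subseteq> punctured_plane" "x0 \<in> U"
    and cover: "\<And>z. z \<in> punctured_plane \<Longrightarrow> \<exists>g\<in>H_hat_group. z \<in> g ` U"
    and S: "subgroup S (pi1_O_at x0)"
    and over: "\<And>e z. e \<in> H_hat_group \<Longrightarrow> z \<in> U \<Longrightarrow> z \<in> e ` U \<Longrightarrow> (e, seg x0 z \<odot> seg z (e x0)) \<in> S"
  shows "S = carrier (pi1_O_at x0)"
proof
  show "S \<subseteq> carrier (pi1_O_at x0)" using S by (rule subgroup.subset)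
  have x0: "x0 \<in> punctured_plane" using U by blast
  interpret G: group "pi1_O_at x0" using x0 by (rule group_pi1_O_at)
  have convU: "convex (h ` U)" "h ` U \<subseteq> punctured_plane" "open (h ` U)" if "h \<in> H_hat_group" for h
    using motion_symmetry[OF that] U lattice_symmetry_convex lattice_symmetry_image lattice_symmetry_open by metis+
  have sj: "seg a b \<odot> seg b c = seg a c" if "h \<in> H_hat_group" "a \<in> h ` U" "b \<in> h ` U" "c \<in> h ` U" for h a b c
    using seg_join[OF convU(1,2)[OF that(1)] that(2-4)] .
  have sa: "seg a b \<in> arrows a b" if "h \<in> H_hat_group" "a \<in> h ` U" "b \<in> h ` U" for h a b
    using seg_arrows[of a b] closed_segment_subset[OF that(2,3) convU(1)[OF that(1)]] convU(2)[OF that(1)] by blast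
  have idH: "(\<lambda>z. z) \<in> H_hat_group" using generator_motions(3)[of 0] by simp
  have compH: "g \<circ> h \<in> H_hat_group" if "g \<in> H_hat_group" "h \<in> H_hat_group" for g h
    using motions_comp[of int_lattice g h] int_lattice_diff that unfolding H_hat_group_eq by blast
  have idU: "(\<lambda>z. z) ` U = U" by simp
  \<comment> \<open>passing from the translate \<open>h U\<close> to the translate \<open>h\<^sub>0 U\<close> at the point \<open>b\<close>\<close>
  have move: "(h0, q \<odot> seg (h x0) b \<odot> seg b (h0 x0)) \<in> S"
    if h: "h \<in> H_hat_group" "(h, q) \<in> S" and h0: "h0 \<in> H_hat_group" and b: "b \<in> h ` U" "b \<in> h0 ` U" for h q h0 b
  proof -
    obtain h' where s: "lattice_symmetry h h'" "h' \<in> H_hat_group" by (rule motion_symmetry[OF h(1)])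
    note I = lattice_symmetry_inverse[OF s(1)]
    let ?e = "h' \<circ> h0" and ?z = "h' b"
    have e: "?e \<in> H_hat_group" using compH[OF s(2) h0] .
    have z: "?z \<in> U" using b(1) I by auto
    have ze: "?z \<in> ?e ` U" using b(2) by auto
    have q: "q \<in> arrows x0 (h x0)" using subgroup.subset[OF S] h(2) by (auto simp: carrier_pi1_O_at)
    have ar: "seg x0 ?z \<in> arrows x0 ?z" "seg ?z (?e x0) \<in> arrows ?z (?e x0)"
      using sa[OF idH, of x0 ?z] sa[OF e ze, of "?e x0"] U(4) z by auto
    have cs: "closed_segment x0 ?z \<subseteq> punctured_plane" "closed_segment ?z (?e x0) \<subseteq> punctured_plane"
      using closed_segment_subset[OF U(4) z U(1)] U(3) closed_segment_subset[OF ze _ convU(1)[OF e], of "?e x0"] convU(2)[OF e] U(4)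
      by blast+
    have "(h, q) \<otimes>\<^bsub>pi1_O_at x0\<^esub> (?e, seg x0 ?z \<odot> seg ?z (?e x0)) \<in> S"
      using S h(2) over[OF e z ze] by (rule subgroup.m_closed)
    also have "(h, q) \<otimes>\<^bsub>pi1_O_at x0\<^esub> (?e, seg x0 ?z \<odot> seg ?z (?e x0)) = (h \<circ> ?e, q \<odot> cimg h (seg x0 ?z \<odot> seg ?z (?e x0)))"
      by (rule mult_pi1_O_at[OF h(1) q cjoin_arrows[OF ar]])
    also have "cimg h (seg x0 ?z \<odot> seg ?z (?e x0)) = seg (h x0) b \<odot> seg b (h0 x0)"
      unfolding cimg_cjoin[OF s(1) ar] cimg_seg[OF s(1) cs(1)] cimg_seg[OF s(1) cs(2)] using I by simp
    also have "h \<circ> ?e = h0" using I by (simp add: fun_eq_iff)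
    finally show ?thesis .
  qed
  show "carrier (pi1_O_at x0) \<subseteq> S"
  proof
    fix X assume X: "X \<in> carrier (pi1_O_at x0)"
    obtain g C where gC: "X = (g, C)" by (cases X)
    then have g: "g \<in> H_hat_group" "C \<in> arrows x0 (g x0)" using X by (auto simp: carrier_pi1_O_at)
    then obtain p where p: "C = path_class punctured_plane p" "path p" "path_image p \<subseteq> punctured_plane"
      "pathstart p = x0" "pathfinish p = g x0" by (elim arrowsE)
    define R where "R t \<longleftrightarrow> (\<exists>h q. h \<in> H_hat_group \<and> (h, q) \<in> S \<and> p t \<in> h ` U \<and>
      path_class punctured_plane (subpath 0 t p) = q \<odot> seg (h x0) (p t))" for t
    have "R 1"
    proof (rule connected_induction_simple[of "{0..1::real}" 0 1 R])
      show "R 0"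
      proof -
        have p0: "p 0 = x0" using p(4) by (simp add: pathstart_def)
        have "subpath 0 0 p = linepath x0 x0" using p0 by (simp add: subpath_refl linepath_refl)
        moreover have "(\<lambda>z. z, seg x0 x0) \<in> S" using subgroup.one_closed[OF S] unfolding one_pi1_O_at .
        moreover have "seg x0 x0 \<odot> seg x0 x0 = seg x0 x0" using seg_refl_arrows[OF x0] by (rule cjoin_unit_left)
        ultimately show ?thesis unfolding R_def p0 using idH U(4) seg_def by (intro exI[of _ "\<lambda>z. z"] exI[of _ "seg x0 x0"]) simp
      qed
      fix a :: real assume a: "a \<in> {0..1}"
      then have "p a \<in> punctured_plane" using p(3) unfolding path_image_def by blast
      then obtain h0 where h0: "h0 \<in> H_hat_group" "p a \<in> h0 ` U" using cover by blast
      have "continuous_on {0..1} p" using p(2) by (simp add: path_def)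
      then have "openin (top_of_set {0..1}) ({0..1} \<inter> p -` (h0 ` U))"
        using convU(3)[OF h0(1)] by (rule continuous_openin_preimage_gen)
      then obtain d where d: "d > 0" "ball a d \<inter> {0..1} \<subseteq> {0..1} \<inter> p -` (h0 ` U)"
        using a h0(2) unfolding openin_contains_ball by blast
      let ?T = "{0..1} \<inter> ball a d"
      have "R y" if x: "x \<in> ?T" and y: "y \<in> ?T" and "R x" for x y
      proof -
        obtain h q where h: "h \<in> H_hat_group" "(h, q) \<in> S" "p x \<in> h ` U"
          "path_class punctured_plane (subpath 0 x p) = q \<odot> seg (h x0) (p x)" using \<open>R x\<close> unfolding R_def by blast
        have q: "q \<in> arrows x0 (h x0)" using subgroup.subset[OF S] h(2) by (auto simp: carrier_pi1_O_at)
        have px: "p x \<in> h0 ` U" "p y \<in> h0 ` U" using d(2) x y by auto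
        have x01: "x \<in> {0..1}" "y \<in> {0..1}" using x y by auto
        have "convex ?T" by (simp add: convex_Int)
        then have "closed_segment x y \<subseteq> ?T" using x y by (intro closed_segment_subset)
        then have im: "path_image (subpath x y p) \<subseteq> h0 ` U"
          using d(2) by (auto simp: path_image_subpath_gen)
        have sub: "path (subpath u v p)" "path_image (subpath u v p) \<subseteq> punctured_plane"
          "pathstart (subpath u v p) = p u" "pathfinish (subpath u v p) = p v"
          if "u \<in> {0..1}" "v \<in> {0..1}" for u v
          using that p(2,3) path_image_subpath_subset[OF that, of p] by (auto intro: path_subpath)
        have "path_class punctured_plane (subpath x y p) = seg (p x) (p y)"
          unfolding seg_def
          by (rule path_class_eq_simply_connected[OF convex_imp_simply_connected[OF convU(1)[OF h0(1)]] convU(2)[OF h0(1)]])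
            (use sub x01 im closed_segment_subset[OF px convU(1)[OF h0(1)]] in auto)
        moreover have "path_class punctured_plane (subpath 0 y p) = 
            path_class punctured_plane (subpath 0 x p) \<odot> path_class punctured_plane (subpath x y p)"
        proof -
          have "homotopic_paths punctured_plane (subpath 0 x p +++ subpath x y p) (subpath 0 y p)"
            by (rule homotopic_join_subpaths) (use p(2,3) x01 in auto)
          then show ?thesis using sub x01 by (subst cjoin_path_class) (auto intro!: path_class_eqI homotopic_paths_sym)
        qed
        ultimately have c: "path_class punctured_plane (subpath 0 y p) = (q \<odot> seg (h x0) (p x)) \<odot> seg (p x) (p y)"
          using h(4) by simp
        let ?q = "q \<odot> seg (h x0) (p x) \<odot> seg (p x) (h0 x0)"
        have q0: "(h0, ?q) \<in> S" by (rule move[OF h(1,2) h0(1) h(3) px(1)])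
        have hx: "h x0 \<in> h ` U" "h0 x0 \<in> h0 ` U" using U(4) by auto
        note A = sa[OF h(1) hx(1) h(3)] sa[OF h0(1) px(1) hx(2)] sa[OF h0(1) hx(2) px(2)] sa[OF h0(1) px]
        have "?q \<odot> seg (h0 x0) (p y) = q \<odot> seg (h x0) (p x) \<odot> seg (p x) (h0 x0) \<odot> seg (h0 x0) (p y)"
          using cjoin_assoc[OF q cjoin_arrows[OF A(1,2)] A(3)] cjoin_assoc[OF A(1,2,3)] by simp
        also have "seg (p x) (h0 x0) \<odot> seg (h0 x0) (p y) = seg (p x) (p y)" by (rule sj[OF h0(1) px(1) hx(2) px(2)])
        also have "q \<odot> seg (h x0) (p x) \<odot> seg (p x) (p y) = path_class punctured_plane (subpath 0 y p)"
          unfolding c using cjoin_assoc[OF q A(1,4)] by simp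
        finally show ?thesis unfolding R_def using h0(1) q0 px(2) by metis
      qed
      moreover have "openin (top_of_set {0..1}) ?T" by (auto simp: openin_open)
      moreover have "a \<in> ?T" using a d(1) by simp
      ultimately show "\<exists>T. openin (top_of_set {0..1}) T \<and> a \<in> T \<and> (\<forall>x\<in>T. \<forall>y\<in>T. R x \<longrightarrow> R y)" by blast
    qed auto
    then obtain h q where h: "h \<in> H_hat_group" "(h, q) \<in> S" "p 1 \<in> h ` U"
      "path_class punctured_plane (subpath 0 1 p) = q \<odot> seg (h x0) (p 1)" unfolding R_def by blast
    have p1: "p 1 = g x0" using p(5) by (simp add: pathfinish_def)
    have gx: "g x0 \<in> g ` U" "h x0 \<in> h ` U" using U(4) by auto
    have "(g, q \<odot> seg (h x0) (g x0) \<odot> seg (g x0) (g x0)) \<in> S"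
      using move[OF h(1,2) g(1) _ gx(1)] h(3) p1 by simp
    then show "X \<in> S"
      using h(4) cjoin_unit_right[OF sa[OF h(1) gx(2) h(3)]] unfolding gC p(1) p1 by simp
  qed
qed

text \<open>The square with vertices \<open>1/2 \<plusminus> 1 + i/2\<close>, \<open>1/2 + i/2 \<plusminus> i\<close>. Four lattice points lie on its
  boundary, one on each side, so that its translates by lattice points cover punctured neighbourhoods of these points.\<close>

definition diamond :: "complex set" where
  "diamond = (\<lambda>z. Re z + Im z) -` {0<..<2} \<inter> (\<lambda>z. Re z - Im z) -` {-1<..<1}"

lemma diamond_iff: "z \<in> diamond \<longleftrightarrow> 0 < Re z + Im z \<and> Re z + Im z < 2 \<and> -1 < Re z - Im z \<and> Re z - Im z < 1"
  by (auto simp: diamond_def)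

lemma convex_diamond: "convex diamond"
  unfolding diamond_def by (intro convex_Int convex_linear_vimage) (auto simp: linear_iff algebra_simps)

lemma open_diamond: "open diamond"
  unfolding diamond_def by (intro open_Int open_vimage) (auto intro!: continuous_intros)

lemma diamond_subset: "diamond \<subseteq> punctured_plane"
proof
  fix z assume z: "z \<in> diamond"
  show "z \<in> punctured_plane"
  proof
    assume "z \<in> int_lattice"
    then obtain a b :: int where "Re z = of_int a" "Im z = of_int b" by (auto simp: int_lattice_def elim!: Ints_cases)
    then have "of_int 0 < (of_int (a + b) :: real)" "(of_int (a + b) :: real) < of_int 2"
      "of_int (-1) < (of_int (a - b) :: real)" "(of_int (a - b) :: real) < of_int 1"
      using z unfolding diamond_iff by auto
    then have "0 < a + b" "a + b < 2" "-1 < a - b" "a - b < 1" unfolding of_int_less_iff by auto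
    then show False by presburger
  qed
qed

lemma diamond_cover:
  assumes "z \<in> punctured_plane"
  shows "\<exists>v\<in>int_lattice. z - v \<in> diamond"
proof (rule bexI)
  let ?v = "Complex (of_int \<lfloor>Re z\<rfloor>) (of_int \<lfloor>Im z\<rfloor>)"
  show "?v \<in> int_lattice" by (simp add: int_lattice_def)
  have "frac (Re z) \<noteq> 0 \<or> frac (Im z) \<noteq> 0" using assms by (auto simp: int_lattice_def frac_eq_0_iff)
  then have "0 < frac (Re z) + frac (Im z)" using frac_ge_0[of "Re z"] frac_ge_0[of "Im z"] by linarith
  then show "z - ?v \<in> diamond"
    using frac_lt_1[of "Re z"] frac_lt_1[of "Im z"] frac_ge_0[of "Re z"] frac_ge_0[of "Im z"]
    unfolding diamond_iff frac_def by (simp, linarith)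
qed

text \<open>The diamond is open, so translates that share only a vertex with it do not meet it.\<close>

lemma diamond_overlap:
  assumes "v \<in> int_lattice" "z \<in> diamond" "z - v \<in> diamond"
  shows "v = 0 \<or> v = 1 \<or> v = -1 \<or> v = \<i> \<or> v = - \<i>"
proof -
  obtain a b :: int where ab: "Re v = of_int a" "Im v = of_int b" using assms(1) by (auto simp: int_lattice_def elim!: Ints_cases)
  have "of_int (-2) < (of_int (a + b) :: real)" "(of_int (a + b) :: real) < of_int 2"
      "of_int (-2) < (of_int (a - b) :: real)" "(of_int (a - b) :: real) < of_int 2"
    using assms(2,3) ab unfolding diamond_iff by auto
  then have "-2 < a + b" "a + b < 2" "-2 < a - b" "a - b < 2" unfolding of_int_less_iff by auto
  then have "(a = 0 \<and> b = 0) \<or> (a = 1 \<and> b = 0) \<or> (a = -1 \<and> b = 0) \<or> (a = 0 \<and> b = 1) \<or> (a = 0 \<and> b = -1)"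
    by presburger
  then show ?thesis using ab by (auto simp: complex_eq_iff)
qed

lemma axis_point_minus_ii [simp]: "axis_point - \<i> = - axis_point"
  by (simp add: complex_eq_iff)

lemma rot_E_mult_pred_at:
  assumes z: "0 < Re z" "Re z < 1"
  shows "rot_E 1 \<otimes>\<^bsub>pi1_A\<^esub> rot_E 0 = (\<lambda>z. z + \<i>, seg axis_point z \<odot> seg z (axis_point + \<i>))"
proof -
  have e: "Complex 1 (of_int 1) - axis_point = E_end 1" "Complex 1 (of_int 1) - E_end 0 = axis_point + \<i>"
    "Complex 1 (of_int 1) - (Complex 1 (of_int 0) - z) = z + \<i>" for z
    by (simp_all add: E_end_def complex_eq_iff)
  have m: "rot_E 1 \<otimes>\<^bsub>pi1_A\<^esub> rot_E 0 = (\<lambda>z. z + \<i>, seg axis_point (E_end 1) \<odot> seg (E_end 1) (axis_point + \<i>))"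
    using rot_E_mult[OF seg_arrows[OF E_end_seg(1)], of 1 "\<lambda>z. Complex 1 (of_int 0) - z" 0]
    unfolding cimg_seg[OF motion_symmetries(2) E_end_seg(1)] e rot_E_def[of 0] .
  have S: "seg axis_point z \<in> arrows axis_point z" "seg z (E_end 1) \<in> arrows z (E_end 1)"
    by (rule seg_arrows; rule strip_segment[OF not_Ints(1) not_Ints(1), where m = 0];
        use z in \<open>simp add: strip_def E_end_def\<close>)+
  have S': "seg (E_end 1) (axis_point + \<i>) \<in> arrows (E_end 1) (axis_point + \<i>)"
    by (rule seg_arrows; rule strip_segment[OF not_Ints(4) not_Ints(1), where m = 0];
        use z in \<open>simp add: strip_def E_end_def\<close>)
  have "seg axis_point z \<odot> seg z (E_end 1) = seg axis_point (E_end 1)"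
    by (rule strip_join[OF not_Ints(1) not_Ints(1), where m = 0]; use z in \<open>simp add: strip_def E_end_def\<close>)
  moreover have "seg z (E_end 1) \<odot> seg (E_end 1) (axis_point + \<i>) = seg z (axis_point + \<i>)"
    by (rule strip_join[OF not_Ints(4) not_Ints(1), where m = 0]; use z in \<open>simp add: strip_def E_end_def\<close>)
  ultimately have "seg axis_point (E_end 1) \<odot> seg (E_end 1) (axis_point + \<i>) = seg axis_point z \<odot> seg z (axis_point + \<i>)"
    using cjoin_assoc[OF S S'] by simp
  then show ?thesis unfolding m by simp
qed

text \<open>The motions that move the diamond to one that meets it are the translations by \<open>0\<close>, \<open>\<plusminus>1\<close> and
  \<open>\<plusminus>i\<close>, possibly preceded by the rotation about its centre \<open>1/2 + i/2\<close>, which belongs to \<open>rot_E 1\<close>. Each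
  of these translations other than \<open>0\<close> lifts to a product of two of the generators.\<close>

lemma pi1_A_generated:
  assumes S: "subgroup S pi1_A" and gen: "rot_R \<in> S" "rot_E 0 \<in> S" "rot_E 1 \<in> S"
  shows "S = carrier pi1_A"
proof (rule generated_by_overlaps[OF convex_diamond open_diamond diamond_subset _ _ S])
  show ad: "axis_point \<in> diamond" by (simp add: diamond_iff)
  note mc = subgroup.m_closed[OF S]
  show "\<exists>g\<in>H_hat_group. z \<in> g ` diamond" if z: "z \<in> punctured_plane" for z
  proof -
    obtain v where "v \<in> int_lattice" "z - v \<in> diamond" using diamond_cover[OF z] by blast
    then show ?thesis
      by (intro bexI[of _ "\<lambda>z. z + v"] image_eqI[of _ _ "z - v"] generator_motions(3)) simp_all
  qed
  have tr: "(\<lambda>z. z + v, seg axis_point z \<odot> seg z (axis_point + v)) \<in> S"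
    if v: "v \<in> int_lattice" and z: "z \<in> diamond" "z - v \<in> diamond" for v z
  proof -
    have sh: "lattice_symmetry (\<lambda>z. z + v) (\<lambda>z. z - v)" using v by (rule translation_symmetry)
    note sjv = seg_join[OF lattice_symmetry_convex[OF sh convex_diamond] lattice_symmetry_image[OF sh diamond_subset]]
    have mem: "w \<in> (\<lambda>z. z + v) ` diamond \<longleftrightarrow> w - v \<in> diamond" for w by (auto intro: image_eqI[of _ _ "w - v"])
    consider "v = 0" | "v = 1" | "v = -1" | "v = \<i>" | "v = - \<i>" using diamond_overlap[OF v z] by blast
    then show ?thesis
    proof cases
      case 1
      have "seg axis_point z \<odot> seg z axis_point = seg axis_point axis_point"
        by (rule seg_join[OF convex_diamond diamond_subset ad z(1) ad])
      then show ?thesis using subgroup.one_closed[OF S] 1 by (simp add: one_pi1_O_at)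
    next
      case 2
      \<comment> \<open>the rotations about \<open>i/2\<close> and then about \<open>1/2 + i/2\<close> give the translation by 1\<close>
      have e: "E_end 1 = axis_point + 1" "Complex 1 (of_int 1) - axis_point = axis_point + 1"
        by (simp_all add: E_end_def complex_eq_iff)
      have "seg axis_point z \<odot> seg z (axis_point + 1) = seg axis_point (axis_point + 1)"
        by (rule seg_join[OF convex_diamond diamond_subset ad z(1)]) (simp add: diamond_iff)
      moreover have "rot_E 1 \<otimes>\<^bsub>pi1_A\<^esub> rot_R = (\<lambda>z. z + 1, seg axis_point (axis_point + 1))"
      proof -
        have "closed_segment axis_point axis_point \<subseteq> punctured_plane"
          using axis_point_plane unfolding closed_segment_idem by blast
        then have "cimg (\<lambda>z. Complex 1 (of_int 1) - z) (seg axis_point axis_point) = seg (E_end 1) (E_end 1)"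
          using cimg_seg[OF motion_symmetries(2)] e by metis
        moreover have "(\<lambda>z. Complex 1 (of_int 1) - (\<i> - z)) = (\<lambda>z. z + 1)" by (simp add: fun_eq_iff complex_eq_iff)
        ultimately show ?thesis
          using rot_E_mult[OF seg_refl_arrows[OF axis_point_plane], of 1 "\<lambda>z. \<i> - z"]
            cjoin_unit_right[OF seg_arrows[OF E_end_seg(1)], of 1]
          unfolding rot_R_def e(1) by simp
      qed
      ultimately show ?thesis using mc[OF gen(3,1)] 2 by simp
    next
      case 3
      have "seg axis_point z \<odot> seg z (axis_point + v) = seg axis_point (axis_point + v)"
      proof (rule sjv)
        have "axis_point - v \<in> diamond" using 3 by (simp add: diamond_iff)
        then show "axis_point \<in> (\<lambda>z. z + v) ` diamond" unfolding mem .
        show "z \<in> (\<lambda>z. z + v) ` diamond" unfolding mem by (rule z(2))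
        show "axis_point + v \<in> (\<lambda>z. z + v) ` diamond" using ad by (rule imageI)
      qed
      moreover have "rot_R \<otimes>\<^bsub>pi1_A\<^esub> rot_E 1 = (\<lambda>z. z + v, seg axis_point (axis_point + v))"
      proof -
        have "(\<lambda>z. \<i> - (Complex 1 (of_int 1) - z)) = (\<lambda>z. z + v)" using 3 by (simp add: fun_eq_iff complex_eq_iff)
        moreover have "\<i> - E_end 1 = axis_point + v" using 3 by (simp add: E_end_def complex_eq_iff)
        ultimately show ?thesis
          using rot_R_mult[OF seg_arrows[OF E_end_seg(1)], of "\<lambda>z. Complex 1 (of_int 1) - z" 1]
          unfolding rot_E_def cimg_seg[OF motion_symmetries(1) E_end_seg(1)] by simp
      qed
      ultimately show ?thesis using mc[OF gen(1,3)] by simp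
    next
      case 4
      have "0 < Re z" "Re z < 1" using z unfolding 4 diamond_iff by auto
      then show ?thesis using rot_E_mult_pred_at mc[OF gen(3,2)] unfolding 4 by metis
    next
      case 5
      have "0 < Re z" "Re z < 1" using z unfolding 5 diamond_iff by auto
      then have "rot_E 0 \<otimes>\<^bsub>pi1_A\<^esub> rot_E 1 = (\<lambda>z. z - \<i>, seg axis_point z \<odot> seg z (- axis_point))"
        using rot_E_mult_Suc_at[of z 0] by simp
      then show ?thesis using mc[OF gen(2,3)] unfolding 5 by simp
    qed
  qed
  show "(e, seg axis_point z \<odot> seg z (e axis_point)) \<in> S"
    if e: "e \<in> H_hat_group" and z: "z \<in> diamond" "z \<in> e ` diamond" for e z
    using e[unfolded H_hat_group_eq]
  proof (cases rule: motionsE)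
    case (1 v)
    then have "z - v \<in> diamond" using z(2) by auto
    then show ?thesis using tr[OF 1(1) z(1)] unfolding 1(2) by simp
  next
    case (2 u)
    \<comment> \<open>the rotation \<open>z \<mapsto> u - z\<close> is the translation by \<open>v\<close> after the rotation about \<open>1/2 + i/2\<close>\<close>
    define v where "v = u - Complex 1 1"
    have v: "v \<in> int_lattice" unfolding v_def by (rule int_lattice_diff[OF 2(1)]) (simp add: int_lattice_def)
    have "u - z \<in> diamond" using z(2) unfolding 2(2) by auto
    then have zv: "z - v \<in> diamond" unfolding v_def diamond_iff by simp
    have sh: "lattice_symmetry (\<lambda>z. z + v) (\<lambda>z. z - v)" using v by (rule translation_symmetry)
    let ?Uv = "(\<lambda>z. z + v) ` diamond"
    have cv: "convex ?Uv" "?Uv \<subseteq> punctured_plane"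
      using lattice_symmetry_convex[OF sh convex_diamond] lattice_symmetry_image[OF sh diamond_subset] .
    have mem: "w \<in> ?Uv \<longleftrightarrow> w - v \<in> diamond" for w by (auto intro: image_eqI[of _ _ "w - v"])
    have E1: "E_end 1 \<in> diamond" by (simp add: diamond_iff E_end_def)
    have in1: "z \<in> ?Uv" by (rule mem[THEN iffD2, OF zv])
    have in2: "axis_point + v \<in> ?Uv" by (rule imageI[OF ad])
    have in3: "E_end 1 + v \<in> ?Uv" by (rule imageI[OF E1])
    have ar: "seg axis_point z \<in> arrows axis_point z" "seg z (axis_point + v) \<in> arrows z (axis_point + v)"
      "seg (axis_point + v) (E_end 1 + v) \<in> arrows (axis_point + v) (E_end 1 + v)"
      by (rule seg_arrows, rule subset_trans[OF closed_segment_subset[OF ad z(1) convex_diamond] diamond_subset],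
          rule seg_arrows, rule subset_trans[OF closed_segment_subset[OF in1 in2 cv(1)] cv(2)],
          rule seg_arrows, rule subset_trans[OF closed_segment_subset[OF in2 in3 cv(1)] cv(2)])
    have "(\<lambda>z. z + v, seg axis_point z \<odot> seg z (axis_point + v)) \<otimes>\<^bsub>pi1_A\<^esub> rot_E 1 =
      ((\<lambda>z. z + v) \<circ> (\<lambda>z. Complex 1 (of_int 1) - z), (seg axis_point z \<odot> seg z (axis_point + v)) \<odot> cimg (\<lambda>z. z + v) (seg axis_point (E_end 1)))"
      unfolding rot_E_def by (rule mult_pi1_O_at[OF generator_motions(3)[OF v] cjoin_arrows[OF ar(1,2)] rot_E_arrows])
    also have "(\<lambda>z. z + v) \<circ> (\<lambda>z. Complex 1 (of_int 1) - z) = e" unfolding 2(2) v_def by (simp add: fun_eq_iff)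
    also have "(seg axis_point z \<odot> seg z (axis_point + v)) \<odot> cimg (\<lambda>z. z + v) (seg axis_point (E_end 1)) = seg axis_point z \<odot> seg z (E_end 1 + v)"
      unfolding cimg_seg[OF sh E_end_seg(1)] using cjoin_assoc[OF ar] seg_join[OF cv in1 in2 in3] by simp
    also have "E_end 1 + v = e axis_point" unfolding 2(2) v_def by (simp add: E_end_def complex_eq_iff)
    finally show ?thesis using mc[OF tr[OF v z(1) zv] gen(3)] by simp
  qed
qed

section \<open>Shears and the reflection act trivially modulo powers of \<open>\<beta>\<^sub>\<infinity>\<close>\<close>

definition shear :: "int \<Rightarrow> complex \<Rightarrow> complex" where
  "shear k z = Complex (Re z) (Im z + of_int k * Re z)"

definition flip :: "complex \<Rightarrow> complex" where
  "flip z = Complex (- Re z) (Im z)"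

lemma Ints_uminus_iff: "- (x::real) \<in> \<int> \<longleftrightarrow> x \<in> \<int>"
  by (metis Ints_minus minus_minus)

lemma shear_zero [simp]: "shear k 0 = 0" and flip_zero [simp]: "flip 0 = 0"
  by (simp_all add: shear_def flip_def complex_eq_iff)

lemma shear_inverse [simp]: "shear k (shear (- k) z) = z" "shear (- k) (shear k z) = z" "flip (flip z) = z"
  by (simp_all add: shear_def flip_def)

lemma shear_lattice: "z \<in> int_lattice \<Longrightarrow> shear k z \<in> int_lattice"
  by (auto simp: shear_def int_lattice_def)

lemma shear_symmetry: "lattice_symmetry (shear k) (shear (- k))"
proof -
  have "linear (shear k)" for k by (auto simp: linear_iff shear_def complex_eq_iff algebra_simps)
  moreover have "shear k z \<in> int_lattice \<longleftrightarrow> z \<in> int_lattice" for z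
    using shear_lattice[of z k] shear_lattice[of "shear k z" "- k"] by auto
  ultimately show ?thesis unfolding lattice_symmetry_def by simp
qed

lemma flip_symmetry: "lattice_symmetry flip flip"
proof -
  have "linear flip" by (auto simp: linear_iff flip_def complex_eq_iff algebra_simps)
  moreover have "flip z \<in> int_lattice \<longleftrightarrow> z \<in> int_lattice" for z
    by (simp add: flip_def int_lattice_def Ints_uminus_iff)
  ultimately show ?thesis unfolding lattice_symmetry_def by simp
qed

lemma transport_fixed_point:
  assumes A: "lattice_symmetry A A'" and fx: "A x = x" and x: "x \<in> punctured_plane"
    and g: "g \<in> H_hat_group" "D \<in> arrows x (g x)"
  shows "transport A A' (seg x x) (g, D) = (A \<circ> g \<circ> A', cimg A D)"
proof -
  have C: "seg x x \<in> arrows x (A x)" using seg_refl_arrows[OF x] fx by simp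
  obtain h where s: "lattice_symmetry (A \<circ> g \<circ> A') h" using conjugate_motion_symmetry[OF A g(1)] by metis
  have "A' x = x" using lattice_symmetry_inverse(2)[OF A, of x] fx by simp
  then have e: "(A \<circ> g \<circ> A') x = A (g x)" by simp
  have cs: "closed_segment x x \<subseteq> punctured_plane" using x unfolding closed_segment_idem by blast
  have AD: "cimg A D \<in> arrows x (A (g x))" using cimg_arrows[OF A g(2)] fx by simp
  have y: "A (g x) \<in> punctured_plane" using arrows_in_plane(2)[OF AD] .
  have cy: "closed_segment (A (g x)) (A (g x)) \<subseteq> punctured_plane" using y unfolding closed_segment_idem by blast
  have "crev (cimg (A \<circ> g \<circ> A') (seg x x)) = seg (A (g x)) (A (g x))"
    unfolding cimg_seg[OF s cs] e by (rule crev_seg[OF cy])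
  then show ?thesis
    unfolding transport_def prod.case using cjoin_unit_right[OF AD] cjoin_unit_left[OF AD] by simp
qed

abbreviation shear_action :: "int \<Rightarrow> pi1_element \<Rightarrow> pi1_element" where
  "shear_action k \<equiv> transport (shear k) (shear (- k)) (seg axis_point axis_point)"

abbreviation flip_action :: "pi1_element \<Rightarrow> pi1_element" where
  "flip_action \<equiv> transport flip flip (seg axis_point axis_point)"

lemma shear_axis_point [simp]: "shear k axis_point = axis_point"
  and flip_axis_point [simp]: "flip axis_point = axis_point"
  by (simp_all add: shear_def flip_def)

lemma shear_fixes_seg: "seg axis_point axis_point \<in> arrows axis_point (shear k axis_point)"
  and flip_fixes_seg: "seg axis_point axis_point \<in> arrows axis_point (flip axis_point)"
  using seg_refl_arrows[OF axis_point_plane] by simp_all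

lemma axis_point_segment: "closed_segment axis_point axis_point \<subseteq> punctured_plane"
  using axis_point_plane unfolding closed_segment_idem by blast

lemma shear_action_rot_R: "shear_action k rot_R = rot_R"
proof -
  have "shear k \<circ> (\<lambda>z. \<i> - z) \<circ> shear (- k) = (\<lambda>z. \<i> - z)"
    by (simp add: fun_eq_iff shear_def complex_eq_iff algebra_simps)
  then show ?thesis
    unfolding rot_R_def transport_fixed_point[OF shear_symmetry shear_axis_point axis_point_plane generator_motions(1) rot_R_arrows]
    by (simp add: cimg_seg[OF shear_symmetry axis_point_segment])
qed

lemma shear_action_rot_E: "shear_action k (rot_E j) = rot_E (j + k)"
proof -
  have "shear k \<circ> (\<lambda>z. Complex 1 (of_int j) - z) \<circ> shear (- k) = (\<lambda>z. Complex 1 (of_int (j + k)) - z)"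
    by (simp add: fun_eq_iff shear_def complex_eq_iff algebra_simps)
  moreover have "shear k (E_end j) = E_end (j + k)" by (simp add: shear_def E_end_def)
  ultimately show ?thesis
    unfolding rot_E_def transport_fixed_point[OF shear_symmetry shear_axis_point axis_point_plane generator_motions(2) rot_E_arrows]
    by (simp add: cimg_seg[OF shear_symmetry E_end_seg(1)])
qed

lemma flip_action_rot_R: "flip_action rot_R = rot_R"
proof -
  have "flip \<circ> (\<lambda>z. \<i> - z) \<circ> flip = (\<lambda>z. \<i> - z)" by (simp add: fun_eq_iff flip_def complex_eq_iff)
  then show ?thesis
    unfolding rot_R_def transport_fixed_point[OF flip_symmetry flip_axis_point axis_point_plane generator_motions(1) rot_R_arrows]
    by (simp add: cimg_seg[OF flip_symmetry axis_point_segment])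
qed

lemma flip_action_rot_E:
  "flip_action (rot_E j) = rot_R \<otimes>\<^bsub>pi1_A\<^esub> (rot_E (2 - j) \<otimes>\<^bsub>pi1_A\<^esub> rot_R)"
proof -
  let ?e = "E_end (2 - j)"
  have e: "Complex 1 (of_int (2 - j)) - axis_point = ?e" by (simp add: E_end_def complex_eq_iff)
  have "cimg (\<lambda>z. Complex 1 (of_int (2 - j)) - z) (seg axis_point axis_point) = seg ?e ?e"
    using cimg_seg[OF motion_symmetries(2) axis_point_segment, of "2 - j"] unfolding e .
  then have "rot_E (2 - j) \<otimes>\<^bsub>pi1_A\<^esub> rot_R = (\<lambda>z. Complex 1 (of_int (2 - j)) - (\<i> - z), seg axis_point ?e)"
    using rot_E_mult[OF seg_refl_arrows[OF axis_point_plane], of "2 - j" "\<lambda>z. \<i> - z"]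
      cjoin_unit_right[OF seg_arrows[OF E_end_seg(1)], of "2 - j"] unfolding rot_R_def by simp
  then have r: "rot_R \<otimes>\<^bsub>pi1_A\<^esub> (rot_E (2 - j) \<otimes>\<^bsub>pi1_A\<^esub> rot_R) =
      (\<lambda>z. \<i> - (Complex 1 (of_int (2 - j)) - (\<i> - z)), seg axis_point (\<i> - ?e))"
    using rot_R_mult[OF seg_arrows[OF E_end_seg(1)]] cimg_seg[OF motion_symmetries(1) E_end_seg(1)] by simp
  have "flip \<circ> (\<lambda>z. Complex 1 (of_int j) - z) \<circ> flip = (\<lambda>z. \<i> - (Complex 1 (of_int (2 - j)) - (\<i> - z)))"
    by (simp add: fun_eq_iff flip_def complex_eq_iff)
  moreover have "flip (E_end j) = \<i> - ?e" by (simp add: flip_def E_end_def complex_eq_iff)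
  ultimately show ?thesis
    unfolding r unfolding rot_E_def transport_fixed_point[OF flip_symmetry flip_axis_point axis_point_plane generator_motions(2) rot_E_arrows]
    by (simp add: cimg_seg[OF flip_symmetry E_end_seg(1)])
qed

lemma subgroup_equalizer:
  assumes "group G" "group H" "f \<in> hom G H" "g \<in> hom G H"
  shows "subgroup {x \<in> carrier G. f x = g x} G"
proof -
  interpret f: group_hom G H f using assms by (simp add: group_hom_def group_hom_axioms_def)
  interpret g: group_hom G H g using assms by (simp add: group_hom_def group_hom_axioms_def)
  show ?thesis by unfold_locales auto
qed

lemma (in normal) r_coset_absorb:
  assumes "x \<in> carrier G" "n \<in> H" shows "H #> (x \<otimes> n) = H #> x" "H #> (n \<otimes> x) = H #> x"
proof -
  have n: "n \<in> carrier G" using assms(2) subset by blast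
  have "H #> n = H" using coset_join2[OF n is_subgroup assms(2)] .
  then show "H #> (n \<otimes> x) = H #> x" using coset_mult_assoc[OF subset n assms(1)] by simp
  have eq: "x \<otimes> n = (x \<otimes> n \<otimes> inv x) \<otimes> x" using assms(1) n by (simp add: m_assoc)
  have k: "x \<otimes> n \<otimes> inv x \<in> H" using assms by (rule inv_op_closed2)
  have "H #> (k \<otimes> x) = H #> x" if "k \<in> H" for k
    using coset_mult_assoc[OF subset _ assms(1), of k] coset_join2[OF _ is_subgroup that] subset that by auto
  then have "H #> ((x \<otimes> n \<otimes> inv x) \<otimes> x) = H #> x" using k by blast
  then show "H #> (x \<otimes> n) = H #> x" unfolding eq[symmetric] .
qed

lemma (in normal) mem_iff_coset: "x \<in> carrier G \<Longrightarrow> x \<in> H \<longleftrightarrow> H #> x = H"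
  using coset_join1[OF _ _ is_subgroup] coset_join2[OF _ is_subgroup] by blast

lemma rot_E_periodic:
  assumes N: "N \<lhd> pi1_A" and k: "down [^]\<^bsub>pi1_A\<^esub> nat \<bar>k\<bar> \<in> N"
  shows "N #>\<^bsub>pi1_A\<^esub> rot_E (j + k) = N #>\<^bsub>pi1_A\<^esub> rot_E j"
proof -
  interpret N: normal N pi1_A by (rule N)
  have *: "N #>\<^bsub>pi1_A\<^esub> rot_E (i + int m) = N #>\<^bsub>pi1_A\<^esub> rot_E i" if "down [^]\<^bsub>pi1_A\<^esub> m \<in> N" for i m
    unfolding rot_E_add by (rule N.r_coset_absorb(1)[OF rot_carrier(2) that])
  show ?thesis
  proof (cases "k \<ge> 0")
    case True
    then show ?thesis using *[of "nat \<bar>k\<bar>" j] k by simp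
  next
    case False
    then have e: "(j + k) + int (nat \<bar>k\<bar>) = j" by simp
    show ?thesis using *[OF k, of "j + k"] unfolding e by (rule sym)
  qed
qed

text \<open>The shear by \<open>k\<close> fixes \<open>rot_R\<close> and takes \<open>rot_E j\<close> to \<open>rot_E (j + k)\<close>; modulo the \<open>k\<close>-th power of
  \<open>down\<close> these two elements agree.\<close>

lemma shear_action_trivial:
  assumes N: "N \<lhd> pi1_A" and k: "down [^]\<^bsub>pi1_A\<^esub> nat \<bar>k\<bar> \<in> N" and x: "x \<in> carrier pi1_A"
  shows "N #>\<^bsub>pi1_A\<^esub> shear_action k x = N #>\<^bsub>pi1_A\<^esub> x"
proof -
  interpret N: normal N pi1_A by (rule N)
  let ?f = "\<lambda>x. N #>\<^bsub>pi1_A\<^esub> shear_action k x" and ?g = "\<lambda>x. N #>\<^bsub>pi1_A\<^esub> x"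
  have f: "?f \<in> hom pi1_A (pi1_A Mod N)"
    using hom_compose[OF transport_hom[OF shear_symmetry shear_fixes_seg] N.r_coset_hom_Mod] by (simp add: comp_def)
  have "{x \<in> carrier pi1_A. ?f x = ?g x} = carrier pi1_A"
    by (rule pi1_A_generated[OF subgroup_equalizer[OF group_pi1_A N.factorgroup_is_group f N.r_coset_hom_Mod]])
      (use rot_carrier rot_E_periodic[OF N k, of 0] rot_E_periodic[OF N k, of 1] in \<open>simp_all add: shear_action_rot_R shear_action_rot_E\<close>)
  then show ?thesis using x by blast
qed

text \<open>The reflection fixes \<open>R = rot_R\<close> and takes \<open>E\<^sub>j = rot_E j\<close> to \<open>R E\<^bsub>2-j\<^esub> R\<close>. Modulo the square of
  \<open>down\<close>, the element \<open>E\<^sub>j\<close> depends only on the parity of \<open>j\<close>, and \<open>2 - j\<close> has the parity of \<open>j\<close>.\<close>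

lemma flip_action_inner:
  assumes N: "N \<lhd> pi1_A" and k: "down [^]\<^bsub>pi1_A\<^esub> (2::nat) \<in> N" and x: "x \<in> carrier pi1_A"
  shows "N #>\<^bsub>pi1_A\<^esub> flip_action x = N #>\<^bsub>pi1_A\<^esub> (rot_R \<otimes>\<^bsub>pi1_A\<^esub> (x \<otimes>\<^bsub>pi1_A\<^esub> rot_R))"
proof -
  interpret N: normal N pi1_A by (rule N)
  let ?c = "\<lambda>x. rot_R \<otimes>\<^bsub>pi1_A\<^esub> (x \<otimes>\<^bsub>pi1_A\<^esub> rot_R)"
  let ?f = "\<lambda>x. N #>\<^bsub>pi1_A\<^esub> flip_action x" and ?g = "\<lambda>x. N #>\<^bsub>pi1_A\<^esub> ?c x"
  have R: "rot_R \<in> carrier pi1_A" by (rule rot_carrier)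
  have RR: "rot_R \<otimes>\<^bsub>pi1_A\<^esub> (rot_R \<otimes>\<^bsub>pi1_A\<^esub> y) = y" if "y \<in> carrier pi1_A" for y
    using N.m_assoc[OF R R that] rot_R_square that by simp
  have c: "?c \<in> hom pi1_A pi1_A"
    by (rule homI) (simp_all add: R N.m_assoc RR)
  have f: "?f \<in> hom pi1_A (pi1_A Mod N)"
    using hom_compose[OF transport_hom[OF flip_symmetry flip_fixes_seg] N.r_coset_hom_Mod] by (simp add: comp_def)
  have g: "?g \<in> hom pi1_A (pi1_A Mod N)"
    using hom_compose[OF c N.r_coset_hom_Mod] by (simp add: comp_def)
  have cong: "?g x = ?g y" if "x \<in> carrier pi1_A" "y \<in> carrier pi1_A" "N #>\<^bsub>pi1_A\<^esub> x = N #>\<^bsub>pi1_A\<^esub> y" for x y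
    using that R by (simp flip: N.rcos_sum)
  have p: "N #>\<^bsub>pi1_A\<^esub> rot_E 2 = N #>\<^bsub>pi1_A\<^esub> rot_E 0"
    using rot_E_periodic[OF N, of 2 0] k by simp
  have "{x \<in> carrier pi1_A. ?f x = ?g x} = carrier pi1_A"
  proof (rule pi1_A_generated[OF subgroup_equalizer[OF group_pi1_A N.factorgroup_is_group f g]])
    show "rot_R \<in> {x \<in> carrier pi1_A. ?f x = ?g x}"
      using R RR[OF R] by (simp add: flip_action_rot_R)
    show "rot_E 0 \<in> {x \<in> carrier pi1_A. ?f x = ?g x}"
      using cong[OF rot_carrier(2) rot_carrier(2) p] rot_carrier(2) by (simp add: flip_action_rot_E)
    show "rot_E 1 \<in> {x \<in> carrier pi1_A. ?f x = ?g x}"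
      using rot_carrier(2) by (simp add: flip_action_rot_E)
  qed
  then show ?thesis using x by blast
qed

section \<open>Consequences for slopes\<close>

lemma punctured_plane_arrow:
  assumes "a \<in> punctured_plane" "b \<in> punctured_plane" shows "\<exists>C. C \<in> arrows a b"
proof -
  have "int_lattice \<subseteq> (\<lambda>(m, n). Complex (of_int m) (of_int n)) ` UNIV"
  proof
    fix z assume "z \<in> int_lattice"
    then obtain m n :: int where "Re z = of_int m" "Im z = of_int n" by (auto simp: int_lattice_def elim!: Ints_cases)
    then have "z = (\<lambda>(m, n). Complex (of_int m) (of_int n)) (m, n)" by (simp add: complex_eq_iff)
    then show "z \<in> (\<lambda>(m, n). Complex (of_int m) (of_int n)) ` UNIV" by blast
  qed
  then have "countable int_lattice" by (rule countable_subset) simp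
  then have "path_connected punctured_plane" by (intro path_connected_complement_countable) simp_all
  then obtain p where "path p" "path_image p \<subseteq> punctured_plane" "pathstart p = a" "pathfinish p = b"
    using assms unfolding path_connected_def by blast
  then show ?thesis using arrowsI by blast
qed

definition alpha_elements :: "complex \<Rightarrow> pi1_element set" where
  "alpha_elements v = line_elements base_point int_lattice (2 * v)"

definition beta_elements :: "complex \<Rightarrow> pi1_element set" where
  "beta_elements v = line_elements base_point half_lattice v"

lemma double_lattice: "v \<in> int_lattice \<Longrightarrow> 2 * v \<in> int_lattice"
  unfolding mult_2 by (rule int_lattice_add)

lemma base_point_plane: "base_point \<in> punctured_plane"
proof -
  have "closed_segment axis_point base_point \<subseteq> punctured_plane"
    by (rule strip_segment[OF not_Ints(1,1), where m = 0]) (simp_all add: strip_def base_point_def)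
  then show ?thesis by auto
qed

lemma normal_preimage:
  assumes "group G" "K \<lhd> H" "f \<in> hom G H"
  shows "{x \<in> carrier G. f x \<in> K} \<lhd> G"
proof -
  interpret K: normal K H by (rule assms)
  have "(\<lambda>x. K #>\<^bsub>H\<^esub> f x) \<in> hom G (H Mod K)"
    using hom_compose[OF assms(3) K.r_coset_hom_Mod] by (simp add: comp_def)
  then interpret h: group_hom G "H Mod K" "\<lambda>x. K #>\<^bsub>H\<^esub> f x"
    using assms(1) K.factorgroup_is_group by (simp add: group_hom_def group_hom_axioms_def)
  have "kernel G (H Mod K) (\<lambda>x. K #>\<^bsub>H\<^esub> f x) = {x \<in> carrier G. f x \<in> K}"
    unfolding kernel_def one_FactGroup
    by (rule Collect_cong) (use K.mem_iff_coset hom_in_carrier[OF assms(3)] in blast)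
  then show ?thesis using h.normal_kernel by simp
qed

lemma image_subset_iff_preserved:
  assumes "f ` L = L'" "L \<subseteq> C" "\<And>x. x \<in> C \<Longrightarrow> f x \<in> N \<longleftrightarrow> x \<in> N"
  shows "L' \<subseteq> N \<longleftrightarrow> L \<subseteq> N"
  using assms by blast

lemma image_subset_iff_preimage:
  assumes "f ` L = L'" "L \<subseteq> C" shows "L' \<subseteq> K \<longleftrightarrow> L \<subseteq> {x \<in> C. f x \<in> K}"
  using assms by blast

text \<open>A normal subgroup is pulled back along a linear map \<open>M\<close> that takes the vertical direction to
  \<open>M i\<close>. As \<open>M\<close> takes lines to lines, statements about the slopes of \<open>M i\<close> and \<open>M v\<close> turn into
  statements about the slopes \<open>\<infinity>\<close> and of \<open>v\<close>.\<close>

lemma pullback_slopes: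
  assumes M: "lattice_symmetry M M'" "M 0 = 0" and K: "K \<lhd> pi1_O"
  obtains N where "N \<lhd> pi1_A"
    "\<And>v. v \<in> int_lattice \<Longrightarrow> alpha_elements (M v) \<subseteq> K \<longleftrightarrow> line_elements axis_point int_lattice (2 * v) \<subseteq> N"
    "\<And>k. \<forall>x\<in>beta_elements (M \<i>). x [^]\<^bsub>pi1_O\<^esub> (k::nat) \<in> K \<Longrightarrow> down [^]\<^bsub>pi1_A\<^esub> k \<in> N"
proof -
  have "M axis_point \<in> punctured_plane" using axis_point_plane lattice_symmetry_lattice[OF M(1)] by simp
  then obtain C where C: "C \<in> arrows base_point (M axis_point)" using punctured_plane_arrow base_point_plane by blast
  let ?t = "transport M M' C"
  have hom: "?t \<in> hom pi1_A pi1_O" unfolding pi1_O_at_base by (rule transport_hom[OF M(1) C])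
  let ?N = "{x \<in> carrier pi1_A. ?t x \<in> K}"
  have "?N \<lhd> pi1_A" by (rule normal_preimage[OF group_pi1_A K hom])
  moreover have "alpha_elements (M v) \<subseteq> K \<longleftrightarrow> line_elements axis_point int_lattice (2 * v) \<subseteq> ?N"
    if v: "v \<in> int_lattice" for v
  proof -
    have "M (2 * v) - M 0 = 2 * M v" using lattice_symmetry_affine(2)[OF M(1), of 2 v] M(2) by simp
    then have "?t ` line_elements axis_point int_lattice (2 * v) = alpha_elements (M v)"
      using transport_line_elements[OF M(1) C double_lattice[OF v] subset_refl] lattice_symmetry_lattice[OF M(1)]
      unfolding alpha_elements_def by simp
    moreover have "line_elements axis_point int_lattice (2 * v) \<subseteq> carrier pi1_A"
      by (rule line_elements_carrier[OF double_lattice[OF v] subset_refl])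
    ultimately show ?thesis by (rule image_subset_iff_preimage)
  qed
  moreover have "down [^]\<^bsub>pi1_A\<^esub> k \<in> ?N" if "\<forall>x\<in>beta_elements (M \<i>). x [^]\<^bsub>pi1_O\<^esub> k \<in> K" for k :: nat
  proof -
    have "?t ` line_elements axis_point half_lattice \<i> = beta_elements (M \<i>)"
      using transport_line_elements[OF M(1) C int_lattice_ii half_lattice_superset] lattice_symmetry_half_lattice[OF M(1)] M(2)
      unfolding beta_elements_def by simp
    then have "?t down \<in> beta_elements (M \<i>)" using down_in_beta_infinity by blast
    then have "?t (down [^]\<^bsub>pi1_A\<^esub> k) \<in> K"
      using that hom_nat_pow[OF hom down_carrier group_pi1_A group_pi1_O] by simp
    then show ?thesis using monoid.nat_pow_closed[OF group.is_monoid[OF group_pi1_A] down_carrier] by blast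
  qed
  ultimately show thesis using that by blast
qed

text \<open>The map \<open>M \<circ> shear k \<circ> M\<^sup>-\<^sup>1\<close> is the \<open>k\<close>-th power of the half twist along \<open>\<beta>\<^sub>s\<close>, where \<open>s\<close> is the
  slope of \<open>M i\<close>.\<close>

lemma alpha_shear:
  assumes M: "lattice_symmetry M M'" "M 0 = 0" and K: "K \<lhd> pi1_O"
    and k: "\<forall>x\<in>beta_elements (M \<i>). x [^]\<^bsub>pi1_O\<^esub> nat \<bar>k\<bar> \<in> K" and v: "v \<in> int_lattice"
  shows "alpha_elements (M (shear k v)) \<subseteq> K \<longleftrightarrow> alpha_elements (M v) \<subseteq> K"
proof -
  obtain N where N: "N \<lhd> pi1_A"
    "\<And>v. v \<in> int_lattice \<Longrightarrow> alpha_elements (M v) \<subseteq> K \<longleftrightarrow> line_elements axis_point int_lattice (2 * v) \<subseteq> N"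
    "down [^]\<^bsub>pi1_A\<^esub> nat \<bar>k\<bar> \<in> N" using pullback_slopes[OF M K] k by metis
  interpret N: normal N pi1_A by (rule N(1))
  have mem: "shear_action k x \<in> N \<longleftrightarrow> x \<in> N" if "x \<in> carrier pi1_A" for x
    using shear_action_trivial[OF N(1,3) that] N.mem_iff_coset[OF that]
      N.mem_iff_coset[OF transport_closed(1)[OF shear_symmetry shear_fixes_seg that]] by simp
  have "shear k (2 * v) = 2 * shear k v" by (simp add: shear_def complex_eq_iff)
  then have "shear_action k ` line_elements axis_point int_lattice (2 * v) = line_elements axis_point int_lattice (2 * shear k v)"
    using transport_line_elements[OF shear_symmetry shear_fixes_seg double_lattice[OF v] subset_refl]
      lattice_symmetry_lattice[OF shear_symmetry] by simp
  then have "line_elements axis_point int_lattice (2 * shear k v) \<subseteq> N \<longleftrightarrow> line_elements axis_point int_lattice (2 * v) \<subseteq> N"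
    by (rule image_subset_iff_preserved[OF _ line_elements_carrier[OF double_lattice[OF v] subset_refl] mem])
  then show ?thesis using N(2)[OF v] N(2)[OF shear_lattice[OF v]] by simp
qed

lemma alpha_flip:
  assumes K: "K \<lhd> pi1_O" and k: "\<forall>x\<in>beta_elements \<i>. x [^]\<^bsub>pi1_O\<^esub> (2::nat) \<in> K" and v: "v \<in> int_lattice"
  shows "alpha_elements (flip v) \<subseteq> K \<longleftrightarrow> alpha_elements v \<subseteq> K"
proof -
  obtain N where N: "N \<lhd> pi1_A"
    "\<And>v. v \<in> int_lattice \<Longrightarrow> alpha_elements v \<subseteq> K \<longleftrightarrow> line_elements axis_point int_lattice (2 * v) \<subseteq> N"
    "down [^]\<^bsub>pi1_A\<^esub> (2::nat) \<in> N" using pullback_slopes[OF lattice_symmetry_id refl K] k by metis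
  interpret N: normal N pi1_A by (rule N(1))
  have inv: "inv\<^bsub>pi1_A\<^esub> rot_R = rot_R" using N.inv_equality[OF rot_R_square rot_carrier(1) rot_carrier(1)] .
  have mem: "flip_action x \<in> N \<longleftrightarrow> x \<in> N" if x: "x \<in> carrier pi1_A" for x
  proof -
    let ?y = "rot_R \<otimes>\<^bsub>pi1_A\<^esub> (x \<otimes>\<^bsub>pi1_A\<^esub> rot_R)"
    have y: "?y \<in> carrier pi1_A" using x rot_carrier(1) by simp
    have "?y = rot_R \<otimes>\<^bsub>pi1_A\<^esub> x \<otimes>\<^bsub>pi1_A\<^esub> inv\<^bsub>pi1_A\<^esub> rot_R" using x rot_carrier(1) inv by (simp add: N.m_assoc)
    moreover have "x = inv\<^bsub>pi1_A\<^esub> rot_R \<otimes>\<^bsub>pi1_A\<^esub> ?y \<otimes>\<^bsub>pi1_A\<^esub> rot_R"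
      using x rot_carrier(1) rot_R_square inv by (simp add: N.m_assoc) (simp add: rot_R_square flip: N.m_assoc)
    ultimately have "?y \<in> N \<longleftrightarrow> x \<in> N"
      using N.inv_op_closed2[OF rot_carrier(1), of x] N.inv_op_closed1[OF rot_carrier(1), of ?y] by auto
    then show ?thesis
      using flip_action_inner[OF N(1,3) x] N.mem_iff_coset[OF y]
        N.mem_iff_coset[OF transport_closed(1)[OF flip_symmetry flip_fixes_seg x]] by simp
  qed
  have "flip (2 * v) = 2 * flip v" by (simp add: flip_def complex_eq_iff)
  then have "flip_action ` line_elements axis_point int_lattice (2 * v) = line_elements axis_point int_lattice (2 * flip v)"
    using transport_line_elements[OF flip_symmetry flip_fixes_seg double_lattice[OF v] subset_refl]
      lattice_symmetry_lattice[OF flip_symmetry] by simp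
  then have "line_elements axis_point int_lattice (2 * flip v) \<subseteq> N \<longleftrightarrow> line_elements axis_point int_lattice (2 * v) \<subseteq> N"
    by (rule image_subset_iff_preserved[OF _ line_elements_carrier[OF double_lattice[OF v] subset_refl] mem])
  moreover have "flip v \<in> int_lattice" using v lattice_symmetry_lattice[OF flip_symmetry] by simp
  ultimately show ?thesis using N(2)[OF v] N(2) by simp
qed

section \<open>Slopes as primitive vectors\<close>

definition slope_of :: "int \<Rightarrow> int \<Rightarrow> rat option" where
  "slope_of a b = (if b = 0 then None else Some (of_int a / of_int b))"

lemma slope_of_uminus [simp]: "slope_of (- a) (- b) = slope_of a b"
  by (simp add: slope_of_def)

lemma num_den_slope_of:
  assumes "coprime a b" shows "num_den (slope_of a b) = (a, b) \<or> num_den (slope_of a b) = (- a, - b)"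
proof (cases "b = 0")
  case True
  then have "a = 1 \<or> a = - 1" using assms by auto
  then show ?thesis using True by (auto simp: slope_of_def)
next
  case False
  have q: "quotient_of (of_int a / of_int b) = (a, b)" if "b > 0" "coprime a b" for a b
    using that by (simp flip: Fract_of_int_quotient add: quotient_of_Fract)
  show ?thesis
  proof (cases "b > 0")
    case True
    then show ?thesis using q[OF True assms] by (simp add: slope_of_def)
  next
    case neg: False
    then have "quotient_of (of_int (- a) / of_int (- b)) = (- a, - b)" using False assms by (intro q) auto
    then show ?thesis using False by (simp add: slope_of_def)
  qed
qed

lemma num_denE:
  obtains a b where "num_den x = (a, b)" "coprime a b" "x = slope_of a b"
proof (cases x)
  case None
  then show thesis using that[of 1 0] by (simp add: slope_of_def)
next
  case (Some q)
  obtain a b where ab: "quotient_of q = (a, b)" by (cases "quotient_of q")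
  then show thesis
    using that[of a b] quotient_of_coprime[OF ab] quotient_of_div[OF ab] quotient_of_denom_pos[OF ab] Some
    by (simp add: slope_of_def)
qed

lemma slope_vector_eq: "num_den x = (a, b) \<Longrightarrow> slope_vector x = Complex (of_int b) (of_int a)"
  by (simp add: slope_vector_def)

lemma slope_vector_slope_of:
  assumes "coprime a b"
  shows "slope_vector (slope_of a b) = Complex (of_int b) (of_int a) \<or>
    slope_vector (slope_of a b) = - Complex (of_int b) (of_int a)"
  using num_den_slope_of[OF assms] by (auto simp: slope_vector_eq complex_eq_iff)

lemma slope_vector_lattice: "slope_vector x \<in> int_lattice"
  by (cases x rule: num_denE) (simp add: slope_vector_eq int_lattice_def)

lemma slope_vector_infinity [simp]: "slope_vector None = \<i>"
  by (simp add: slope_vector_def complex_eq_iff)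

lemma alpha_eq: "alpha s = alpha_elements (slope_vector s)"
  unfolding alpha_def alpha_elements_def by (rule line_loops_eq[OF double_lattice[OF slope_vector_lattice] subset_refl])

lemma beta_eq: "beta s = beta_elements (slope_vector s)"
  unfolding beta_def beta_elements_def by (rule line_loops_eq[OF slope_vector_lattice half_lattice_superset])

lemma alpha_elements_uminus: "alpha_elements (- v) = alpha_elements v"
  using line_elements_minus[of base_point int_lattice "2 * v"] by (simp add: alpha_elements_def)

lemma alpha_slope_of:
  assumes "coprime a b" shows "alpha (slope_of a b) = alpha_elements (Complex (of_int b) (of_int a))"
  using slope_vector_slope_of[OF assms] alpha_elements_uminus unfolding alpha_eq by metis

text \<open>A Farey triangle has vertices represented by \<open>u\<close>, \<open>v\<close> and \<open>u + v\<close> for a basis \<open>u, v\<close> of the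
  lattice, and the reflection in its side \<open>u, v\<close> replaces \<open>u + v\<close> by \<open>u - v\<close>.\<close>

lemma reflection_slope_of:
  assumes D: "p * q' - p' * q \<noteq> 0"
  shows "reflection (slope_of p q) (slope_of p' q') (slope_of (p + p') (q + q')) = slope_of (p - p') (q - q')"
proof -
  consider "q = 0" "q' \<noteq> 0" | "q \<noteq> 0" "q' = 0" | "q \<noteq> 0" "q' \<noteq> 0" "q + q' = 0" | "q \<noteq> 0" "q' \<noteq> 0" "q + q' \<noteq> 0"
    using D by (metis mult_zero_right diff_self)
  then show ?thesis
  proof cases
    case 1
    then show ?thesis by (simp add: slope_of_def field_simps)
  next
    case 2
    then show ?thesis by (simp add: slope_of_def field_simps)
  next
    case 3
    then have q': "q' = - q" by simp
    show ?thesis unfolding q' using 3(1) by (simp add: slope_of_def) (simp add: field_simps)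
  next
    case 4
    define P Q P' Q' where "P = (of_int p :: rat)" and "Q = (of_int q :: rat)"
      and "P' = (of_int p' :: rat)" and "Q' = (of_int q' :: rat)"
    have nz: "Q \<noteq> 0" "Q' \<noteq> 0" "Q + Q' \<noteq> 0" using 4 unfolding Q_def Q'_def by (simp_all flip: of_int_add)
    have "P * Q' - P' * Q = of_int (p * q' - p' * q)" by (simp add: P_def Q_def P'_def Q'_def)
    then have Dn: "P * Q' - P' * Q \<noteq> 0" using D by (simp only: of_int_eq_0_iff not_False_eq_True)
    define t m where "t = (P + P') / (Q + Q')" and "m = (P / Q + P' / Q') / 2"
    have tm: "t - m = (Q - Q') * (P * Q' - P' * Q) / (2 * Q * Q' * (Q + Q'))"
      using nz unfolding t_def m_def by (simp add: divide_simps) (simp add: algebra_simps)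
    have eqs: "slope_of p q = Some (P / Q)" "slope_of p' q' = Some (P' / Q')" "slope_of (p + p') (q + q') = Some t"
      using 4 unfolding t_def P_def Q_def P'_def Q'_def by (simp_all add: slope_of_def)
    have r: "reflection (Some (P / Q)) (Some (P' / Q')) (Some t) =
        (if t = m then None else Some (m + ((P' / Q' - P / Q) / 2)\<^sup>2 / (t - m)))"
      unfolding m_def by simp
    show ?thesis
    proof (cases "q = q'")
      case True
      then have "Q = Q'" unfolding Q_def Q'_def by simp
      then have "t = m" using tm by simp
      then show ?thesis unfolding eqs r using True by (simp add: slope_of_def)
    next
      case False
      then have QQ: "Q - Q' \<noteq> 0" unfolding Q_def Q'_def by simp
      then have "t - m \<noteq> 0" unfolding tm using nz Dn by simp
      have "m + ((P' / Q' - P / Q) / 2)\<^sup>2 / (t - m) = (P - P') / (Q - Q')"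
      proof -
        define d where "d = P * Q' - P' * Q"
        have "P' / Q' - P / Q = - d / (Q * Q')" using nz unfolding d_def by (simp add: divide_simps)
        then have "((P' / Q' - P / Q) / 2)\<^sup>2 / (t - m) = (d / (2 * Q * Q'))\<^sup>2 / ((Q - Q') * d / (2 * Q * Q' * (Q + Q')))"
          unfolding tm d_def[symmetric] by (simp add: power2_eq_square)
        also have "\<dots> = d * (Q + Q') / (2 * Q * Q' * (Q - Q'))"
          using nz QQ Dn unfolding d_def[symmetric]
          by (simp add: divide_simps power2_eq_square) (simp add: algebra_simps)
        finally have 1: "((P' / Q' - P / Q) / 2)\<^sup>2 / (t - m) = d * (Q + Q') / (2 * Q * Q' * (Q - Q'))" .
        have 2: "m = (P * Q' + P' * Q) * (Q - Q') / (2 * Q * Q' * (Q - Q'))"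
          using nz QQ unfolding m_def by (simp add: divide_simps)
        have "m + ((P' / Q' - P / Q) / 2)\<^sup>2 / (t - m) =
          ((P * Q' + P' * Q) * (Q - Q') + d * (Q + Q')) / (2 * Q * Q' * (Q - Q'))"
          unfolding 1 by (subst 2) (simp add: add_divide_distrib)
        also have "(P * Q' + P' * Q) * (Q - Q') + d * (Q + Q') = 2 * Q * Q' * (P - P')"
          unfolding d_def by (simp add: algebra_simps)
        also have "2 * Q * Q' * (P - P') / (2 * Q * Q' * (Q - Q')) = (P - P') / (Q - Q')" using nz by simp
        finally show ?thesis .
      qed
      then show ?thesis unfolding eqs r using False \<open>t - m \<noteq> 0\<close> by (simp add: slope_of_def P_def Q_def P'_def Q'_def)
    qed
  qed
qed

lemma farey_triangle_basis:
  assumes "farey_triangle x y z"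
  shows "\<exists>p q p' q'. x = slope_of p q \<and> y = slope_of p' q' \<and> z = slope_of (p + p') (q + q') \<and> \<bar>p * q' - p' * q\<bar> = 1"
  using assms
proof induction
  case base
  show ?case \<comment> \<open>the vectors \<open>0/1\<close> and \<open>(-1)/(-1)\<close>, with sum \<open>(-1)/0\<close>\<close>
    by (intro exI[of _ 0] exI[of _ 1] exI[of _ "-1"] exI[of _ "-1"]) (simp add: slope_of_def)
next
  case (swap x y z)
  then obtain p q p' q' where "x = slope_of p q" "y = slope_of p' q'" "z = slope_of (p + p') (q + q')" "\<bar>p * q' - p' * q\<bar> = 1"
    by blast
  then show ?case
    by (intro exI[of _ p'] exI[of _ q'] exI[of _ p] exI[of _ q]) (simp add: add.commute abs_minus_commute mult.commute)
next
  case (rotate x y z)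
  then obtain p q p' q' where *: "x = slope_of p q" "y = slope_of p' q'" "z = slope_of (p + p') (q + q')" "\<bar>p * q' - p' * q\<bar> = 1"
    by blast
  have "z = slope_of (- (p + p')) (- (q + q'))" "x = slope_of (p' + - (p + p')) (q' + - (q + q'))"
    using * slope_of_uminus[of "p + p'" "q + q'"] by simp_all
  moreover have "p' * (- (q + q')) - (- (p + p')) * q' = p * q' - p' * q" by (simp add: algebra_simps)
  ultimately show ?case using * by metis
next
  case (reflect x y z)
  then obtain p q p' q' where *: "x = slope_of p q" "y = slope_of p' q'" "z = slope_of (p + p') (q + q')" "\<bar>p * q' - p' * q\<bar> = 1"
    by blast
  then have "reflection x y z = slope_of (p - p') (q - q')" using reflection_slope_of[of p q' p' q] by force
  moreover have "y = slope_of (- p') (- q')" using * by simp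
  moreover have "\<bar>p * (- q') - (- p') * q\<bar> = 1" using *(4) by (simp add: abs_if split: if_splits)
  ultimately show ?case using *(1) by (intro exI[of _ p] exI[of _ q] exI[of _ "- p'"] exI[of _ "- q'"]) simp
qed

lemma farey_edge_infinity:
  assumes "farey_edge None b" obtains c :: int where "b = Some (of_int c)"
proof -
  obtain p q p' q' where *: "None = slope_of p q" "b = slope_of p' q'" "\<bar>p * q' - p' * q\<bar> = 1"
    using assms farey_triangle_basis unfolding farey_edge_def by metis
  then have "q = 0" by (simp add: slope_of_def split: if_splits)
  then have "\<bar>q' * p\<bar> = 1" using *(3) by (simp add: mult.commute)
  then have "\<bar>q'\<bar> = 1" by (rule abs_zmult_eq_1)
  then have "q' = 1 \<or> q' = -1" by linarith
  then show thesis using that[of p'] that[of "- p'"] *(2) by (auto simp: slope_of_def)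
qed

text \<open>Up to sign, the reflection in the edge from \<open>\<infinity>\<close> to the integer \<open>c\<close> acts on slope vectors as
  \<open>shear (2 c) \<circ> flip\<close>.\<close>

lemma alpha_reflection:
  assumes K: "K \<lhd> pi1_O" and b: "\<forall>x\<in>beta_elements \<i>. x [^]\<^bsub>pi1_O\<^esub> (2::nat) \<in> K"
  shows "alpha (reflection None (Some (of_int c)) s) \<subseteq> K \<longleftrightarrow> alpha s \<subseteq> K"
proof -
  obtain a d where s: "num_den s = (a, d)" "coprime a d" "s = slope_of a d" by (rule num_denE)
  have "reflection None (Some (of_int c)) s = slope_of (2 * c * d - a) d"
    unfolding s(3) by (simp add: slope_of_def field_simps)
  moreover have "coprime (2 * c * d - a) d"
  proof (rule coprimeI)
    fix e assume "e dvd 2 * c * d - a" "e dvd d"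
    then have "e dvd 2 * c * d - (2 * c * d - a)" by (blast intro: dvd_diff dvd_mult)
    then have "e dvd a" by simp
    then show "is_unit e" using \<open>e dvd d\<close> s(2) by (meson coprime_common_divisor)
  qed
  ultimately have 1: "alpha (reflection None (Some (of_int c)) s) = alpha_elements (Complex (of_int d) (of_int (2 * c * d - a)))"
    using alpha_slope_of by metis
  have "Complex (of_int d) (of_int (2 * c * d - a)) = - shear (2 * c) (flip (slope_vector s))"
    unfolding slope_vector_eq[OF s(1)] by (simp add: shear_def flip_def complex_eq_iff)
  then have 2: "alpha (reflection None (Some (of_int c)) s) = alpha_elements (shear (2 * c) (flip (slope_vector s)))"
    unfolding 1 by (simp add: alpha_elements_uminus)
  interpret K: normal K pi1_O by (rule K)
  have b': "\<forall>x\<in>beta_elements \<i>. x [^]\<^bsub>pi1_O\<^esub> nat \<bar>2 * c\<bar> \<in> K"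
  proof
    fix x assume x: "x \<in> beta_elements \<i>"
    then have xc: "x \<in> carrier pi1_O"
      using line_elements_carrier[OF int_lattice_ii half_lattice_superset] unfolding beta_elements_def pi1_O_at_base by blast
    have "nat \<bar>2 * c\<bar> = 2 * nat \<bar>c\<bar>" by (simp add: abs_mult nat_mult_distrib)
    then have "x [^]\<^bsub>pi1_O\<^esub> nat \<bar>2 * c\<bar> = (x [^]\<^bsub>pi1_O\<^esub> (2::nat)) [^]\<^bsub>pi1_O\<^esub> nat \<bar>c\<bar>"
      using K.nat_pow_pow[OF xc, of 2 "nat \<bar>c\<bar>"] by (simp only:)
    moreover have "y [^]\<^bsub>pi1_O\<^esub> (m::nat) \<in> K" if "y \<in> K" for y m
      by (induction m) (use that in \<open>auto intro: K.m_closed\<close>)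
    ultimately show "x [^]\<^bsub>pi1_O\<^esub> nat \<bar>2 * c\<bar> \<in> K" using b x by (simp only:)
  qed
  have fl: "flip (slope_vector s) \<in> int_lattice" using slope_vector_lattice lattice_symmetry_lattice[OF flip_symmetry] by simp
  show ?thesis
    unfolding 2 using alpha_shear[OF lattice_symmetry_id refl K b' fl] alpha_flip[OF K b slope_vector_lattice]
    unfolding alpha_eq by simp
qed

text \<open>The transvection \<open>v \<mapsto> v + e det((p, q), v) (p, q)\<close> on slopes; \<open>e = -1\<close> gives the inverse
  of \<^const>\<open>unit_shift\<close>.\<close>

definition transvection :: "int \<Rightarrow> int \<Rightarrow> int \<Rightarrow> rat option \<Rightarrow> rat option" where
  "transvection e p q x = (case num_den x of (a, b) \<Rightarrow>
     slope_of (a + e * (p * b - q * a) * p) (b + e * (p * b - q * a) * q))"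

lemma unit_shift_eq:
  assumes "num_den (Some r) = (p, q)" shows "unit_shift r = transvection 1 p q"
  using assms by (auto simp: fun_eq_iff unit_shift_def transvection_def slope_of_def Let_def split: prod.splits)

lemma coprime_transvection:
  assumes "coprime (a::int) b"
  shows "coprime (a + e * (p * b - q * a) * p) (b + e * (p * b - q * a) * q)"
proof (rule coprimeI)
  fix c assume c: "c dvd a + e * (p * b - q * a) * p" "c dvd b + e * (p * b - q * a) * q"
  have "p * (b + e * (p * b - q * a) * q) - q * (a + e * (p * b - q * a) * p) = p * b - q * a" by (simp add: algebra_simps)
  then have d: "c dvd p * b - q * a" using c by (metis dvd_diff dvd_mult)
  have "c dvd e * (p * b - q * a) * p" "c dvd e * (p * b - q * a) * q" using d by (metis dvd_mult dvd_mult2)+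
  then have "c dvd a" "c dvd b" using c by (metis dvd_add_left_iff)+
  then show "is_unit c" using assms by (meson coprime_common_divisor)
qed

lemma transvection_slope_of:
  assumes "coprime a b"
  shows "transvection e p q (slope_of a b) = slope_of (a + e * (p * b - q * a) * p) (b + e * (p * b - q * a) * q)"
proof -
  have "- a + e * (p * - b - q * - a) * p = - (a + e * (p * b - q * a) * p)"
    "- b + e * (p * - b - q * - a) * q = - (b + e * (p * b - q * a) * q)" by (simp_all add: algebra_simps)
  note e = this
  show ?thesis using num_den_slope_of[OF assms]
  proof
    assume n: "num_den (slope_of a b) = (- a, - b)"
    show ?thesis unfolding transvection_def n prod.case e by (rule slope_of_uminus)
  qed (simp add: transvection_def)
qed

lemma transvection_inverse: "transvection (- e) p q (transvection e p q x) = x"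
proof -
  obtain a b where x: "num_den x = (a, b)" "coprime a b" "x = slope_of a b" by (rule num_denE)
  let ?d = "p * b - q * a"
  let ?a = "a + e * ?d * p" and ?b = "b + e * ?d * q"
  have d: "p * ?b - q * ?a = ?d" by (simp add: algebra_simps)
  have "transvection (- e) p q (transvection e p q x) = slope_of (?a + - e * (p * ?b - q * ?a) * p) (?b + - e * (p * ?b - q * ?a) * q)"
    unfolding x(3) transvection_slope_of[OF x(2)] by (rule transvection_slope_of[OF coprime_transvection[OF x(2)]])
  also have "\<dots> = slope_of a b" unfolding d by simp
  finally show ?thesis unfolding x(3) .
qed

lemma bij_unit_shift: "bij (unit_shift r)"
proof -
  obtain p q where r: "num_den (Some r) = (p, q)" by (cases "num_den (Some r)")
  show ?thesis unfolding unit_shift_eq[OF r]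
    by (rule o_bij[where g = "transvection (- 1) p q"])
      (use transvection_inverse[of 1 p q] transvection_inverse[of "-1" p q] in \<open>auto simp: fun_eq_iff\<close>)
qed

definition linear_map :: "int \<Rightarrow> int \<Rightarrow> int \<Rightarrow> int \<Rightarrow> complex \<Rightarrow> complex" where
  "linear_map a b c d z = Complex (of_int a * Re z + of_int b * Im z) (of_int c * Re z + of_int d * Im z)"

lemma linear_map_symmetry:
  assumes "a * d - b * c = 1" shows "lattice_symmetry (linear_map a b c d) (linear_map d (- b) (- c) a)"
proof -
  have lin: "linear (linear_map a b c d)" for a b c d
    by (auto simp: linear_iff linear_map_def complex_eq_iff algebra_simps)
  have inv: "linear_map d (- b) (- c) a (linear_map a b c d z) = z" if "a * d - b * c = 1" for a b c d z
  proof -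
    have e: "(of_int a * of_int d - of_int b * of_int c :: real) = 1" using that by (metis of_int_1 of_int_diff of_int_mult)
    have "of_int d * (of_int a * Re z + of_int b * Im z) + of_int (- b) * (of_int c * Re z + of_int d * Im z)
        = (of_int a * of_int d - of_int b * of_int c) * Re z" by (simp add: algebra_simps)
    moreover have "of_int (- c) * (of_int a * Re z + of_int b * Im z) + of_int a * (of_int c * Re z + of_int d * Im z)
        = (of_int a * of_int d - of_int b * of_int c) * Im z" by (simp add: algebra_simps)
    ultimately show ?thesis unfolding linear_map_def e by (simp add: complex_eq_iff)
  qed
  have lat: "linear_map a b c d z \<in> int_lattice" if "z \<in> int_lattice" for a b c d z
    using that by (auto simp: linear_map_def int_lattice_def)
  have i1: "linear_map d (- b) (- c) a (linear_map a b c d z) = z" for z by (rule inv[OF assms])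
  have i2: "linear_map a b c d (linear_map d (- b) (- c) a z) = z" for z
    using inv[of d a "- b" "- c" z] assms by (simp add: mult.commute)
  have "linear_map a b c d z \<in> int_lattice \<longleftrightarrow> z \<in> int_lattice" for z
    using lat[of z a b c d] lat[of "linear_map a b c d z" d "- b" "- c" a] unfolding i1 by auto
  moreover have "linear_map a b c d 0 = 0" for a b c d by (simp add: linear_map_def complex_eq_iff)
  ultimately show ?thesis unfolding lattice_symmetry_def using lin i1 i2 by simp
qed

text \<open>If \<open>M\<close> has determinant 1 and takes \<open>i\<close> to the vector of \<open>r\<close>, the transvection along this vector
  is \<open>M \<circ> shear 1 \<circ> M\<^sup>-\<^sup>1\<close>.\<close>

lemma alpha_unit_shift_power:
  assumes K: "K \<lhd> pi1_O" and b: "\<forall>x\<in>beta (Some r). x [^]\<^bsub>pi1_O\<^esub> (k::nat) \<in> K"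
  shows "alpha ((unit_shift r ^^ k) s) \<subseteq> K \<longleftrightarrow> alpha s \<subseteq> K"
proof -
  obtain p q where r: "num_den (Some r) = (p, q)" "coprime p q" by (rule num_denE)
  obtain c d where cd: "d * p - q * c = 1"
  proof -
    obtain u v where "u * p + v * q = 1" using r(2) bezout_int[of p q] by (auto simp: coprime_iff_gcd_eq_1)
    then show thesis using that[of u "- v"] by (simp add: mult.commute)
  qed
  let ?M = "linear_map d q c p" and ?M' = "linear_map p (- q) (- c) d"
  have M: "lattice_symmetry ?M ?M'" using cd by (rule linear_map_symmetry)
  have M0: "?M 0 = 0" by (simp add: linear_map_def complex_eq_iff)
  have Mi: "?M \<i> = slope_vector (Some r)" unfolding slope_vector_eq[OF r(1)] by (simp add: linear_map_def complex_eq_iff)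
  have step: "\<exists>e\<in>{1, -1}. slope_vector (unit_shift r x) = e * ?M (shear 1 (?M' (slope_vector x)))" for x
  proof -
    obtain a b where x: "num_den x = (a, b)" "coprime a b" "x = slope_of a b" by (rule num_denE)
    let ?e = "p * b - q * a"
    define w where "w = ?M' (slope_vector x)"
    have Mw: "slope_vector x = ?M w" unfolding w_def using lattice_symmetry_inverse[OF M] by simp
    have Re_w: "Re w = of_int ?e" unfolding w_def slope_vector_eq[OF x(1)] by (simp add: linear_map_def)
    have "?M (shear 1 w) = ?M w + of_real (Re w) * slope_vector (Some r)"
      unfolding slope_vector_eq[OF r(1)] by (simp add: linear_map_def shear_def complex_eq_iff algebra_simps)
    also have "of_real (Re w) = (of_int ?e :: complex)" unfolding Re_w by simp
    also have "?M w + of_int ?e * slope_vector (Some r) = Complex (of_int (b + 1 * ?e * q)) (of_int (a + 1 * ?e * p))"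
      unfolding Mw[symmetric] slope_vector_eq[OF x(1)] slope_vector_eq[OF r(1)] by (simp add: complex_eq_iff)
    finally have 1: "?M (shear 1 w) = Complex (of_int (b + 1 * ?e * q)) (of_int (a + 1 * ?e * p))" .
    have "unit_shift r x = slope_of (a + 1 * ?e * p) (b + 1 * ?e * q)"
      unfolding unit_shift_eq[OF r(1)] x(3) by (rule transvection_slope_of[OF x(2)])
    then show ?thesis
      using slope_vector_slope_of[OF coprime_transvection[OF x(2), of 1 p q]] unfolding w_def[symmetric] 1 by auto
  qed
  have "\<exists>e\<in>{1, -1}. slope_vector ((unit_shift r ^^ m) s) = e * ?M (shear (int m) (?M' (slope_vector s)))" for m
  proof (induction m)
    case 0
    have "shear (int 0) z = z" for z by (simp add: shear_def)
    then show ?case using lattice_symmetry_inverse[OF M] by simp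
  next
    case (Suc m)
    let ?x = "(unit_shift r ^^ m) s"
    obtain e where e: "e \<in> {1, -1}" "slope_vector ?x = e * ?M (shear (int m) (?M' (slope_vector s)))" using Suc by blast
    obtain e' where e': "e' \<in> {1, -1}" "slope_vector (unit_shift r ?x) = e' * ?M (shear 1 (?M' (slope_vector ?x)))"
      using step by blast
    have lin: "?M' (e * z) = e * ?M' z" "shear 1 (e * z) = e * shear 1 z" "?M (e * z) = e * ?M z" for z
      using e(1) by (auto simp: linear_map_def shear_def complex_eq_iff)
    have "shear 1 (shear (int m) z) = shear (int (Suc m)) z" for z by (simp add: shear_def complex_eq_iff algebra_simps)
    then have "slope_vector (unit_shift r ?x) = (e' * e) * ?M (shear (int (Suc m)) (?M' (slope_vector s)))"
      unfolding e'(2) e(2) lin lattice_symmetry_inverse[OF M] by simp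
    moreover have "e' * e \<in> {1, -1}" using e(1) e'(1) by auto
    ultimately show ?case by (simp only: funpow.simps comp_apply) blast
  qed
  then obtain e where "e \<in> {1, -1}" "slope_vector ((unit_shift r ^^ k) s) = e * ?M (shear (int k) (?M' (slope_vector s)))" by blast
  then have 1: "alpha ((unit_shift r ^^ k) s) = alpha_elements (?M (shear (int k) (?M' (slope_vector s))))"
    unfolding alpha_eq using alpha_elements_uminus by auto
  have b': "\<forall>x\<in>beta_elements (?M \<i>). x [^]\<^bsub>pi1_O\<^esub> nat \<bar>int k\<bar> \<in> K" using b unfolding Mi beta_eq by simp
  have v: "?M' (slope_vector s) \<in> int_lattice"
    using slope_vector_lattice lattice_symmetry_lattice[OF lattice_symmetry_sym[OF M]] by simp
  show ?thesis unfolding 1 alpha_shear[OF M M0 K b' v] lattice_symmetry_inverse[OF M]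
    by (simp add: alpha_eq)
qed

lemma generate_BijGroup_invariant:
  assumes "g \<in> generate (BijGroup UNIV) X" and X: "X \<subseteq> Bij UNIV" "\<And>h s. h \<in> X \<Longrightarrow> Q (h s) \<longleftrightarrow> Q s"
  shows "g \<in> Bij UNIV \<and> (\<forall>s. Q (g s) \<longleftrightarrow> Q s)"
  using assms(1)
proof induction
  case one
  have "\<one>\<^bsub>BijGroup UNIV\<^esub> = (\<lambda>x::'a. x)" by (simp add: BijGroup_def restrict_def)
  then show ?case by (auto simp: Bij_def bij_betw_def)
next
  case (incl h)
  then show ?case using X by blast
next
  case (inv h)
  then have h: "h \<in> Bij UNIV" using X by blast
  then have bij: "bij h" by (simp add: Bij_def)
  have eq: "inv\<^bsub>BijGroup UNIV\<^esub> h = inv_into UNIV h" using inv_BijGroup[OF h] by (simp add: restrict_def)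
  have "Q (inv_into UNIV h s) \<longleftrightarrow> Q s" for s
    using X(2)[OF inv, of "inv_into UNIV h s"] bij by (simp add: bij_is_surj surj_f_inv_f)
  moreover have "inv_into UNIV h \<in> Bij UNIV" using bij by (simp add: Bij_def bij_imp_bij_inv)
  ultimately show ?case unfolding eq by blast
next
  case (eng g h)
  then have e: "g \<otimes>\<^bsub>BijGroup UNIV\<^esub> h = g \<circ> h" using BijGroup_mult_comp by blast
  have "g \<circ> h \<in> Bij UNIV" using eng.IH by (simp add: Bij_def bij_comp)
  moreover have "\<forall>s. Q ((g \<circ> h) s) \<longleftrightarrow> Q s" using eng.IH by simp
  ultimately show ?case unfolding e by blast
qed

text \<open>The reflections that generate \<open>\<Gamma>\<^sub>\<infinity>\<close> preserve the condition because of \<open>\<beta>\<^sub>\<infinity>\<^sup>2\<close>, and the generator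
  of \<open>C\<^sub>r(2n)\<close> does because of \<open>\<beta>\<^sub>r\<^bsup>2n\<^esup>\<close>.\<close>

lemma alpha_orbit:
  assumes K: "K \<lhd> pi1_O" and b: "\<forall>x\<in>beta None. x [^]\<^bsub>pi1_O\<^esub> (2::nat) \<in> K"
    and br: "\<forall>x\<in>beta (Some r). x [^]\<^bsub>pi1_O\<^esub> nat \<lfloor>2 * n\<rfloor> \<in> K" and t: "t \<in> Gamma_orbit r n s"
  shows "alpha t \<subseteq> K \<longleftrightarrow> alpha s \<subseteq> K"
proof -
  let ?Q = "\<lambda>s. alpha s \<subseteq> K"
  have G: "g \<in> Bij UNIV \<and> (\<forall>s. ?Q (g s) \<longleftrightarrow> ?Q s)" if "g \<in> Gamma_inf" for g
    using that unfolding Gamma_inf_def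
  proof (rule generate_BijGroup_invariant)
    show "{reflection None b | b. farey_edge None b} \<subseteq> Bij UNIV"
    proof
      fix h assume "h \<in> {reflection None b | b. farey_edge None b}"
      then obtain c :: int where h: "h = reflection None (Some (of_int c))" using farey_edge_infinity by auto
      have "h \<circ> h = id" unfolding h by (auto simp: fun_eq_iff option.map_comp comp_def option.map_ident)
      then show "h \<in> Bij UNIV" unfolding Bij_def using o_bij by auto
    qed
    fix h s assume "h \<in> {reflection None b | b. farey_edge None b}"
    then obtain c :: int where h: "h = reflection None (Some (of_int c))" using farey_edge_infinity by auto
    show "?Q (h s) \<longleftrightarrow> ?Q s" unfolding h
      by (rule alpha_reflection[OF K]) (use b in \<open>simp add: beta_eq\<close>)
  qed
  have C: "g \<in> Bij UNIV \<and> (\<forall>s. ?Q (g s) \<longleftrightarrow> ?Q s)" if "g \<in> C_group r (nat \<lfloor>2 * n\<rfloor>)" for g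
    using that unfolding C_group_def
  proof (rule generate_BijGroup_invariant)
    show "{unit_shift r ^^ nat \<lfloor>2 * n\<rfloor>} \<subseteq> Bij UNIV" using bij_fn[OF bij_unit_shift] by (simp add: Bij_def)
    show "?Q (h s) \<longleftrightarrow> ?Q s" if "h \<in> {unit_shift r ^^ nat \<lfloor>2 * n\<rfloor>}" for h s
      using alpha_unit_shift_power[OF K br] that by simp
  qed
  have "g \<in> Bij UNIV \<and> (\<forall>s. ?Q (g s) \<longleftrightarrow> ?Q s)" if "g \<in> Gamma r n" for g
    using that unfolding Gamma_def by (rule generate_BijGroup_invariant) (use G C in auto)
  then show ?thesis using t unfolding Gamma_orbit_def by auto
qed

section \<open>The kernel of the Heckoid group is normal in the orbifold group\<close>

lemma normal_closure_normal:
  fixes G (structure)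
  assumes "group G" "X \<subseteq> carrier G" shows "normal_closure G X \<lhd> G"
proof -
  interpret group G by (rule assms)
  let ?F = "{N. N \<lhd> G \<and> X \<subseteq> N}"
  have "carrier G \<lhd> G" by (rule normal_invI[OF subgroup_self]) simp
  then have ne: "?F \<noteq> {}" using assms(2) by blast
  have sub: "subgroup (\<Inter>?F) G"
    by (rule subgroups_Inter[OF _ ne]) (auto dest: normal_imp_subgroup)
  show ?thesis unfolding normal_closure_def
  proof (rule normal_invI[OF sub])
    fix x h assume xh: "x \<in> carrier G" "h \<in> \<Inter>?F"
    show "x \<otimes> h \<otimes> inv x \<in> \<Inter>?F"
    proof
      fix N assume N: "N \<in> ?F"
      then show "x \<otimes> h \<otimes> inv x \<in> N" using normal.inv_op_closed2[of N G x h] xh by blast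
    qed
  qed
qed

lemma normal_closure_superset: "X \<subseteq> normal_closure G X"
  unfolding normal_closure_def by blast

lemma normal_closure_minimal: "N \<lhd> G \<Longrightarrow> X \<subseteq> N \<Longrightarrow> normal_closure G X \<subseteq> N"
  unfolding normal_closure_def by blast

lemma conjugation_hom:
  fixes G (structure)
  assumes "S \<lhd> G" "y \<in> carrier G"
  shows "(\<lambda>x. y \<otimes>\<^bsub>G\<^esub> x \<otimes>\<^bsub>G\<^esub> inv\<^bsub>G\<^esub> y) \<in> hom (G\<lparr>carrier := S\<rparr>) (G\<lparr>carrier := S\<rparr>)"
proof -
  interpret normal S G by (rule assms)
  have eq: "y \<otimes> (a \<otimes> b) \<otimes> inv y = (y \<otimes> a \<otimes> inv y) \<otimes> (y \<otimes> b \<otimes> inv y)" if "a \<in> S" "b \<in> S" for a b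
  proof -
    have c: "a \<in> carrier G" "b \<in> carrier G" using that subset by auto
    have "inv y \<otimes> (y \<otimes> (b \<otimes> inv y)) = b \<otimes> inv y" using assms(2) c by (simp flip: m_assoc)
    then show ?thesis using assms(2) c by (simp add: m_assoc)
  qed
  show ?thesis by (rule homI) (use assms(2) inv_op_closed2 eq in auto)
qed

text \<open>Conjugation by an element of \<open>G\<close> restricts to an automorphism of \<open>S\<close>, and it permutes the normal
  subgroups of \<open>S\<close> that contain \<open>X\<close>.\<close>

lemma normal_closure_in_normal_subgroup:
  assumes S: "S \<lhd> G" and X: "X \<subseteq> S"
    and inv: "\<And>y x. y \<in> carrier G \<Longrightarrow> x \<in> X \<Longrightarrow> y \<otimes>\<^bsub>G\<^esub> x \<otimes>\<^bsub>G\<^esub> inv\<^bsub>G\<^esub> y \<in> X"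
  shows "normal_closure (G\<lparr>carrier := S\<rparr>) X \<lhd> G"
proof -
  interpret S: normal S G by (rule S)
  let ?GS = "G\<lparr>carrier := S\<rparr>"
  have grp: "group ?GS" using S.subgroup_imp_group[OF S.is_subgroup] .
  have N: "normal_closure ?GS X \<lhd> ?GS" by (rule normal_closure_normal[OF grp]) (use X in simp)
  have "subgroup (normal_closure ?GS X) G"
    using S.incl_subgroup[OF S.is_subgroup normal_imp_subgroup[OF N]] .
  then show ?thesis
  proof (rule S.normal_invI)
    fix y h assume y: "y \<in> carrier G" and h: "h \<in> normal_closure ?GS X"
    let ?c = "\<lambda>x. y \<otimes>\<^bsub>G\<^esub> x \<otimes>\<^bsub>G\<^esub> inv\<^bsub>G\<^esub> y"
    have "{x \<in> carrier ?GS. ?c x \<in> normal_closure ?GS X} \<lhd> ?GS"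
      by (rule normal_preimage[OF grp N conjugation_hom[OF S y]])
    moreover have "X \<subseteq> {x \<in> carrier ?GS. ?c x \<in> normal_closure ?GS X}"
      using X inv[OF y] normal_closure_superset[of X ?GS] by auto
    ultimately show "?c h \<in> normal_closure ?GS X" using normal_closure_minimal h by blast
  qed
qed

text \<open>Thus the action of symmetries on line elements describes their conjugates as well.\<close>

lemma conjugation_eq_transport:
  assumes g: "(g, D) \<in> carrier (pi1_O_at x)" and s: "lattice_symmetry g g'" and Y: "Y \<in> carrier (pi1_O_at x)"
  shows "(g, D) \<otimes>\<^bsub>pi1_O_at x\<^esub> Y \<otimes>\<^bsub>pi1_O_at x\<^esub> inv\<^bsub>pi1_O_at x\<^esub> (g, D) = transport g g' D Y"
proof -
  have gD: "g \<in> H_hat_group" "D \<in> arrows x (g x)" using g by (auto simp: carrier_pi1_O_at)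
  interpret group "pi1_O_at x" by (rule group_pi1_O_at[OF arrows_in_plane(1)[OF gD(2)]])
  obtain h E where YE: "Y = (h, E)" by (cases Y)
  then have h: "h \<in> H_hat_group" "E \<in> arrows x (h x)" using Y by (auto simp: carrier_pi1_O_at)
  let ?k = "g \<circ> h \<circ> g'"
  obtain k' where k: "lattice_symmetry ?k k'" using conjugate_motion_symmetry[OF s h(1)] by metis
  note T = transport_arrows[OF s gD(2) h]
  have kg: "?k \<circ> g = g \<circ> h" by (simp add: fun_eq_iff lattice_symmetry_inverse[OF s])
  have kD: "cimg ?k D \<in> arrows (?k x) (g (h x))" using cimg_arrows[OF k gD(2)] by (simp add: lattice_symmetry_inverse[OF s])
  have "transport g g' D Y \<otimes>\<^bsub>pi1_O_at x\<^esub> (g, D) = (?k \<circ> g, (D \<odot> cimg g E \<odot> crev (cimg ?k D)) \<odot> cimg ?k D)"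
    unfolding YE transport_def prod.case by (rule mult_pi1_O_at[OF conjugate_motion(1)[OF s h(1)] T(3) gD(2)])
  also have "(D \<odot> cimg g E \<odot> crev (cimg ?k D)) \<odot> cimg ?k D = D \<odot> cimg g E \<odot> crev (cimg ?k D) \<odot> cimg ?k D"
    using cjoin_assoc[OF gD(2) cjoin_arrows[OF T(1) crev_arrows[OF kD]] kD]
      cjoin_assoc[OF T(1) crev_arrows[OF kD] kD] by simp
  also have "\<dots> = D \<odot> cimg g E" using cjoin_inverse_left[OF kD] cjoin_unit_right[OF T(1)] by simp
  also have "(?k \<circ> g, D \<odot> cimg g E) = (g, D) \<otimes>\<^bsub>pi1_O_at x\<^esub> Y" unfolding kg YE mult_pi1_O_at[OF gD h(2)] ..
  finally have "transport g g' D Y \<otimes>\<^bsub>pi1_O_at x\<^esub> (g, D) = (g, D) \<otimes>\<^bsub>pi1_O_at x\<^esub> Y" .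
  then have "(g, D) \<otimes>\<^bsub>pi1_O_at x\<^esub> Y = transport g g' D Y \<otimes>\<^bsub>pi1_O_at x\<^esub> (g, D)" ..
  moreover have "transport g g' D Y \<in> carrier (pi1_O_at x)" by (rule transport_closed(1)[OF s gD(2) Y])
  ultimately show ?thesis using g by (simp add: m_assoc)
qed

lemma carrier_pi1_S: "carrier pi1_S = pi1_S_at base_point"
  by (simp add: pi1_S_eq)

lemma carrier_pi1_S_subset: "carrier pi1_S \<subseteq> carrier pi1_O"
  unfolding carrier_pi1_S pi1_O_at_base by (rule pi1_S_at_subset)

lemma pi1_S_normal: "carrier pi1_S \<lhd> pi1_O"
proof -
  interpret group pi1_O by (rule group_pi1_O)
  have S: "pi1_S = pi1_O\<lparr>carrier := carrier pi1_S\<rparr>" unfolding carrier_pi1_S by (rule pi1_S_eq)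
  have "subgroup (carrier pi1_S) pi1_O"
    by (rule group_incl_imp_subgroup[OF carrier_pi1_S_subset]) (use group_pi1_S S in metis)
  then show ?thesis
  proof (rule normal_invI)
    fix y h assume y: "y \<in> carrier pi1_O" and h: "h \<in> carrier pi1_S"
    obtain g D where yg: "y = (g, D)" by (cases y)
    have gD: "(g, D) \<in> carrier (pi1_O_at base_point)" "D \<in> arrows base_point (g base_point)" "g \<in> H_hat_group"
      using y unfolding yg pi1_O_at_base by (auto simp: carrier_pi1_O_at)
    obtain g' where s: "lattice_symmetry g g'" using motion_symmetry[OF gD(3)] by metis
    have hc: "h \<in> carrier (pi1_O_at base_point)" using h carrier_pi1_S_subset unfolding pi1_O_at_base by blast
    show "y \<otimes>\<^bsub>pi1_O\<^esub> h \<otimes>\<^bsub>pi1_O\<^esub> inv\<^bsub>pi1_O\<^esub> y \<in> carrier pi1_S"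
      unfolding yg pi1_O_at_base conjugation_eq_transport[OF gD(1) s hc] carrier_pi1_S
      by (rule transport_closed(2)[OF s gD(2)]) (use h in \<open>simp add: carrier_pi1_S\<close>)
  qed
qed

lemma pi1_S_restrict: "pi1_S = pi1_O\<lparr>carrier := carrier pi1_S\<rparr>"
  unfolding carrier_pi1_S by (rule pi1_S_eq)

lemma motion_linear_part:
  assumes "g \<in> H_hat_group" shows "g v - g 0 = v \<or> g v - g 0 = - v"
  using assms unfolding H_hat_group_eq by (cases rule: motionsE) auto

lemma alpha_elements_pi1_S: "v \<in> int_lattice \<Longrightarrow> alpha_elements v \<subseteq> carrier pi1_S"
  unfolding alpha_elements_def carrier_pi1_S by (rule line_elements_pi1_S) auto

lemma alpha_conjugate:
  assumes y: "y \<in> carrier pi1_O" and x: "x \<in> alpha s"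
  shows "y \<otimes>\<^bsub>pi1_O\<^esub> x \<otimes>\<^bsub>pi1_O\<^esub> inv\<^bsub>pi1_O\<^esub> y \<in> alpha s"
proof -
  obtain g D where yg: "y = (g, D)" by (cases y)
  have gD: "(g, D) \<in> carrier (pi1_O_at base_point)" "D \<in> arrows base_point (g base_point)" "g \<in> H_hat_group"
    using y unfolding yg pi1_O_at_base by (auto simp: carrier_pi1_O_at)
  obtain g' where s: "lattice_symmetry g g'" using motion_symmetry[OF gD(3)] by metis
  let ?v = "2 * slope_vector s"
  have v: "?v \<in> int_lattice" by (rule double_lattice[OF slope_vector_lattice])
  have xl: "x \<in> line_elements base_point int_lattice ?v" using x unfolding alpha_eq alpha_elements_def .
  have xc: "x \<in> carrier (pi1_O_at base_point)" using line_elements_carrier[OF v subset_refl] xl by blast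
  have "transport g g' D x \<in> line_elements base_point int_lattice (g ?v - g 0)"
    using transport_line_elements[OF s gD(2) v subset_refl lattice_symmetry_lattice[OF s]] xl by blast
  also have "line_elements base_point int_lattice (g ?v - g 0) = line_elements base_point int_lattice ?v"
    using motion_linear_part[OF gD(3), of ?v] line_elements_minus by metis
  finally show ?thesis
    unfolding yg pi1_O_at_base conjugation_eq_transport[OF gD(1) s xc] alpha_eq alpha_elements_def .
qed

lemma alpha_subset_pi1_S: "alpha s \<subseteq> carrier pi1_S"
  unfolding alpha_eq by (rule alpha_elements_pi1_S[OF slope_vector_lattice])

lemma beta_subset_pi1_O: "beta s \<subseteq> carrier pi1_O"
  unfolding beta_eq beta_elements_def pi1_O_at_base by (rule line_elements_carrier[OF slope_vector_lattice half_lattice_superset])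

lemma pow_pi1_S: "x [^]\<^bsub>pi1_S\<^esub> (k::nat) = x [^]\<^bsub>pi1_O\<^esub> k"
  by (subst pi1_S_restrict) (rule monoid.nat_pow_consistent[OF group.is_monoid[OF group_pi1_O], symmetric])

lemma square_pi1_O: "x \<in> carrier pi1_O \<Longrightarrow> x [^]\<^bsub>pi1_O\<^esub> (2::nat) = x \<otimes>\<^bsub>pi1_O\<^esub> x"
  using monoid.l_one[OF group.is_monoid[OF group_pi1_O]] by (simp add: numeral_2_eq_2)

lemma beta_square_alpha:
  assumes "x \<in> beta s" shows "x [^]\<^bsub>pi1_O\<^esub> (2::nat) \<in> alpha s"
proof -
  have "x \<in> carrier pi1_O" using assms beta_subset_pi1_O by blast
  then show ?thesis
    using square_beta_alpha[OF slope_vector_lattice] assms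
    unfolding beta_eq beta_elements_def alpha_eq alpha_elements_def
    by (simp add: square_pi1_O) (simp add: pi1_O_at_base)
qed

text \<open>If \<open>n\<close> is an integer, the kernel is a normal closure in \<open>\<pi>\<^sub>1(S)\<close> only. But conjugation by \<open>\<pi>\<^sub>1(O)\<close>
  permutes its generators, and the squares of the elements of \<open>\<beta>\<^sub>s\<close> belong to \<open>\<alpha>\<^sub>s\<close>, so the kernel has the
  same properties as for half-integers.\<close>

lemma heckoid_kernel_properties:
  assumes n: "n > 1" "2 * n \<in> \<int>"
  shows "heckoid_kernel r n \<lhd> pi1_O"
    and "alpha None \<subseteq> heckoid_kernel r n"
    and "\<forall>x\<in>beta None. x [^]\<^bsub>pi1_O\<^esub> (2::nat) \<in> heckoid_kernel r n"
    and "\<forall>x\<in>beta (Some r). x [^]\<^bsub>pi1_O\<^esub> nat \<lfloor>2 * n\<rfloor> \<in> heckoid_kernel r n"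
    and "n \<in> \<int> \<Longrightarrow> heckoid_kernel r n \<lhd> pi1_S"
proof -
  interpret O: group pi1_O by (rule group_pi1_O)
  let ?K = "heckoid_kernel r n"
  have "?K \<lhd> pi1_O \<and> alpha None \<subseteq> ?K \<and> (\<forall>x\<in>beta None. x [^]\<^bsub>pi1_O\<^esub> (2::nat) \<in> ?K) \<and>
    (\<forall>x\<in>beta (Some r). x [^]\<^bsub>pi1_O\<^esub> nat \<lfloor>2 * n\<rfloor> \<in> ?K) \<and> (n \<in> \<int> \<longrightarrow> ?K \<lhd> pi1_S)"
  proof (cases "n \<in> \<int>")
    case True
    define m where "m = nat \<lfloor>n\<rfloor>"
    let ?X = "alpha None \<union> (\<lambda>x. x [^]\<^bsub>pi1_S\<^esub> m) ` alpha (Some r)"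
    have K: "?K = normal_closure pi1_S ?X" using True by (simp add: heckoid_kernel_def m_def)
    have X: "?X \<subseteq> carrier pi1_S"
      using alpha_subset_pi1_S monoid.nat_pow_closed[OF group.is_monoid[OF group_pi1_S]] by blast
    have "y \<otimes>\<^bsub>pi1_O\<^esub> x \<otimes>\<^bsub>pi1_O\<^esub> inv\<^bsub>pi1_O\<^esub> y \<in> ?X" if y: "y \<in> carrier pi1_O" and x: "x \<in> ?X" for y x
      using x
    proof
      assume "x \<in> alpha None" then show ?thesis using alpha_conjugate[OF y] by blast
    next
      assume "x \<in> (\<lambda>x. x [^]\<^bsub>pi1_S\<^esub> m) ` alpha (Some r)"
      then obtain z where z: "z \<in> alpha (Some r)" "x = z [^]\<^bsub>pi1_S\<^esub> m" by blast
      have zS: "z \<in> carrier pi1_S" using z(1) alpha_subset_pi1_S by blast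
      have h: "(\<lambda>x. y \<otimes>\<^bsub>pi1_O\<^esub> x \<otimes>\<^bsub>pi1_O\<^esub> inv\<^bsub>pi1_O\<^esub> y) \<in> hom pi1_S pi1_S"
        using conjugation_hom[OF pi1_S_normal y] unfolding pi1_S_restrict[symmetric] .
      have "y \<otimes>\<^bsub>pi1_O\<^esub> x \<otimes>\<^bsub>pi1_O\<^esub> inv\<^bsub>pi1_O\<^esub> y = (y \<otimes>\<^bsub>pi1_O\<^esub> z \<otimes>\<^bsub>pi1_O\<^esub> inv\<^bsub>pi1_O\<^esub> y) [^]\<^bsub>pi1_S\<^esub> m"
        unfolding z(2) by (rule hom_nat_pow[OF h zS group_pi1_S group_pi1_S])
      then show ?thesis using alpha_conjugate[OF y z(1)] by blast
    qed
    then have N: "?K \<lhd> pi1_O"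
      using normal_closure_in_normal_subgroup[OF pi1_S_normal X] unfolding K pi1_S_restrict[symmetric] by blast
    have XK: "?X \<subseteq> ?K" unfolding K by (rule normal_closure_superset)
    obtain i where i: "n = of_int i" using True by (auto elim: Ints_cases)
    have "\<lfloor>2 * n\<rfloor> = 2 * i" unfolding i by (metis floor_of_int of_int_mult of_int_numeral)
    then have nm: "nat \<lfloor>2 * n\<rfloor> = 2 * m" using n(1) unfolding m_def i by (simp add: nat_mult_distrib)
    have "x [^]\<^bsub>pi1_O\<^esub> nat \<lfloor>2 * n\<rfloor> \<in> ?K" if x: "x \<in> beta (Some r)" for x
    proof -
      have xc: "x \<in> carrier pi1_O" using x beta_subset_pi1_O by blast
      have "x [^]\<^bsub>pi1_O\<^esub> nat \<lfloor>2 * n\<rfloor> = (x [^]\<^bsub>pi1_O\<^esub> (2::nat)) [^]\<^bsub>pi1_S\<^esub> m"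
        unfolding nm pow_pi1_S by (rule O.nat_pow_pow[OF xc, symmetric])
      then show ?thesis using beta_square_alpha[OF x] XK by auto
    qed
    moreover have "?K \<lhd> pi1_S" unfolding K by (rule normal_closure_normal[OF group_pi1_S X])
    ultimately show ?thesis using N XK beta_square_alpha by blast
  next
    case False
    let ?X = "(\<lambda>x. x [^]\<^bsub>pi1_O\<^esub> (2::nat)) ` beta None \<union> (\<lambda>x. x [^]\<^bsub>pi1_O\<^esub> nat \<lfloor>2 * n\<rfloor>) ` beta (Some r)"
    have K: "?K = normal_closure pi1_O ?X" using False by (simp add: heckoid_kernel_def)
    have X: "?X \<subseteq> carrier pi1_O" using beta_subset_pi1_O O.nat_pow_closed by blast
    have N: "?K \<lhd> pi1_O" unfolding K by (rule normal_closure_normal[OF group_pi1_O X])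
    have XK: "?X \<subseteq> ?K" unfolding K by (rule normal_closure_superset)
    have "alpha None \<subseteq> ?K"
    proof
      fix y assume "y \<in> alpha None"
      then have "y \<in> line_elements base_point int_lattice (2 * \<i>)" unfolding alpha_eq alpha_elements_def by simp
      then obtain x where x: "x \<in> line_elements base_point half_lattice \<i>" "y = x \<otimes>\<^bsub>pi1_O\<^esub> x"
        using alpha_infinity_square unfolding pi1_O_at_base by blast
      have xb: "x \<in> beta None" using x(1) unfolding beta_eq beta_elements_def by simp
      then have "x \<in> carrier pi1_O" using beta_subset_pi1_O by blast
      then have "y = x [^]\<^bsub>pi1_O\<^esub> (2::nat)" unfolding x(2) by (rule square_pi1_O[symmetric])
      then show "y \<in> ?K" using xb XK by blast
    qed
    then show ?thesis using N XK False by blast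
  qed
  then show "?K \<lhd> pi1_O" "alpha None \<subseteq> ?K" "\<forall>x\<in>beta None. x [^]\<^bsub>pi1_O\<^esub> (2::nat) \<in> ?K"
    "\<forall>x\<in>beta (Some r). x [^]\<^bsub>pi1_O\<^esub> nat \<lfloor>2 * n\<rfloor> \<in> ?K" "n \<in> \<int> \<Longrightarrow> ?K \<lhd> pi1_S"
    by blast+
qed

section \<open>Pair classes under homomorphisms\<close>

lemma pair_class_carrier:
  assumes "group G" "x \<in> carrier G" "y \<in> carrier G" "(a, b) \<in> pair_class G x y"
  shows "a \<in> carrier G \<and> b \<in> carrier G"
proof -
  interpret group G by (rule assms)
  show ?thesis using assms(4) by induction (use assms(2,3) in auto)
qed

lemma pair_class_image:
  assumes G: "group G" and H: "group H" and f: "f \<in> hom G H" "f ` carrier G = carrier H"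
    and xy: "x \<in> carrier G" "y \<in> carrier G"
  shows "map_prod f f ` pair_class G x y = pair_class H (f x) (f y)"
proof
  interpret group_hom G H f using G H f by (simp add: group_hom_def group_hom_axioms_def)
  have "a \<in> carrier G \<and> b \<in> carrier G \<and> (f a, f b) \<in> pair_class H (f x) (f y)" if "(a, b) \<in> pair_class G x y" for a b
    using that
  proof induction
    case base then show ?case using xy by (auto intro: pair_class.base)
  next
    case (swap a b) then show ?case by (auto intro: pair_class.swap)
  next
    case (inv1 a b) then show ?case by (auto intro: pair_class.inv1)
  next
    case (conj a b g) then show ?case using pair_class.conj[of "f a" "f b" H "f x" "f y" "f g"] by auto
  qed
  then show "map_prod f f ` pair_class G x y \<subseteq> pair_class H (f x) (f y)" by auto
  have "\<exists>a' b'. (a', b') \<in> pair_class G x y \<and> a = f a' \<and> b = f b'" if "(a, b) \<in> pair_class H (f x) (f y)" for a b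
    using that
  proof induction
    case base then show ?case by (blast intro: pair_class.base)
  next
    case (swap a b) then show ?case by (blast intro: pair_class.swap)
  next
    case (inv1 a b)
    then obtain a' b' where *: "(a', b') \<in> pair_class G x y" "a = f a'" "b = f b'" by blast
    have "a' \<in> carrier G" using pair_class_carrier[OF G xy *(1)] by simp
    then show ?case using pair_class.inv1[OF *(1)] * by (intro exI[of _ "inv\<^bsub>G\<^esub> a'"] exI[of _ b']) simp
  next
    case (conj a b g)
    then obtain a' b' where *: "(a', b') \<in> pair_class G x y" "a = f a'" "b = f b'" by blast
    obtain g' where g: "g' \<in> carrier G" "g = f g'" using conj f(2) by blast
    have "a' \<in> carrier G" "b' \<in> carrier G" using pair_class_carrier[OF G xy *(1)] by simp_all
    then show ?case using pair_class.conj[OF *(1) g(1)] * g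
      by (intro exI[of _ "g' \<otimes>\<^bsub>G\<^esub> a' \<otimes>\<^bsub>G\<^esub> inv\<^bsub>G\<^esub> g'"] exI[of _ "g' \<otimes>\<^bsub>G\<^esub> b' \<otimes>\<^bsub>G\<^esub> inv\<^bsub>G\<^esub> g'"]) simp
  qed
  then show "pair_class H (f x) (f y) \<subseteq> map_prod f f ` pair_class G x y" by force
qed

lemma pair_class_mono:
  assumes "(x', y') \<in> pair_class G x y" shows "pair_class G x' y' \<subseteq> pair_class G x y"
proof -
  have "(a, b) \<in> pair_class G x y" if "(a, b) \<in> pair_class G x' y'" for a b
    using that by induction (use assms in \<open>auto intro: pair_class.intros\<close>)
  then show ?thesis by auto
qed

lemma pair_class_inverse_right:
  fixes G (structure)
  assumes "group G" "x \<in> carrier G" "y \<in> carrier G"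
  shows "pair_class G x (inv\<^bsub>G\<^esub> y) = pair_class G x y"
proof -
  interpret group G by (rule assms)
  have *: "(x, inv y) \<in> pair_class G x y" for y by (intro pair_class.swap[OF pair_class.inv1[OF pair_class.swap[OF pair_class.base]]])
  show ?thesis using pair_class_mono[OF *[of y]] pair_class_mono[OF *[of "inv y"]] assms(3) by auto
qed

section \<open>Epimorphisms induced on the quotients\<close>

lemma mult_pi1_S: "x \<otimes>\<^bsub>pi1_S\<^esub> y = x \<otimes>\<^bsub>pi1_O\<^esub> y"
  by (simp add: pi1_S_eq)

lemma pi1_S_subgroup: "subgroup (carrier pi1_S) pi1_O"
  using normal_imp_subgroup[OF pi1_S_normal] .

lemma heckoid_group_eq:
  "heckoid_group r n = (pi1_O Mod heckoid_kernel r n)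
    \<lparr>carrier := (\<lambda>x. heckoid_kernel r n #>\<^bsub>pi1_O\<^esub> x) ` carrier pi1_S\<rparr>"
  by (auto simp: heckoid_group_def FactGroup_def RCOSETS_def r_coset_def set_mult_def mult_pi1_S fun_eq_iff)

text \<open>The natural maps between quotients of \<open>\<pi>\<^sub>1(S)\<close> and \<open>\<pi>\<^sub>1(O)\<close> are written as
  \<open>C \<mapsto> K \<cdot> f(C)\<close> on cosets \<open>C\<close>.\<close>

lemma set_mult_image_coset:
  assumes G: "group G" and H: "group H" and K: "subgroup K H" and L: "subgroup L G"
    and f: "f \<in> hom G H" "f ` L \<subseteq> K" and x: "x \<in> carrier G"
  shows "K <#>\<^bsub>H\<^esub> f ` (L #>\<^bsub>G\<^esub> x) = K #>\<^bsub>H\<^esub> f x"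
proof
  interpret G: group G by (rule G)
  interpret H: group H by (rule H)
  have fx: "f x \<in> carrier H" using hom_in_carrier[OF f(1) x] .
  show "K <#>\<^bsub>H\<^esub> f ` (L #>\<^bsub>G\<^esub> x) \<subseteq> K #>\<^bsub>H\<^esub> f x"
  proof
    fix y assume "y \<in> K <#>\<^bsub>H\<^esub> f ` (L #>\<^bsub>G\<^esub> x)"
    then obtain k l where kl: "k \<in> K" "l \<in> L" "y = k \<otimes>\<^bsub>H\<^esub> f (l \<otimes>\<^bsub>G\<^esub> x)"
      unfolding set_mult_def r_coset_def by blast
    have lG: "l \<in> carrier G" using kl(2) subgroup.subset[OF L] by blast
    have c: "k \<in> carrier H" "f l \<in> carrier H" "f l \<in> K" using kl(1,2) subgroup.subset[OF K] f by blast+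
    have "y = (k \<otimes>\<^bsub>H\<^esub> f l) \<otimes>\<^bsub>H\<^esub> f x"
      unfolding kl(3) hom_mult[OF f(1) lG x] by (rule H.m_assoc[OF c(1,2) fx, symmetric])
    moreover have "k \<otimes>\<^bsub>H\<^esub> f l \<in> K" using K kl(1) c(3) by (rule subgroup.m_closed)
    ultimately show "y \<in> K #>\<^bsub>H\<^esub> f x" unfolding r_coset_def by blast
  qed
  show "K #>\<^bsub>H\<^esub> f x \<subseteq> K <#>\<^bsub>H\<^esub> f ` (L #>\<^bsub>G\<^esub> x)"
    using G.rcos_self[OF x L] unfolding set_mult_def r_coset_def[of H] by blast
qed

lemma map_prod_image_comp:
  assumes "\<And>a b. (a, b) \<in> P \<Longrightarrow> f (g a) = h a \<and> f (g b) = h b"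
  shows "map_prod f f ` map_prod g g ` P = map_prod h h ` P"
  unfolding image_image using assms by (intro image_cong) auto

lemma meridian_pi1_S:
  assumes "meridian c \<in> carrier pi1_O" "c \<in> int_lattice" shows "meridian c \<in> carrier pi1_S"
proof -
  have "2 * c \<in> even_lattice" using assms(2) by blast
  then have "pi_rotation c \<in> H_group" unfolding H_group_eq by (rule motionsI(2))
  then show ?thesis using assms(1) unfolding carrier_pi1_S pi1_O_at_base meridian_def pi1_S_at_def carrier_pi1_O_at by simp
qed

text \<open>An endomorphism of \<open>\<pi>\<^sub>1(S)\<close> that takes the relators of \<open>G(K(s))\<close> into the kernel of the Heckoid
  group induces the required epimorphism if it respects the meridian pair modulo that kernel.\<close>

lemma induced_epimorphism:
  assumes n: "n > 1" "2 * n \<in> \<int>"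
    and f: "f \<in> hom pi1_S pi1_S" "f ` carrier pi1_S = carrier pi1_S"
    and rel: "f ` (alpha None \<union> alpha s) \<subseteq> heckoid_kernel r n"
    and mer: "meridian 0 \<in> carrier pi1_S" "meridian 1 \<in> carrier pi1_S"
    and m0: "heckoid_kernel r n #>\<^bsub>pi1_O\<^esub> f (meridian 0) = heckoid_kernel r n #>\<^bsub>pi1_O\<^esub> meridian 0"
    and m1: "heckoid_kernel r n #>\<^bsub>pi1_O\<^esub> f (meridian 1) = heckoid_kernel r n #>\<^bsub>pi1_O\<^esub> meridian 1 \<or>
      heckoid_kernel r n #>\<^bsub>pi1_O\<^esub> f (meridian 1) = heckoid_kernel r n #>\<^bsub>pi1_O\<^esub> inv\<^bsub>pi1_S\<^esub> meridian 1"
  shows "\<exists>F. F \<in> epi (link_group s) (heckoid_group r n) \<and> upper_meridian_pair_preserving s r n F"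
proof -
  define K where "K = heckoid_kernel r n"
  define L where "L = link_kernel s"
  define T where "T = tangle_kernel"
  define Hk where "Hk = heckoid_group r n"
  note kp = heckoid_kernel_properties[OF n, of r, folded K_def]
  interpret K: normal K pi1_O by (rule kp(1))
  interpret S: group pi1_S by (rule group_pi1_S)
  let ?S = "carrier pi1_S"
  let ?q = "\<lambda>x. K #>\<^bsub>pi1_O\<^esub> x"
  have Ks: "subgroup K pi1_O" by (rule K.is_subgroup)
  have L: "L \<lhd> pi1_S" and T: "T \<lhd> pi1_S"
    unfolding L_def link_kernel_def T_def tangle_kernel_def
    using normal_closure_normal[OF group_pi1_S] alpha_subset_pi1_S by simp_all
  have Ls: "subgroup L pi1_S" and Ts: "subgroup T pi1_S" using normal_imp_subgroup L T by auto
  have TL: "T \<subseteq> L" unfolding T_def tangle_kernel_def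
    by (rule normal_closure_minimal[OF L])
      (use normal_closure_superset[of "alpha None \<union> alpha s" pi1_S] in \<open>unfold L_def link_kernel_def, blast\<close>)
  have incl: "g \<in> hom pi1_S pi1_O" if "g \<in> hom pi1_S pi1_S" for g
    using that carrier_pi1_S_subset by (auto simp: hom_def mult_pi1_S)
  have clos: "g ` normal_closure pi1_S X \<subseteq> K" if g: "g \<in> hom pi1_S pi1_S" "g ` X \<subseteq> K" "X \<subseteq> ?S" for g X
  proof -
    have "{x \<in> ?S. g x \<in> K} \<lhd> pi1_S" by (rule normal_preimage[OF group_pi1_S kp(1) incl[OF g(1)]])
    then have "normal_closure pi1_S X \<subseteq> {x \<in> ?S. g x \<in> K}"
      by (rule normal_closure_minimal) (use g(2,3) in blast)
    then show ?thesis by blast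
  qed
  have idS: "(\<lambda>x. x) \<in> hom pi1_S pi1_S" by (auto simp: hom_def)
  have fL: "f ` L \<subseteq> K" unfolding L_def link_kernel_def
    by (rule clos[OF f(1) rel[folded K_def]]) (use alpha_subset_pi1_S in blast)
  have TK: "(\<lambda>x. x) ` T \<subseteq> K" unfolding T_def tangle_kernel_def
    by (rule clos[OF idS]) (use kp(2) alpha_subset_pi1_S in simp_all)
  \<comment> \<open>the Heckoid group as the image of \<open>\<pi>\<^sub>1(S)\<close>\<close>
  have qO: "?q \<in> hom pi1_O (pi1_O Mod K)" by (rule K.r_coset_hom_Mod)
  interpret qh: group_hom pi1_O "pi1_O Mod K" ?q
    using qO group_pi1_O K.factorgroup_is_group by (simp add: group_hom_def group_hom_axioms_def)
  have HkE: "Hk = (pi1_O Mod K)\<lparr>carrier := ?q ` ?S\<rparr>" unfolding Hk_def K_def by (rule heckoid_group_eq)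
  have gHk: "group Hk" unfolding HkE
    by (rule group.subgroup_imp_group[OF K.factorgroup_is_group qh.subgroup_img_is_subgroup[OF pi1_S_subgroup]])
  have q: "?q \<in> hom pi1_S Hk"
    using hom_mult[OF qO] carrier_pi1_S_subset by (auto simp: HkE hom_def mult_pi1_S subset_iff)
  have qS: "?q ` ?S = carrier Hk" by (simp add: HkE)
  have qf: "(\<lambda>x. ?q (f x)) \<in> hom pi1_S Hk" using hom_compose[OF f(1) q] by (simp add: comp_def)
  have qfS: "(\<lambda>x. ?q (f x)) ` ?S = carrier Hk" using f(2) qS by (metis image_image)
  define F where "F C = K <#>\<^bsub>pi1_O\<^esub> f ` C" for C
  have Fq: "F (L #>\<^bsub>pi1_S\<^esub> x) = ?q (f x)" if "x \<in> ?S" for x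
    unfolding F_def by (rule set_mult_image_coset[OF group_pi1_S group_pi1_O Ks Ls incl[OF f(1)] fL that])
  have lg: "link_group s = pi1_S Mod L" by (simp add: link_group_def L_def)
  have cL: "carrier (pi1_S Mod L) = (\<lambda>x. L #>\<^bsub>pi1_S\<^esub> x) ` ?S"
    by (auto simp: FactGroup_def RCOSETS_def)
  have "F \<in> epi (link_group s) Hk"
  proof -
    have "F ` carrier (pi1_S Mod L) = carrier Hk"
      unfolding cL image_image qfS[symmetric] by (rule image_cong) (simp_all add: Fq)
    moreover have "F (C \<otimes>\<^bsub>pi1_S Mod L\<^esub> D) = F C \<otimes>\<^bsub>Hk\<^esub> F D"
      if CD: "C \<in> carrier (pi1_S Mod L)" "D \<in> carrier (pi1_S Mod L)" for C D
    proof -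
      obtain x where x: "x \<in> ?S" "C = L #>\<^bsub>pi1_S\<^esub> x" using CD(1)[unfolded cL] by (rule imageE)
      obtain y where y: "y \<in> ?S" "D = L #>\<^bsub>pi1_S\<^esub> y" using CD(2)[unfolded cL] by (rule imageE)
      note xy = x(1) y(1) x(2) y(2)
      have "C \<otimes>\<^bsub>pi1_S Mod L\<^esub> D = L #>\<^bsub>pi1_S\<^esub> (x \<otimes>\<^bsub>pi1_S\<^esub> y)"
        unfolding xy(3,4) using hom_mult[OF normal.r_coset_hom_Mod[OF L] xy(1,2)] by simp
      then have "F (C \<otimes>\<^bsub>pi1_S Mod L\<^esub> D) = ?q (f (x \<otimes>\<^bsub>pi1_S\<^esub> y))" using Fq[OF S.m_closed[OF xy(1,2)]] by simp
      then show ?thesis unfolding xy(3,4) Fq[OF xy(1)] Fq[OF xy(2)] using hom_mult[OF qf xy(1,2)] by simp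
    qed
    ultimately show ?thesis unfolding lg epi_def by (auto intro!: homI)
  qed
  moreover have "upper_meridian_pair_preserving s r n F"
  proof -
    let ?P = "pair_class pi1_S (meridian 0) (meridian 1)"
    have Pc: "a \<in> ?S \<and> b \<in> ?S" if "(a, b) \<in> ?P" for a b using pair_class_carrier[OF group_pi1_S mer that] .
    have cT: "(\<lambda>x. T #>\<^bsub>pi1_S\<^esub> x) ` ?S = carrier (pi1_S Mod T)" by (auto simp: FactGroup_def RCOSETS_def)
    let ?qT = "\<lambda>x. T #>\<^bsub>pi1_S\<^esub> x" and ?qL = "\<lambda>x. L #>\<^bsub>pi1_S\<^esub> x"
    have tp: "tangle_meridian_pair = map_prod ?qT ?qT ` ?P"
      unfolding tangle_meridian_pair_def tangle_group_def T_def[symmetric]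
      by (rule pair_class_image[OF group_pi1_S normal.factorgroup_is_group[OF T] normal.r_coset_hom_Mod[OF T] cT mer, symmetric])
    have absL: "L <#>\<^bsub>pi1_S\<^esub> (T #>\<^bsub>pi1_S\<^esub> x) = L #>\<^bsub>pi1_S\<^esub> x" if "x \<in> ?S" for x
      using set_mult_image_coset[OF group_pi1_S group_pi1_S Ls Ts idS _ that] TL by simp
    have absK: "K <#>\<^bsub>pi1_O\<^esub> (T #>\<^bsub>pi1_S\<^esub> x) = K #>\<^bsub>pi1_O\<^esub> x" if "x \<in> ?S" for x
      using set_mult_image_coset[OF group_pi1_S group_pi1_O Ks Ts incl[OF idS] TK that] by simp
    have lp: "link_upper_pair s = map_prod ?qL ?qL ` ?P"
      unfolding link_upper_pair_def Let_def L_def[symmetric] tp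
      by (rule map_prod_image_comp) (use Pc absL in blast)
    have "map_prod F F ` link_upper_pair s = map_prod (\<lambda>x. ?q (f x)) (\<lambda>x. ?q (f x)) ` ?P"
      unfolding lp by (rule map_prod_image_comp) (use Pc Fq in blast)
    also have "\<dots> = pair_class Hk (?q (f (meridian 0))) (?q (f (meridian 1)))"
      by (rule pair_class_image[OF group_pi1_S gHk qf qfS mer])
    also have "\<dots> = pair_class Hk (?q (meridian 0)) (?q (meridian 1))"
    proof -
      interpret qs: group_hom pi1_S Hk ?q
        using q gHk group_pi1_S by (simp add: group_hom_def group_hom_axioms_def)
      have "?q (inv\<^bsub>pi1_S\<^esub> meridian 1) = inv\<^bsub>Hk\<^esub> ?q (meridian 1)" using mer(2) by (rule qs.hom_inv)
      then show ?thesis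
        using m0 m1 pair_class_inverse_right[OF gHk qs.hom_closed[OF mer(1)] qs.hom_closed[OF mer(2)]]
        unfolding K_def[symmetric] by auto
    qed
    also have "\<dots> = map_prod ?q ?q ` ?P" by (rule pair_class_image[OF group_pi1_S gHk q qS mer, symmetric])
    also have "\<dots> = heckoid_upper_pair r n"
      unfolding heckoid_upper_pair_def Let_def K_def[symmetric] tp
      by (rule map_prod_image_comp[symmetric]) (use Pc absK in blast)
    finally show ?thesis unfolding upper_meridian_pair_preserving_def .
  qed
  ultimately show ?thesis unfolding Hk_def by blast
qed

section \<open>The meridian pair\<close>

text \<open>The open strip \<open>0 < \<plusminus> y < 1\<close> together with the two end points on the real axis is
  starlike about \<open>m\<close>.\<close>

lemma half_plane_arc:
  assumes e: "e = 1 \<or> e = -1" and ab: "Im a = 0" "Im b = 0" "a \<in> punctured_plane" "b \<in> punctured_plane"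
    and m: "0 < e * Im m" "e * Im m < 1"
    and p: "path p" "pathstart p = a" "pathfinish p = b"
    and im: "\<And>t. 0 < t \<Longrightarrow> t < 1 \<Longrightarrow> 0 < e * Im (p t) \<and> e * Im (p t) < 1"
  shows "path_class punctured_plane p = seg a m \<odot> seg m b"
proof -
  let ?S = "{z. 0 < e * Im z \<and> e * Im z < 1} \<union> {a, b}"
  have sub: "?S \<subseteq> punctured_plane"
  proof -
    have "z \<notin> int_lattice" if "0 < e * Im z" "e * Im z < 1" for z
    proof
      assume "z \<in> int_lattice"
      then obtain k :: int where "Im z = of_int k" by (auto simp: int_lattice_def elim: Ints_cases)
      then have "(of_int 0 :: real) < of_int k \<and> of_int k < (of_int 1 :: real) \<or> (of_int (-1) :: real) < of_int k \<and> of_int k < (of_int 0 :: real)"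
        using that e by auto
      then show False unfolding of_int_less_iff by presburger
    qed
    then show ?thesis using ab by blast
  qed
  have mS: "m \<in> ?S" using m by simp
  have segS: "closed_segment m z \<subseteq> ?S" if z: "z \<in> ?S" for z
  proof
    fix x assume "x \<in> closed_segment m z"
    then obtain u where u: "0 \<le> u" "u \<le> 1" "x = (1 - u) *\<^sub>R m + u *\<^sub>R z" by (auto simp: in_segment)
    show "x \<in> ?S"
    proof (cases "u = 1")
      case True then show ?thesis using u z by simp
    next
      case False
      then have u1: "u < 1" using u by simp
      have z01: "0 \<le> e * Im z" "e * Im z < 1" using z ab by auto
      have x: "e * Im x = (1 - u) * (e * Im m) + u * (e * Im z)" unfolding u(3) by (simp add: algebra_simps)
      have "0 < (1 - u) * (e * Im m)" using u1 m by simp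
      moreover have "0 \<le> u * (e * Im z)" using u z01 by simp
      moreover have "(1 - u) * (e * Im m) < (1 - u) * 1" using u1 m by (intro mult_strict_left_mono) auto
      moreover have "u * (e * Im z) \<le> u * 1" using u z01 by (intro mult_left_mono) auto
      ultimately show ?thesis using x by simp
    qed
  qed
  have sc: "simply_connected ?S"
    by (rule starlike_imp_simply_connected) (unfold starlike_def, use mS segS in blast)
  have sg: "closed_segment a m \<subseteq> ?S" "closed_segment m b \<subseteq> ?S"
    using segS[of a] segS[of b] by (simp_all add: closed_segment_commute)
  have pim: "path_image p \<subseteq> ?S"
  proof
    fix z assume "z \<in> path_image p"
    then obtain t where t: "0 \<le> t" "t \<le> 1" "z = p t" by (auto simp: path_image_def)
    then consider "t = 0" | "t = 1" | "0 < t" "t < 1" by linarith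
    then show "z \<in> ?S"
    proof cases
      case 1 then show ?thesis using t p(2) by (simp add: pathstart_def)
    next
      case 2 then show ?thesis using t p(3) by (simp add: pathfinish_def)
    next
      case 3 then show ?thesis using t im by simp
    qed
  qed
  have "path_class punctured_plane p = path_class punctured_plane (linepath a m +++ linepath m b)"
    by (rule path_class_eq_simply_connected[OF sc sub p(1) pim]) (use p sg in \<open>auto simp: path_image_join\<close>)
  also have "\<dots> = seg a m \<odot> seg m b"
    unfolding seg_def using sg sub by (intro cjoin_path_class[symmetric]) auto
  finally show ?thesis .
qed

abbreviation base_change :: "pi1_element \<Rightarrow> pi1_element" where
  "base_change \<equiv> transport (\<lambda>z. z) (\<lambda>z. z) (seg base_point axis_point)"

lemma base_point_Complex: "base_point = Complex (1 / 4) 0"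
  by (simp add: base_point_def complex_eq_iff)

lemma base_axis_segment: "closed_segment base_point axis_point \<subseteq> punctured_plane"
  by (rule strip_segment[OF not_Ints(1,1), where m = 0]) (simp_all add: strip_def base_point_Complex)

lemma base_axis_arrow: "seg base_point axis_point \<in> arrows base_point axis_point"
  by (rule seg_arrows[OF base_axis_segment])

lemma base_change_apply:
  assumes g: "g \<in> H_hat_group" and D: "D \<in> arrows axis_point (g axis_point)"
  shows "base_change (g, D) = (g, seg base_point axis_point \<odot> D \<odot> seg (g axis_point) (g base_point))"
proof -
  obtain g' where s: "lattice_symmetry g g'" using motion_symmetry[OF g] by metis
  have "closed_segment axis_point base_point \<subseteq> punctured_plane"
    using base_axis_segment by (simp add: closed_segment_commute)
  then have "crev (cimg g (seg base_point axis_point)) = seg (g axis_point) (g base_point)"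
    unfolding cimg_crev[OF s base_axis_arrow, symmetric] crev_seg[OF base_axis_segment] by (rule cimg_seg[OF s])
  moreover have "(\<lambda>z. z) \<circ> g \<circ> (\<lambda>z. z) = g" by auto
  ultimately show ?thesis unfolding transport_def prod.case cimg_id[OF D] by simp
qed

text \<open>Both sides pass from \<open>1/4\<close> above \<open>0\<close> to \<open>-1/4\<close>.\<close>

lemma meridian_0: "meridian 0 = base_change (rot_R \<otimes>\<^bsub>pi1_A\<^esub> (rot_E 1 \<otimes>\<^bsub>pi1_A\<^esub> rot_E 0))"
proof -
  \<comment> \<open>\<open>z\<close> is chosen such that the rotation about \<open>i/2\<close> takes it to the end point \<open>-1/4\<close> of the half circle\<close>
  let ?z = "Complex (1 / 4) 1" and ?y = "Complex (- 1 / 4) 0"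
  have E: "rot_E 1 \<otimes>\<^bsub>pi1_A\<^esub> rot_E 0 = (\<lambda>z. z + \<i>, seg axis_point ?z \<odot> seg ?z (axis_point + \<i>))"
    by (rule rot_E_mult_pred_at) simp_all
  have sz: "closed_segment axis_point ?z \<subseteq> punctured_plane"
    by (rule strip_segment[OF not_Ints(1,1), where m = 0]) (simp_all add: strip_def)
  have sz': "closed_segment ?z (axis_point + \<i>) \<subseteq> punctured_plane"
    by (rule strip_segment[OF not_Ints(4) not_Ints(1), where m = 0]) (simp_all add: strip_def)
  note az = seg_arrows[OF sz] seg_arrows[OF sz']
  have e: "\<i> - ?z = ?y" "\<i> - (axis_point + \<i>) = - axis_point" by (simp_all add: complex_eq_iff)
  have R: "rot_R \<otimes>\<^bsub>pi1_A\<^esub> (rot_E 1 \<otimes>\<^bsub>pi1_A\<^esub> rot_E 0) = (\<lambda>z. \<i> - (z + \<i>), seg axis_point ?y \<odot> seg ?y (- axis_point))"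
    unfolding E rot_R_mult[OF cjoin_arrows[OF az]] cimg_cjoin[OF motion_symmetries(1) az]
      cimg_seg[OF motion_symmetries(1) sz] cimg_seg[OF motion_symmetries(1) sz'] e ii_minus_axis_point ..
  have g: "(\<lambda>z. \<i> - (z + \<i>)) = (\<lambda>z. 0 - z)" by (simp add: fun_eq_iff)
  have gH: "(\<lambda>z. 0 - z) \<in> H_hat_group" unfolding H_hat_group_eq by (rule motionsI) simp
  have str: "axis_point \<in> strip (- 1) (1/2) (1/2)" "?y \<in> strip (- 1) (1/2) (1/2)"
     "?y \<in> strip (- 1) (1/2) (- 1/2)" "- axis_point \<in> strip (- 1) (1/2) (- 1/2)"
    by (simp_all add: strip_def)
  have ay: "seg axis_point ?y \<in> arrows axis_point ?y"
    by (rule seg_arrows[OF strip_segment[OF not_Ints(1,1) str(1,2)]])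
  have ay': "seg ?y (- axis_point) \<in> arrows ?y (- axis_point)" "seg (- axis_point) ?y \<in> arrows (- axis_point) ?y"
    by (rule seg_arrows[OF strip_segment[OF not_Ints(1,2) str(3,4)]], rule seg_arrows[OF strip_segment[OF not_Ints(1,2) str(4,3)]])
  have D: "seg axis_point ?y \<odot> seg ?y (- axis_point) \<in> arrows axis_point (0 - axis_point)"
    using cjoin_arrows[OF ay ay'(1)] by simp
  have nb: "0 - base_point = ?y" "0 - axis_point = - axis_point" by (simp_all add: base_point_Complex complex_eq_iff)
  have "base_change (rot_R \<otimes>\<^bsub>pi1_A\<^esub> (rot_E 1 \<otimes>\<^bsub>pi1_A\<^esub> rot_E 0)) =
    (\<lambda>z. 0 - z, seg base_point axis_point \<odot> (seg axis_point ?y \<odot> seg ?y (- axis_point)) \<odot> seg (- axis_point) ?y)"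
    unfolding R g base_change_apply[OF gH D] nb ..
  also have "(seg axis_point ?y \<odot> seg ?y (- axis_point)) \<odot> seg (- axis_point) ?y = seg axis_point ?y"
  proof -
    have "seg ?y (- axis_point) \<odot> seg (- axis_point) ?y = seg ?y ?y"
      by (rule strip_join[OF not_Ints(1,2) str(3,4,3)])
    then show ?thesis using cjoin_assoc[OF ay ay'] cjoin_unit_right[OF ay] by simp
  qed
  also have "seg base_point axis_point \<odot> seg axis_point ?y =
      path_class punctured_plane (\<lambda>t. 0 + (base_point - 0) * cis (pi * t))"
  proof (rule half_plane_arc[of 1, symmetric])
    show "base_point \<in> punctured_plane" by (rule base_point_plane)
    show "?y \<in> punctured_plane" using arrows_in_plane(2)[OF ay] .
    show "path (\<lambda>t. 0 + (base_point - 0) * cis (pi * t))" unfolding path_def by (intro continuous_intros)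
    fix t :: real assume t: "0 < t" "t < 1"
    then have "0 < sin (pi * t)" by (intro sin_gt_zero) auto
    moreover have "sin (pi * t) \<le> 1" by simp
    moreover have "Im (0 + (base_point - 0) * cis (pi * t)) = 1 / 4 * sin (pi * t)"
      by (simp add: base_point_Complex)
    ultimately show "0 < 1 * Im (0 + (base_point - 0) * cis (pi * t)) \<and> 1 * Im (0 + (base_point - 0) * cis (pi * t)) < 1"
      by linarith
  qed (simp_all add: base_point_Complex pathstart_def pathfinish_def complex_eq_iff)
  finally show ?thesis by (simp add: meridian_def)
qed

text \<open>Both sides pass from \<open>1/4\<close> below \<open>1\<close> to \<open>7/4\<close>.\<close>

lemma meridian_1: "meridian 1 = base_change (rot_E 0 \<otimes>\<^bsub>pi1_A\<^esub> (rot_R \<otimes>\<^bsub>pi1_A\<^esub> rot_E 1))"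
proof -
  let ?e = "E_end 0" and ?f = "Complex 2 (- 1 / 2)" and ?h = "Complex (- 1) (1 / 2)"
  have e: "\<i> - E_end 1 = ?h" "Complex 1 (of_int 0) - axis_point = ?e" "Complex 1 (of_int 0) - ?h = ?f"
    by (simp_all add: E_end_def complex_eq_iff)
  have sh: "closed_segment axis_point ?h \<subseteq> punctured_plane"
    by (rule strip_segment[OF not_Ints(1,1), where m = "-1"]) (simp_all add: strip_def)
  have RE: "rot_R \<otimes>\<^bsub>pi1_A\<^esub> rot_E 1 = (\<lambda>z. \<i> - (Complex 1 (of_int 1) - z), seg axis_point ?h)"
    using rot_R_mult[OF seg_arrows[OF E_end_seg(1)], of "\<lambda>z. Complex 1 (of_int 1) - z" 1]
    unfolding rot_E_def cimg_seg[OF motion_symmetries(1) E_end_seg(1)] e ii_minus_axis_point .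
  have "rot_E 0 \<otimes>\<^bsub>pi1_A\<^esub> (rot_R \<otimes>\<^bsub>pi1_A\<^esub> rot_E 1) =
      (\<lambda>z. Complex 1 (of_int 0) - (\<i> - (Complex 1 (of_int 1) - z)), seg axis_point ?e \<odot> seg ?e ?f)"
    unfolding RE rot_E_mult[OF seg_arrows[OF sh]] cimg_seg[OF motion_symmetries(2) sh] e ..
  also have "(\<lambda>z. Complex 1 (of_int 0) - (\<i> - (Complex 1 (of_int 1) - z))) = (\<lambda>z. 2 - z)"
    by (simp add: fun_eq_iff complex_eq_iff)
  finally have m: "rot_E 0 \<otimes>\<^bsub>pi1_A\<^esub> (rot_R \<otimes>\<^bsub>pi1_A\<^esub> rot_E 1) = (\<lambda>z. 2 - z, seg axis_point ?e \<odot> seg ?e ?f)" .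
  have gH: "(\<lambda>z. 2 - z) \<in> H_hat_group" unfolding H_hat_group_eq by (rule motionsI) (simp add: int_lattice_def)
  have n2: "2 - axis_point = ?f" "2 - base_point = Complex (7 / 4) 0" by (simp_all add: base_point_Complex complex_eq_iff)
  let ?b = "Complex (7 / 4) 0"
  have str: "?e \<in> strip 1 (- 1/2) (- 1/2)" "?f \<in> strip 1 (- 1/2) (- 1/2)" "?b \<in> strip 1 (- 1/2) (- 1/2)"
    by (simp_all add: strip_def E_end_def)
  have str0: "base_point \<in> strip 0 (1/2) (- 1/2)" "axis_point \<in> strip 0 (1/2) (- 1/2)" "?e \<in> strip 0 (1/2) (- 1/2)"
    by (simp_all add: strip_def E_end_def base_point_Complex)
  have a: "seg axis_point ?e \<in> arrows axis_point ?e" by (rule seg_arrows[OF E_end_seg(1)])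
  have b: "seg ?e ?f \<in> arrows ?e ?f" "seg ?f ?b \<in> arrows ?f ?b" "seg ?e ?b \<in> arrows ?e ?b"
    by (rule seg_arrows[OF strip_segment[OF not_Ints(2,2) str(1,2)]], rule seg_arrows[OF strip_segment[OF not_Ints(2,2) str(2,3)]],
        rule seg_arrows[OF strip_segment[OF not_Ints(2,2) str(1,3)]])
  have D: "seg axis_point ?e \<odot> seg ?e ?f \<in> arrows axis_point (2 - axis_point)"
    unfolding n2 by (rule cjoin_arrows[OF a b(1)])
  have "base_change (rot_E 0 \<otimes>\<^bsub>pi1_A\<^esub> (rot_R \<otimes>\<^bsub>pi1_A\<^esub> rot_E 1)) =
    (\<lambda>z. 2 - z, seg base_point axis_point \<odot> (seg axis_point ?e \<odot> seg ?e ?f) \<odot> seg ?f ?b)"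
    unfolding m base_change_apply[OF gH D] n2 ..
  also have "(seg axis_point ?e \<odot> seg ?e ?f) \<odot> seg ?f ?b = seg axis_point ?e \<odot> seg ?e ?b"
    using cjoin_assoc[OF a b(1,2)] strip_join[OF not_Ints(2,2) str] by simp
  also have "seg base_point axis_point \<odot> seg axis_point ?e \<odot> seg ?e ?b = seg base_point ?e \<odot> seg ?e ?b"
    using cjoin_assoc[OF base_axis_arrow a b(3)] strip_join[OF not_Ints(1,2) str0] by simp
  also have "\<dots> = path_class punctured_plane (\<lambda>t. 1 + (base_point - 1) * cis (pi * t))"
  proof (rule half_plane_arc[of "-1", symmetric])
    show "base_point \<in> punctured_plane" by (rule base_point_plane)
    show "?b \<in> punctured_plane" using arrows_in_plane(2)[OF b(2)] .
    show "path (\<lambda>t. 1 + (base_point - 1) * cis (pi * t))" unfolding path_def by (intro continuous_intros)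
    fix t :: real assume t: "0 < t" "t < 1"
    then have "0 < sin (pi * t)" by (intro sin_gt_zero) auto
    moreover have "sin (pi * t) \<le> 1" by simp
    moreover have "Im (1 + (base_point - 1) * cis (pi * t)) = - (3 / 4) * sin (pi * t)"
      by (simp add: base_point_Complex)
    ultimately show "0 < -1 * Im (1 + (base_point - 1) * cis (pi * t)) \<and> -1 * Im (1 + (base_point - 1) * cis (pi * t)) < 1"
      by linarith
  qed (simp_all add: base_point_Complex pathstart_def pathfinish_def complex_eq_iff E_end_def)
  finally show ?thesis by (simp add: meridian_def)
qed

section \<open>The half twist and the epimorphism\<close>

abbreviation base_change_back :: "pi1_element \<Rightarrow> pi1_element" where
  "base_change_back \<equiv> transport (\<lambda>z. z) (\<lambda>z. z) (crev (cimg (\<lambda>z. z) (seg base_point axis_point)))"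

text \<open>The action of the half twist \<open>(x, y) \<mapsto> (x, x + y)\<close>, transferred from the fixed point \<open>i/2\<close> to the
  given base point.\<close>

definition half_twist :: "pi1_element \<Rightarrow> pi1_element" where
  "half_twist x = base_change (shear_action 1
     (base_change_back x))"

lemmas base_change_hom =
  transport_hom[OF lattice_symmetry_id base_axis_arrow, folded pi1_O_at_base]

lemma base_change_inverse_arrow:
  "crev (cimg (\<lambda>z. z) (seg base_point axis_point)) \<in> arrows axis_point base_point"
  by (rule crev_arrows) (simp add: cimg_id[OF base_axis_arrow] base_axis_arrow)

lemma half_twist_hom: "half_twist \<in> hom pi1_O pi1_O"
proof -
  have "base_change \<circ> (shear_action 1 \<circ> base_change_back)
      \<in> hom pi1_O pi1_O"
    unfolding pi1_O_at_base
    by (rule hom_compose[OF hom_compose[OF transport_hom[OF lattice_symmetry_id base_change_inverse_arrow]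
        transport_hom[OF shear_symmetry shear_fixes_seg]] transport_hom[OF lattice_symmetry_id base_axis_arrow]])
  then show ?thesis by (simp add: half_twist_def[abs_def] comp_def)
qed

lemma half_twist_image_S: "half_twist ` carrier pi1_S = carrier pi1_S"
proof -
  have "half_twist ` carrier pi1_S = base_change ` shear_action 1 `
      base_change_back ` pi1_S_at base_point"
    by (simp only: half_twist_def[abs_def] image_image carrier_pi1_S)
  then show ?thesis
    unfolding carrier_pi1_S transport_surj(2)[OF lattice_symmetry_id base_change_inverse_arrow]
      transport_surj(2)[OF shear_symmetry shear_fixes_seg] transport_surj(2)[OF lattice_symmetry_id base_axis_arrow] .
qed

lemma half_twist_hom_S: "half_twist \<in> hom pi1_S pi1_S"
proof (rule homI)
  show "half_twist x \<in> carrier pi1_S" if "x \<in> carrier pi1_S" for x using half_twist_image_S that by blast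
  show "half_twist (x \<otimes>\<^bsub>pi1_S\<^esub> y) = half_twist x \<otimes>\<^bsub>pi1_S\<^esub> half_twist y"
    if "x \<in> carrier pi1_S" "y \<in> carrier pi1_S" for x y
    unfolding mult_pi1_S using hom_mult[OF half_twist_hom] carrier_pi1_S_subset that by blast
qed

lemma half_twist_base_change:
  "x \<in> carrier pi1_A \<Longrightarrow> half_twist (base_change x) = base_change (shear_action 1 x)"
  unfolding half_twist_def using transport_inverse(1)[OF lattice_symmetry_id base_axis_arrow] by simp

lemma half_twist_alpha: "half_twist ` alpha s = alpha_elements (shear 1 (slope_vector s))"
proof -
  let ?v = "slope_vector s"
  have v: "2 * ?v \<in> int_lattice" and w: "2 * shear 1 ?v \<in> int_lattice"
    by (rule double_lattice[OF slope_vector_lattice], rule double_lattice[OF shear_lattice[OF slope_vector_lattice]])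
  have s: "shear 1 (2 * ?v) - shear 1 0 = 2 * shear 1 ?v" by (simp add: shear_def complex_eq_iff)
  have "half_twist ` alpha s = base_change ` shear_action 1 `
      base_change_back ` line_elements base_point int_lattice (2 * ?v)"
    by (simp only: half_twist_def[abs_def] image_image alpha_eq alpha_elements_def)
  also have "base_change_back ` line_elements base_point int_lattice (2 * ?v)
      = line_elements axis_point int_lattice (2 * ?v)"
    using transport_line_elements[OF lattice_symmetry_id base_change_inverse_arrow v subset_refl] by simp
  also have "shear_action 1 ` line_elements axis_point int_lattice (2 * ?v) = line_elements axis_point int_lattice (2 * shear 1 ?v)"
    using transport_line_elements[OF shear_symmetry[of 1] shear_fixes_seg v subset_refl lattice_symmetry_lattice[OF shear_symmetry]]
    unfolding s .
  also have "base_change ` line_elements axis_point int_lattice (2 * shear 1 ?v) = alpha_elements (shear 1 ?v)"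
    using transport_line_elements[OF lattice_symmetry_id base_axis_arrow w subset_refl] by (simp add: alpha_elements_def)
  finally show ?thesis .
qed

lemma half_twist_alpha_slope: "half_twist ` alpha s = alpha (map_option (\<lambda>x. x + 1) s)"
proof -
  obtain a b where s: "num_den s = (a, b)" "coprime a b" "s = slope_of a b" by (rule num_denE)
  have "map_option (\<lambda>x. x + 1) s = slope_of (a + b) b" unfolding s(3) by (simp add: slope_of_def field_simps)
  moreover have "coprime (a + b) b" using s(2) unfolding coprime_iff_gcd_eq_1 gcd_add1 .
  ultimately have "alpha (map_option (\<lambda>x. x + 1) s) = alpha_elements (Complex (of_int b) (of_int (a + b)))"
    using alpha_slope_of by metis
  moreover have "Complex (of_int b) (of_int (a + b)) = shear 1 (slope_vector s)"
    unfolding slope_vector_eq[OF s(1)] by (simp add: shear_def)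
  ultimately show ?thesis using half_twist_alpha by simp
qed

lemma rot_E_mult_pred: "rot_E (j + 1) \<otimes>\<^bsub>pi1_A\<^esub> rot_E j = inv\<^bsub>pi1_A\<^esub> down"
proof -
  interpret group pi1_A by (rule group_pi1_A)
  have "inv\<^bsub>pi1_A\<^esub> rot_E i = rot_E i" for i using inv_equality[OF rot_E_square rot_carrier(2) rot_carrier(2)] .
  then show ?thesis unfolding rot_E_mult_Suc[of j, symmetric] by (simp add: inv_mult_group rot_carrier(2))
qed

lemma half_twist_meridian_0: "half_twist (meridian 0) = meridian 0"
proof -
  interpret group pi1_A by (rule group_pi1_A)
  note h = hom_mult[OF transport_hom[OF shear_symmetry shear_fixes_seg, of 1]] and c = rot_carrier
  have "shear_action 1 (rot_R \<otimes>\<^bsub>pi1_A\<^esub> (rot_E 1 \<otimes>\<^bsub>pi1_A\<^esub> rot_E 0)) = rot_R \<otimes>\<^bsub>pi1_A\<^esub> (rot_E (1 + 1) \<otimes>\<^bsub>pi1_A\<^esub> rot_E (0 + 1))"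
    using h[OF c(1) m_closed[OF c(2) c(2)], of 1 0] h[OF c(2) c(2), of 1 0]
    unfolding shear_action_rot_R shear_action_rot_E by simp
  also have "\<dots> = rot_R \<otimes>\<^bsub>pi1_A\<^esub> (rot_E 1 \<otimes>\<^bsub>pi1_A\<^esub> rot_E 0)"
    using rot_E_mult_pred[of 1] rot_E_mult_pred[of 0] by simp
  finally show ?thesis
    unfolding meridian_0 using half_twist_base_change c by simp
qed

lemma meridians_pi1_S: "meridian 0 \<in> carrier pi1_S" "meridian 1 \<in> carrier pi1_S"
proof -
  interpret group pi1_A by (rule group_pi1_A)
  have "meridian 0 \<in> carrier pi1_O" "meridian 1 \<in> carrier pi1_O"
    unfolding meridian_0 meridian_1 using hom_in_carrier[OF base_change_hom] rot_carrier by simp_all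
  then show "meridian 0 \<in> carrier pi1_S" "meridian 1 \<in> carrier pi1_S" using meridian_pi1_S by auto
qed

text \<open>With \<open>E\<^sub>j = rot_E j\<close> and \<open>R = rot_R\<close>, the meridian is \<open>E\<^sub>0 R E\<^sub>1\<close> and its image is \<open>E\<^sub>1 R E\<^sub>2\<close>. Modulo
  \<open>\<beta>\<^sub>\<infinity>\<^sup>2\<close> this is \<open>E\<^sub>1 R E\<^sub>0\<close>, the inverse of the meridian.\<close>

lemma half_twist_meridian_1:
  assumes K: "K \<lhd> pi1_O" and b: "\<forall>x\<in>beta None. x [^]\<^bsub>pi1_O\<^esub> (2::nat) \<in> K"
  shows "K #>\<^bsub>pi1_O\<^esub> half_twist (meridian 1) = K #>\<^bsub>pi1_O\<^esub> inv\<^bsub>pi1_S\<^esub> meridian 1"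
proof -
  interpret A: group pi1_A by (rule group_pi1_A)
  interpret K: normal K pi1_O by (rule K)
  interpret bc: group_hom pi1_A pi1_O base_change
    using base_change_hom group_pi1_A group_pi1_O by (simp add: group_hom_def group_hom_axioms_def)
  note h = hom_mult[OF transport_hom[OF shear_symmetry shear_fixes_seg, of 1]] and c = rot_carrier
  let ?x = "rot_E 0 \<otimes>\<^bsub>pi1_A\<^esub> (rot_R \<otimes>\<^bsub>pi1_A\<^esub> rot_E 1)" and ?y = "rot_E 1 \<otimes>\<^bsub>pi1_A\<^esub> (rot_R \<otimes>\<^bsub>pi1_A\<^esub> rot_E 0)"
  let ?d = "down [^]\<^bsub>pi1_A\<^esub> (2::nat)"
  have dc: "?d \<in> carrier pi1_A" using down_carrier by simp
  have y: "?y \<in> carrier pi1_A" using c by simp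
  have invE: "inv\<^bsub>pi1_A\<^esub> rot_E i = rot_E i" for i using A.inv_equality[OF rot_E_square c(2) c(2)] .
  have invR: "inv\<^bsub>pi1_A\<^esub> rot_R = rot_R" using A.inv_equality[OF rot_R_square c(1) c(1)] .
  have inv: "inv\<^bsub>pi1_A\<^esub> ?x = ?y" using c by (simp add: A.inv_mult_group invE invR A.m_assoc)
  have "shear_action 1 ?x = rot_E (0 + 1) \<otimes>\<^bsub>pi1_A\<^esub> (rot_R \<otimes>\<^bsub>pi1_A\<^esub> rot_E (1 + 1))"
    using h[OF c(2) A.m_closed[OF c], of 0 1] h[OF c, of 1] unfolding shear_action_rot_R shear_action_rot_E by simp
  also have "rot_E (1 + 1) = rot_E 0 \<otimes>\<^bsub>pi1_A\<^esub> ?d" using rot_E_add[of 0 2] by simp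
  also have "rot_E (0 + 1) \<otimes>\<^bsub>pi1_A\<^esub> (rot_R \<otimes>\<^bsub>pi1_A\<^esub> (rot_E 0 \<otimes>\<^bsub>pi1_A\<^esub> ?d)) = ?y \<otimes>\<^bsub>pi1_A\<^esub> ?d"
    using c dc by (simp add: A.m_assoc)
  finally have sx: "shear_action 1 ?x = ?y \<otimes>\<^bsub>pi1_A\<^esub> ?d" .
  have "base_change ` line_elements axis_point half_lattice \<i> = line_elements base_point half_lattice \<i>"
    using transport_line_elements[OF lattice_symmetry_id base_axis_arrow int_lattice_ii half_lattice_superset] by simp
  then have "base_change down \<in> beta None"
    using down_in_beta_infinity unfolding beta_eq beta_elements_def slope_vector_infinity by blast
  then have dK: "base_change ?d \<in> K" using b bc.hom_nat_pow[OF down_carrier] by simp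
  have "half_twist (meridian 1) = base_change ?y \<otimes>\<^bsub>pi1_O\<^esub> base_change ?d"
    unfolding meridian_1 using half_twist_base_change[of ?x] sx bc.hom_mult[OF y dc] c by simp
  then have "K #>\<^bsub>pi1_O\<^esub> half_twist (meridian 1) = K #>\<^bsub>pi1_O\<^esub> base_change ?y"
    using K.r_coset_absorb(1)[OF bc.hom_closed[OF y] dK] by simp
  also have "base_change ?y = inv\<^bsub>pi1_O\<^esub> meridian 1"
    unfolding meridian_1 inv[symmetric] by (rule bc.hom_inv) (use c in simp)
  also have "\<dots> = inv\<^bsub>pi1_S\<^esub> meridian 1"
    using K.m_inv_consistent[OF pi1_S_subgroup meridians_pi1_S(2)] unfolding pi1_S_restrict[symmetric] by simp
  finally show ?thesis .
qed

theorem theorem2p3: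
  fixes r n :: rat and s :: "rat option"
  assumes "n > 1" and "2 * n \<in> \<int>"
    and "s \<in> Gamma_orbit r n None \<or> map_option (\<lambda>x. x + 1) s \<in> Gamma_orbit r n None"
  shows "\<exists>f. f \<in> epi (link_group s) (heckoid_group r n) \<and> upper_meridian_pair_preserving s r n f"
proof -
  let ?K = "heckoid_kernel r n"
  note K = heckoid_kernel_properties[OF assms(1,2), of r]
  have orbit: "alpha t \<subseteq> ?K" if "t \<in> Gamma_orbit r n None" for t
    using alpha_orbit[OF K(1,3,4) that] K(2) by simp
  note induced = induced_epimorphism[OF assms(1,2) _ _ _ meridians_pi1_S]
  from assms(3) show ?thesis
  proof
    assume s: "s \<in> Gamma_orbit r n None"
    show ?thesis
    proof (rule induced[where f = "\<lambda>x. x"])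
      show "(\<lambda>x. x) ` (alpha None \<union> alpha s) \<subseteq> ?K" using orbit[OF s] K(2) by simp
    qed (simp_all add: hom_def monoid.m_closed[OF group.is_monoid[OF group_pi1_S]])
  next
    assume s: "map_option (\<lambda>x. x + 1) s \<in> Gamma_orbit r n None"
    show ?thesis
    proof (rule induced[OF half_twist_hom_S half_twist_image_S])
      show "half_twist ` (alpha None \<union> alpha s) \<subseteq> ?K"
        unfolding image_Un half_twist_alpha_slope using orbit[OF s] K(2) by simp
    qed (simp_all add: half_twist_meridian_0 half_twist_meridian_1[OF K(1,3)])
  qed
qed

end
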